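(* Let $G$ be a Riemannian metric on the manifold of shapes $B_e$, let $f$ be a real-valued (twice shape differentiable) function of shapes, let $\Omega\subset\mathbb{R}^2$ be a shape, and let $V,W\in C^\infty(\mathbb{R}^2,\mathbb{R}^2)$ be vector fields which are orthogonal to the boundary, i.e. $V|_{\partial\Omega}=\langle V|_{\partial\Omega},\vec{n}\rangle\vec{n}$ and $W|_{\partial\Omega}=\langle W|_{\partial\Omega},\vec{n}\rangle\vec{n}$. Then the Riemannian shape Hessian based on $G$ satisfies $$G(\mathrm{Hess}f(\Omega)[V],W)=d(df(\Omega)[W])[V]-df(\Omega)[\nabla_VW],$$ where $d(df(\Omega)[W])[V]$ denotes the standard shape Hessian. Furthermore, the following symmetry holds: $$G(\mathrm{Hess}f(\Omega)[V],W)=G(V,\mathrm{Hess}f(\Omega)[W]).$$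
   Context: A shape is a nonempty, simply connected, compact subset $\Omega\subset\mathbb{R}^2$ with $C^\infty$ boundary $\partial\Omega$; it is identified with its boundary curve $c=\partial\Omega$. The set of all shapes is the manifold $B_e=B_e(S^1,\mathbb{R}^2):=\mathrm{Emb}(S^1,\mathbb{R}^2)/\mathrm{Diff}(S^1)$ ($C^\infty$ embeddings of the unit circle into the plane modulo $C^\infty$ reparametrizations), with tangent space $T_cB_e\cong\{h\mid h=\alpha\vec{n},\ \alpha\in C^\infty(S^1,\mathbb{R})\}$, where $\vec{n}$ is the unit exterior normal field of $\Omega$ on $\partial\Omega=c$. Vector fields $V,W$ orthogonal to $\partial\Omega$ are identified with the tangent vectors $V|_{\partial\Omega},W|_{\partial\Omega}\in T_cB_e$. The shape derivative $df(\Omega)[V]$ is the directional derivative of $f$ at $\Omega$ in direction of the vector field $V$; a tangent vector $h\in T_cB_e$ acts on a scalar function $f$ on $B_e$ by $h(f)(c)=df(\Omega)[V]$ for any $C^\infty$ extension $V$ of $h$, $V|_{\partial\Omega}=h$. The standard shape Hessian $d(df(\Omega)[W])[V]$ is defined by repeated shape differentiation: it is the shape derivative in direction $V$ of $\Omega\mapsto df(\Omega)[W]$. $\mathrm{grad}f$ is the Riemannian gradient, i.e. $G(\mathrm{grad}f,h)=h(f)$ for all $h\in T_cB_e$. $\nabla$ is the covariant derivative (Riemannian, i.e. metric compatible and torsion free, connection) associated with $G$, and $\nabla_VW:=\nabla_hk$ for $h=V|_{\partial\Omega}$, $k=W|_{\partial\Omega}$. The Riemannian shape Hessian is defined by $\mathrm{Hess}f(\Omega)[V]:=\nabla_V\mathrm{grad}f$.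 *)

theory Defs
  imports "HOL-Analysis.Analysis"
begin

section \<open>Smooth maps and the Frechet space of smooth loops\<close>

type_synonym plane = "real ^ 2"

(* For a Euclidean domain this is the usual class C^k on the whole space. *)
fun Ck :: "nat \<Rightarrow> ('a::real_normed_vector \<Rightarrow> 'b::real_normed_vector) \<Rightarrow> bool" where
  "Ck 0 f = continuous_on UNIV f"
| "Ck (Suc k) f = ((\<forall>x. f differentiable (at x)) \<and> (\<forall>v. Ck k (\<lambda>x. frechet_derivative f (at x) v)))"

definition smooth :: "('a::real_normed_vector \<Rightarrow> 'b::real_normed_vector) \<Rightarrow> bool" where
  "smooth f \<longleftrightarrow> (\<forall>k. Ck k f)"

lemma Ck_const: "Ck k (\<lambda>x. c)"
  by (induction k arbitrary: c) (auto simp: frechet_derivative_const)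

lemma Ck_add: "Ck k f \<Longrightarrow> Ck k g \<Longrightarrow> Ck k (\<lambda>x. f x + g x)"
proof (induction k arbitrary: f g)
  case 0
  then show ?case by (auto intro: continuous_intros)
next
  case (Suc k)
  then have "frechet_derivative (\<lambda>x. f x + g x) (at x) v
      = frechet_derivative f (at x) v + frechet_derivative g (at x) v" for x v
    by (subst frechet_derivative_at[OF has_derivative_add[OF
        frechet_derivative_works[THEN iffD1] frechet_derivative_works[THEN iffD1]], symmetric]) auto
  with Suc show ?case by (auto intro: differentiable_add)
qed

lemma Ck_scaleR: "Ck k f \<Longrightarrow> Ck k (\<lambda>x. r *\<^sub>R f x)"
proof (induction k arbitrary: f)
  case 0
  then show ?case by (auto intro: continuous_intros)
next
  case (Suc k)
  then have "frechet_derivative (\<lambda>x. r *\<^sub>R f x) (at x) v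
      = r *\<^sub>R frechet_derivative f (at x) v" for x v
    by (subst frechet_derivative_at[OF has_derivative_scaleR_right[OF
        frechet_derivative_works[THEN iffD1]], symmetric]) auto
  with Suc show ?case by auto
qed

lemma smooth_const: "smooth (\<lambda>x. c)"
  by (simp add: smooth_def Ck_const)

lemma smooth_add: "smooth f \<Longrightarrow> smooth g \<Longrightarrow> smooth (\<lambda>x. f x + g x)"
  by (simp add: smooth_def Ck_add)

lemma smooth_scaleR: "smooth f \<Longrightarrow> smooth (\<lambda>x. r *\<^sub>R f x)"
  by (simp add: smooth_def Ck_scaleR)

(* Functions on the unit circle are represented by functions of the angle. *)
definition periodic :: "(real \<Rightarrow> 'a) \<Rightarrow> bool" where
  "periodic \<gamma> \<longleftrightarrow> (\<forall>\<theta>. \<gamma> (\<theta> + 2 * pi) = \<gamma> \<theta>)"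

typedef loop = "{\<gamma> :: real \<Rightarrow> plane. smooth \<gamma> \<and> periodic \<gamma>}"
  morphisms at_angle Abs_loop
  by (rule exI[of _ "\<lambda>_. 0"]) (simp add: smooth_const periodic_def)

setup_lifting type_definition_loop

instantiation loop :: real_vector
begin

lift_definition zero_loop :: loop is "\<lambda>_. 0"
  by (simp add: smooth_const periodic_def)

lift_definition plus_loop :: "loop \<Rightarrow> loop \<Rightarrow> loop" is "\<lambda>\<gamma> \<delta> \<theta>. \<gamma> \<theta> + \<delta> \<theta>"
  by (simp add: smooth_add periodic_def)

lift_definition scaleR_loop :: "real \<Rightarrow> loop \<Rightarrow> loop" is "\<lambda>r \<gamma> \<theta>. r *\<^sub>R \<gamma> \<theta>"
  by (simp add: smooth_scaleR periodic_def)

lift_definition uminus_loop :: "loop \<Rightarrow> loop" is "\<lambda>\<gamma> \<theta>. - \<gamma> \<theta>"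
  using smooth_scaleR[of _ "-1"] by (fastforce simp: periodic_def)

definition minus_loop :: "loop \<Rightarrow> loop \<Rightarrow> loop" where
  "minus_loop \<gamma> \<delta> = \<gamma> + - \<delta>"

instance
  by standard (simp_all add: minus_loop_def, (transfer, auto simp: algebra_simps)+)

end

definition angle_deriv :: "nat \<Rightarrow> loop \<Rightarrow> real \<Rightarrow> plane" where
  "angle_deriv j \<gamma> = ((\<lambda>g \<theta>. vector_derivative g (at \<theta>)) ^^ j) (at_angle \<gamma>)"

(* The Frechet topology: uniform convergence of all derivatives. *)
instantiation loop :: topological_space
begin

definition open_loop :: "loop set \<Rightarrow> bool" where
  "open_loop U \<longleftrightarrow> (\<forall>\<gamma>\<in>U. \<exists>k. \<exists>e>0. \<forall>\<delta>.
     (\<forall>j\<le>k. \<forall>\<theta>. dist (angle_deriv j \<delta> \<theta>) (angle_deriv j \<gamma> \<theta>) < e) \<longrightarrow> \<delta> \<in> U)"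

instance
proof
  show "open (UNIV :: loop set)"
    by (auto simp: open_loop_def intro: exI[of _ 1])
next
  fix S T :: "loop set"
  assume S: "open S" and T: "open T"
  show "open (S \<inter> T)"
    unfolding open_loop_def
  proof
    fix \<gamma> assume g: "\<gamma> \<in> S \<inter> T"
    obtain k e where 1: "e > 0" "\<And>\<delta>. (\<forall>j\<le>k. \<forall>\<theta>. dist (angle_deriv j \<delta> \<theta>) (angle_deriv j \<gamma> \<theta>) < e) \<Longrightarrow> \<delta> \<in> S"
      using S g unfolding open_loop_def by blast
    obtain l d where 2: "d > 0" "\<And>\<delta>. (\<forall>j\<le>l. \<forall>\<theta>. dist (angle_deriv j \<delta> \<theta>) (angle_deriv j \<gamma> \<theta>) < d) \<Longrightarrow> \<delta> \<in> T"
      using T g unfolding open_loop_def by blast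
    show "\<exists>k. \<exists>e>0. \<forall>\<delta>.
       (\<forall>j\<le>k. \<forall>\<theta>. dist (angle_deriv j \<delta> \<theta>) (angle_deriv j \<gamma> \<theta>) < e) \<longrightarrow> \<delta> \<in> S \<inter> T"
      using 1 2 by (intro exI[of _ "max k l"] exI[of _ "min e d"]) auto
  qed
next
  fix K :: "loop set set"
  assume "\<forall>S\<in>K. open S"
  then show "open (\<Union>K)"
    unfolding open_loop_def by (meson Union_iff)
qed

end

(* Class C^k in the sense of Hamilton and Milnor (Michal-Bastiani) on an open set U of a
   topological vector space: D j x v is the iterated directional derivative of F at x in the
   directions v 0, ..., v (j - 1), and it is jointly continuous in the point and the directions. *)
definition Ck_on ::
  "nat \<Rightarrow> 'e::{real_vector,topological_space} set \<Rightarrow> ('e \<Rightarrow> 'f::{real_vector,topological_space}) \<Rightarrow> bool"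
where
  "Ck_on k U F \<longleftrightarrow> (\<exists>D :: nat \<Rightarrow> 'e \<Rightarrow> (nat \<Rightarrow> 'e) \<Rightarrow> 'f.
     (\<forall>x\<in>U. \<forall>v. D 0 x v = F x) \<and>
     (\<forall>j<k. \<forall>x\<in>U. \<forall>v.
        ((\<lambda>t. (D j (x + t *\<^sub>R v j) v - D j x v) /\<^sub>R t) \<longlongrightarrow> D (Suc j) x v) (at 0)) \<and>
     (\<forall>j\<le>k. continuous_on (U \<times> UNIV) (\<lambda>(x, v). D j x v)))"


section \<open>The manifold of shapes\<close>

definition Emb :: "loop set" where
  "Emb = {\<gamma>. inj_on (at_angle \<gamma>) {0..<2 * pi} \<and> (\<forall>\<theta>. angle_deriv 1 \<gamma> \<theta> \<noteq> 0)}"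

definition curve :: "loop \<Rightarrow> plane set" where
  "curve \<gamma> = range (at_angle \<gamma>)"

(* Two embeddings of the circle differ by a diffeomorphism of the circle iff they have the same
   image, so Emb / Diff is realised as the set of image curves. *)
definition Be :: "plane set set" where
  "Be = curve ` Emb"

definition shape :: "plane set \<Rightarrow> bool" where
  "shape \<Omega> \<longleftrightarrow> \<Omega> \<noteq> {} \<and> simply_connected \<Omega> \<and> compact \<Omega> \<and> frontier \<Omega> \<in> Be"

(* outside c is the unbounded component of the complement, i.e. the complement of the shape
   bounded by c. *)
definition ext_normal :: "plane set \<Rightarrow> plane \<Rightarrow> plane" where
  "ext_normal c x = (THE n. norm n = 1 \<and>
     (\<forall>\<gamma>\<in>Emb. \<forall>\<theta>. curve \<gamma> = c \<and> at_angle \<gamma> \<theta> = x \<longrightarrow> n \<bullet> angle_deriv 1 \<gamma> \<theta> = 0) \<and>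
     (\<forall>\<^sub>F t in at_right 0. x + t *\<^sub>R n \<in> outside c))"

(* Tangent vectors are normal fields along c; as functions on the plane they vanish off c. *)
definition tangent_space :: "plane set \<Rightarrow> (plane \<Rightarrow> plane) set" where
  "tangent_space c = {h. (\<forall>x. x \<notin> c \<longrightarrow> h x = 0) \<and>
     (\<forall>\<gamma>\<in>Emb. curve \<gamma> = c \<longrightarrow> (\<exists>\<alpha> :: real \<Rightarrow> real. smooth \<alpha> \<and> periodic \<alpha> \<and>
        (\<forall>\<theta>. h (at_angle \<gamma> \<theta>) = \<alpha> \<theta> *\<^sub>R ext_normal c (at_angle \<gamma> \<theta>))))}"

definition restrict_to :: "plane set \<Rightarrow> (plane \<Rightarrow> plane) \<Rightarrow> plane \<Rightarrow> plane" where
  "restrict_to c V = (\<lambda>x. if x \<in> c then V x else 0)"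

definition orthogonal_to_curve :: "plane set \<Rightarrow> (plane \<Rightarrow> plane) \<Rightarrow> bool" where
  "orthogonal_to_curve c V \<longleftrightarrow> (\<forall>x\<in>c. V x = (V x \<bullet> ext_normal c x) *\<^sub>R ext_normal c x)"

(* The differential at \<gamma> of the projection Emb \<rightarrow> Be: an arbitrary field a along \<gamma>
   is sent to its normal part. *)
definition project_tangent :: "loop \<Rightarrow> loop \<Rightarrow> plane \<Rightarrow> plane" where
  "project_tangent \<gamma> a = restrict_to (curve \<gamma>) (\<lambda>x.
     (at_angle a (inv_into {0..<2 * pi} (at_angle \<gamma>) x) \<bullet> ext_normal (curve \<gamma>) x)
       *\<^sub>R ext_normal (curve \<gamma>) x)"

type_synonym shape_functional = "plane set \<Rightarrow> real"
type_synonym shape_field = "plane set \<Rightarrow> plane \<Rightarrow> plane"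
type_synonym shape_metric = "plane set \<Rightarrow> (plane \<Rightarrow> plane) \<Rightarrow> (plane \<Rightarrow> plane) \<Rightarrow> real"

(* Regularity on Be is regularity of the lift to the open subset Emb of the space of loops;
   Emb \<rightarrow> Be is a submersion. *)
definition Ck_functional :: "nat \<Rightarrow> shape_functional \<Rightarrow> bool" where
  "Ck_functional k f \<longleftrightarrow> Ck_on k Emb (\<lambda>\<gamma>. f (curve \<gamma>))"

abbreviation twice_shape_differentiable :: "shape_functional \<Rightarrow> bool" where
  "twice_shape_differentiable \<equiv> Ck_functional 2"

definition C1_field :: "shape_field \<Rightarrow> bool" where
  "C1_field X \<longleftrightarrow> (\<forall>c\<in>Be. X c \<in> tangent_space c) \<and>
     Ck_on 1 Emb (\<lambda>\<gamma>. Abs_loop (\<lambda>\<theta>. X (curve \<gamma>) (at_angle \<gamma> \<theta>)))"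

(* A vector field W on the plane induces on Be the vector field given by its normal parts. *)
definition induced_field :: "(plane \<Rightarrow> plane) \<Rightarrow> shape_field" where
  "induced_field W = (\<lambda>c. restrict_to c (\<lambda>x. (W x \<bullet> ext_normal c x) *\<^sub>R ext_normal c x))"


section \<open>Shape calculus\<close>

(* Directional derivative with respect to the perturbation of identity x \<mapsto> x + t V(x). *)
definition shape_deriv :: "shape_functional \<Rightarrow> plane set \<Rightarrow> (plane \<Rightarrow> plane) \<Rightarrow> real" where
  "shape_deriv f c V = deriv (\<lambda>t. f ((\<lambda>x. x + t *\<^sub>R V x) ` c)) 0"

(* Only the values of V on c matter. Hence a tangent vector h acts by h(f)(c) = shape_deriv f c h,
   which equals shape_deriv f c V for every extension V of h. *)
lemma shape_deriv_extension:
  assumes "restrict_to c V = h"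
  shows "shape_deriv f c V = shape_deriv f c h"
proof -
  have "(\<lambda>x. x + t *\<^sub>R V x) ` c = (\<lambda>x. x + t *\<^sub>R h x) ` c" for t
    using assms by (auto simp: restrict_to_def intro!: image_cong)
  then show ?thesis by (simp add: shape_deriv_def)
qed

(* d(df(c)[W])[V] *)
definition shape_hessian ::
  "shape_functional \<Rightarrow> plane set \<Rightarrow> (plane \<Rightarrow> plane) \<Rightarrow> (plane \<Rightarrow> plane) \<Rightarrow> real" where
  "shape_hessian f c W V = shape_deriv (\<lambda>c'. shape_deriv f c' W) c V"

definition field_action :: "shape_field \<Rightarrow> shape_functional \<Rightarrow> shape_functional" where
  "field_action X f = (\<lambda>c. shape_deriv f c (X c))"


section \<open>Riemannian structure\<close>

definition riemannian_metric :: "shape_metric \<Rightarrow> bool" where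
  "riemannian_metric G \<longleftrightarrow>
     (\<forall>c\<in>Be. \<forall>h\<in>tangent_space c. \<forall>k\<in>tangent_space c. \<forall>l\<in>tangent_space c. \<forall>a b.
        G c (\<lambda>x. a *\<^sub>R h x + b *\<^sub>R k x) l = a * G c h l + b * G c k l) \<and>
     (\<forall>c\<in>Be. \<forall>h\<in>tangent_space c. \<forall>k\<in>tangent_space c. G c h k = G c k h) \<and>
     (\<forall>c\<in>Be. \<forall>h\<in>tangent_space c. h \<noteq> (\<lambda>_. 0) \<longrightarrow> G c h h > 0) \<and>
     (\<forall>k. Ck_on k (Emb \<times> UNIV)
        (\<lambda>(\<gamma>, a, b). G (curve \<gamma>) (project_tangent \<gamma> a) (project_tangent \<gamma> b)))"

(* nabla c h X is the covariant derivative at c of the field X in direction of the tangent vector h. *)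
type_synonym shape_connection = "plane set \<Rightarrow> (plane \<Rightarrow> plane) \<Rightarrow> shape_field \<Rightarrow> plane \<Rightarrow> plane"

definition covariant_derivative :: "shape_connection \<Rightarrow> bool" where
  "covariant_derivative nabla \<longleftrightarrow>
     (\<forall>c\<in>Be. \<forall>h\<in>tangent_space c. \<forall>X. C1_field X \<longrightarrow>
        nabla c h X \<in> tangent_space c) \<and>
     (\<forall>c\<in>Be. \<forall>h\<in>tangent_space c. \<forall>k\<in>tangent_space c. \<forall>a b. \<forall>X. C1_field X \<longrightarrow>
        nabla c (\<lambda>x. a *\<^sub>R h x + b *\<^sub>R k x) X = (\<lambda>x. a *\<^sub>R nabla c h X x + b *\<^sub>R nabla c k X x)) \<and>
     (\<forall>c\<in>Be. \<forall>h\<in>tangent_space c. \<forall>X Y. C1_field X \<longrightarrow> C1_field Y \<longrightarrow>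
        nabla c h (\<lambda>c' x. X c' x + Y c' x) = (\<lambda>x. nabla c h X x + nabla c h Y x)) \<and>
     (\<forall>c\<in>Be. \<forall>h\<in>tangent_space c. \<forall>X \<phi>. C1_field X \<longrightarrow> Ck_functional 1 \<phi> \<longrightarrow>
        nabla c h (\<lambda>c' x. \<phi> c' *\<^sub>R X c' x)
          = (\<lambda>x. shape_deriv \<phi> c h *\<^sub>R X c x + \<phi> c *\<^sub>R nabla c h X x))"

definition metric_compatible :: "shape_metric \<Rightarrow> shape_connection \<Rightarrow> bool" where
  "metric_compatible G nabla \<longleftrightarrow>
     (\<forall>X Y. C1_field X \<longrightarrow> C1_field Y \<longrightarrow> (\<forall>c\<in>Be. \<forall>h\<in>tangent_space c.
        shape_deriv (\<lambda>c'. G c' (X c') (Y c')) c h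
          = G c (nabla c h X) (Y c) + G c (X c) (nabla c h Y)))"

(* [X,Y] g = X (Y g) - Y (X g) *)
definition is_lie_bracket :: "shape_field \<Rightarrow> shape_field \<Rightarrow> shape_field \<Rightarrow> bool" where
  "is_lie_bracket X Y Z \<longleftrightarrow> (\<forall>c\<in>Be. Z c \<in> tangent_space c) \<and>
     (\<forall>g. Ck_functional 2 g \<longrightarrow> (\<forall>c\<in>Be.
        field_action Z g c = field_action X (field_action Y g) c - field_action Y (field_action X g) c))"

definition torsion_free :: "shape_connection \<Rightarrow> bool" where
  "torsion_free nabla \<longleftrightarrow> (\<forall>X Y. C1_field X \<longrightarrow> C1_field Y \<longrightarrow>
     is_lie_bracket X Y (\<lambda>c x. nabla c (X c) Y x - nabla c (Y c) X x))"

definition riemannian_connection :: "shape_metric \<Rightarrow> shape_connection \<Rightarrow> bool" where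
  "riemannian_connection G nabla \<longleftrightarrow>
     covariant_derivative nabla \<and> metric_compatible G nabla \<and> torsion_free nabla"

definition is_gradient :: "shape_metric \<Rightarrow> shape_functional \<Rightarrow> shape_field \<Rightarrow> bool" where
  "is_gradient G f X \<longleftrightarrow> C1_field X \<and>
     (\<forall>c\<in>Be. \<forall>h\<in>tangent_space c. G c (X c) h = shape_deriv f c h)"

(* For plane vector fields V, W. Away from c, the field W is continued to Be by its normal parts,
   so that the resulting field k satisfies k(f)(c') = df(c')[W] for all c'. *)
definition nabla_plane ::
  "shape_connection \<Rightarrow> plane set \<Rightarrow> (plane \<Rightarrow> plane) \<Rightarrow> (plane \<Rightarrow> plane) \<Rightarrow> plane \<Rightarrow> plane" where
  "nabla_plane nabla c V W = nabla c (restrict_to c V) (induced_field W)"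

definition riemannian_shape_hessian ::
  "shape_connection \<Rightarrow> shape_field \<Rightarrow> plane set \<Rightarrow> (plane \<Rightarrow> plane) \<Rightarrow> plane \<Rightarrow> plane" where
  "riemannian_shape_hessian nabla gradf c V = nabla c (restrict_to c V) gradf"

end

theory Submission
  imports Defs
begin

text \<open>
The theorem is a computation with the Levi-Civita connection. Let \<open>c\<close> be the boundary curve and let
\<open>X\<close>, \<open>Y\<close> be the fields on \<open>Be\<close> that \<open>V\<close>, \<open>W\<close> induce by their normal parts. Metric compatibility at
\<open>c\<close> in direction \<open>X c\<close> gives
\<open>X (G(gradf, Y)) = G(\<nabla>\<^sub>X gradf, Y) + G(gradf, \<nabla>\<^sub>X Y)\<close>. The last term is \<open>df[\<nabla>\<^sub>X Y]\<close>, and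
\<open>G(gradf, Y) = df[Y]\<close>. If this function agrees on all of \<open>Be\<close> with \<open>c' \<mapsto> df(c')[W]\<close>, the left-hand
side is the standard shape Hessian and the formula follows. Symmetry follows from it because
absence of torsion states that the difference of the two mixed second derivatives of \<open>f\<close> is
\<open>df[\<nabla>\<^sub>X Y - \<nabla>\<^sub>Y X]\<close>.

Three facts justify this computation.

First, the normal part of a smooth plane field is a \<open>C\<^sup>1\<close> field on \<open>Be\<close> (\<open>C1_field_induced_field\<close>).
The exterior normal has to be identified, up to one global sign, with the rotated unit velocity
(\<open>ext_normal_curve\<close>). A thin tube around an embedded curve consists of the curve and two
connected halves, and by the Jordan-Brouwer theorem exactly one half lies outside the curve
(\<open>Emb_sides\<close>). The dependence of the normal part on the curve is then differentiated in the Frechet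
topology by a small calculus of operators (\<open>C1_operator\<close>), which rests on the convergence, with all
derivatives, of difference quotients of superposition operators
(\<open>smooth_limit_difference_quotient\<close>).

Secondly, the first shape derivative ignores tangential parts (\<open>shape_deriv_induced_field\<close>). The
curves moved by the normal part of \<open>W\<close> can be reparametrized so that the path of loops has initial
velocity \<open>W\<close> along the curve, and a \<open>C\<^sup>1\<close> functional may be differentiated along such a path
(\<open>derivative_along_path\<close>).

Thirdly, embeddings form an open set of loops (\<open>open_Emb\<close>), so identities between functionals on
\<open>Be\<close> can be differentiated (\<open>shape_deriv_cong\<close>).
\<close>

section \<open>Smooth functions and the symmetry of second derivatives\<close>

text \<open>The derivative of a function of one real variable, as a function.\<close>

abbreviation vd :: "(real \<Rightarrow> 'b::real_normed_vector) \<Rightarrow> real \<Rightarrow> 'b" where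
  "vd g \<equiv> \<lambda>\<theta>. vector_derivative g (at \<theta>)"

lemma Ck_Suc_imp_Ck: "Ck (Suc k) f \<Longrightarrow> Ck k f"
proof (induction k arbitrary: f)
  case 0
  then show ?case by (auto intro!: differentiable_imp_continuous_on simp: differentiable_on_def differentiable_at_withinI)
qed auto

lemma smooth_differentiable: "smooth f \<Longrightarrow> f differentiable (at x)"
  unfolding smooth_def by (metis Ck.simps(2))

lemma smooth_has_derivative: "smooth f \<Longrightarrow> (f has_derivative frechet_derivative f (at x)) (at x)"
  using smooth_differentiable frechet_derivative_works by blast

lemma smooth_frechet_derivative: "smooth f \<Longrightarrow> smooth (\<lambda>x. frechet_derivative f (at x) v)"
  unfolding smooth_def by (metis Ck.simps(2))

lemma smooth_continuous_on: "smooth f \<Longrightarrow> continuous_on S f"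
  by (meson smooth_def Ck.simps(1) continuous_on_subset subset_UNIV)

lemma smooth_has_vector_derivative: "smooth g \<Longrightarrow> (g has_vector_derivative vd g \<theta>) (at \<theta>)"
  by (simp add: smooth_differentiable vector_derivative_works[symmetric])

text \<open>In one real variable the directional derivatives in the definition of \<open>Ck\<close> are multiples of
the ordinary derivative, so it suffices to follow the latter.\<close>

lemma Ck_Suc_real:
  fixes g :: "real \<Rightarrow> 'b::real_normed_vector"
  shows "Ck (Suc k) g \<longleftrightarrow> (\<forall>\<theta>. g differentiable (at \<theta>)) \<and> Ck k (vd g)"
proof -
  have *: "frechet_derivative g (at \<theta>) v = v *\<^sub>R vd g \<theta>" if "g differentiable (at \<theta>)" for \<theta> v
    using that frechet_derivative_at has_vector_derivative_def vector_derivative_works by metis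
  show ?thesis
  proof (cases "\<forall>\<theta>. g differentiable (at \<theta>)")
    case True
    then have eq: "(\<lambda>x. frechet_derivative g (at x) v) = (\<lambda>x. v *\<^sub>R vd g x)" for v
      using * by blast
    show ?thesis
      unfolding Ck.simps(2) eq using True Ck_scaleR by (metis (no_types, lifting) ext scaleR_one)
  next
    case False
    then show ?thesis unfolding Ck.simps(2) by blast
  qed
qed

lemma smooth_vd: "smooth g \<Longrightarrow> smooth (vd g)"
  unfolding smooth_def by (metis Ck_Suc_real)

lemma Ck_bounded_linear:
  assumes "bounded_linear L" "Ck k f"
  shows "Ck k (\<lambda>x. L (f x))"
  using assms(2)
proof (induction k arbitrary: f)
  case 0
  then show ?case
    using bounded_linear.continuous_on[OF assms(1)] by simp
next
  case (Suc k)
  have d: "((\<lambda>x. L (f x)) has_derivative (\<lambda>v. L (frechet_derivative f (at x) v))) (at x)" for x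
    using Suc.prems by (intro bounded_linear.has_derivative[OF assms(1)]) (simp add: frechet_derivative_works[symmetric])
  have e: "frechet_derivative (\<lambda>x. L (f x)) (at x) = (\<lambda>v. L (frechet_derivative f (at x) v))" for x
    using d frechet_derivative_at by metis
  show ?case using Suc d by (auto simp: e differentiable_def)
qed

lemma Ck_bounded_bilinear:
  fixes p :: "real \<Rightarrow> 'a::real_normed_vector" and q :: "real \<Rightarrow> 'b::real_normed_vector"
  assumes "bounded_bilinear B" "Ck k p" "Ck k q"
  shows "Ck k (\<lambda>\<theta>. B (p \<theta>) (q \<theta>))"
  using assms(2,3)
proof (induction k arbitrary: p q)
  case 0
  then show ?case
    using bounded_bilinear.continuous_on[OF assms(1)] by simp
next
  case (Suc k)
  then have "(p has_vector_derivative vd p \<theta>) (at \<theta>)" "(q has_vector_derivative vd q \<theta>) (at \<theta>)" for \<theta>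
    using Ck_Suc_real by (auto simp: vector_derivative_works[symmetric])
  then have d: "((\<lambda>\<theta>. B (p \<theta>) (q \<theta>)) has_vector_derivative B (p \<theta>) (vd q \<theta>) + B (vd p \<theta>) (q \<theta>)) (at \<theta>)" for \<theta>
    by (intro bounded_bilinear.has_vector_derivative[OF assms(1)])
  have e: "vd (\<lambda>\<theta>. B (p \<theta>) (q \<theta>)) = (\<lambda>\<theta>. B (p \<theta>) (vd q \<theta>) + B (vd p \<theta>) (q \<theta>))"
    using d vector_derivative_at by blast
  have "Ck k p" "Ck k q" "Ck k (vd p)" "Ck k (vd q)"
    using Suc.prems Ck_Suc_imp_Ck Ck_Suc_real by blast+
  then show ?case
    unfolding Ck_Suc_real e using d by (auto intro!: Ck_add Suc.IH differentiableI_vector)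
qed

lemma Ck_sum: "finite I \<Longrightarrow> (\<And>i. i \<in> I \<Longrightarrow> Ck k (f i)) \<Longrightarrow> Ck k (\<lambda>x. \<Sum>i\<in>I. f i x)"
  by (induction I rule: finite_induct) (auto intro: Ck_add Ck_const)

text \<open>Writing the derivative in coordinates separates the point from the direction. This turns the
chain rule into a sum of products to which induction on the order of differentiability applies.\<close>

lemma frechet_derivative_basis_sum:
  fixes W :: "'a::euclidean_space \<Rightarrow> 'b::real_normed_vector"
  assumes "smooth W"
  shows "frechet_derivative W (at x) v = (\<Sum>i\<in>Basis. (v \<bullet> i) *\<^sub>R frechet_derivative W (at x) i)"
proof -
  have l: "linear (frechet_derivative W (at x))"
    using assms smooth_has_derivative has_derivative_linear by blast
  show ?thesis
    by (subst euclidean_representation[of v, symmetric]) (simp add: linear_sum[OF l] linear_scale[OF l])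
qed

lemma has_vector_derivative_smooth_compose:
  fixes W :: "'a::real_normed_vector \<Rightarrow> 'b::real_normed_vector"
  assumes "smooth W" "(u has_vector_derivative u') (at \<theta>)"
  shows "((\<lambda>\<theta>. W (u \<theta>)) has_vector_derivative frechet_derivative W (at (u \<theta>)) u') (at \<theta>)"
  using vector_derivative_diff_chain_within[OF assms(2), of W "frechet_derivative W (at (u \<theta>))"] 
    smooth_has_derivative[OF assms(1)]
  by (simp add: o_def has_derivative_at_withinI)

lemma Ck_smooth_compose:
  fixes W :: "'a::euclidean_space \<Rightarrow> 'b::real_normed_vector" and u :: "real \<Rightarrow> 'a"
  assumes "smooth W" "Ck k u"
  shows "Ck k (\<lambda>\<theta>. W (u \<theta>))"
  using assms
proof (induction k arbitrary: u W)
  case 0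
  then show ?case
    using continuous_on_compose2[of UNIV W UNIV u] smooth_continuous_on by auto
next
  case (Suc k)
  then have "(u has_vector_derivative vd u \<theta>) (at \<theta>)" for \<theta>
    using Ck_Suc_real by (auto simp: vector_derivative_works[symmetric])
  from has_vector_derivative_smooth_compose[OF Suc.prems(1) this]
  have d: "((\<lambda>\<theta>. W (u \<theta>)) has_vector_derivative frechet_derivative W (at (u \<theta>)) (vd u \<theta>)) (at \<theta>)" for \<theta> .
  have e: "vd (\<lambda>\<theta>. W (u \<theta>)) = (\<lambda>\<theta>. \<Sum>i\<in>Basis. (vd u \<theta> \<bullet> i) *\<^sub>R frechet_derivative W (at (u \<theta>)) i)"
    using d vector_derivative_at frechet_derivative_basis_sum[OF Suc.prems(1)] by metis
  have k: "Ck k u" "Ck k (vd u)"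
    using Suc.prems Ck_Suc_imp_Ck Ck_Suc_real by blast+
  have "Ck k (\<lambda>\<theta>. (vd u \<theta> \<bullet> i) *\<^sub>R frechet_derivative W (at (u \<theta>)) i)" for i
    by (intro Ck_bounded_bilinear[OF bounded_bilinear_scaleR] Suc.IH[OF _ k(1)]
        smooth_frechet_derivative Suc.prems Ck_bounded_linear[OF bounded_linear_inner_left] k(2))
  then show ?case
    unfolding Ck_Suc_real e using d by (auto intro!: Ck_sum differentiableI_vector)
qed

lemma smooth_bounded_linear: "bounded_linear L \<Longrightarrow> smooth f \<Longrightarrow> smooth (\<lambda>x. L (f x))"
  by (simp add: smooth_def Ck_bounded_linear)

lemma smooth_bounded_bilinear:
  fixes p :: "real \<Rightarrow> 'a::real_normed_vector" and q :: "real \<Rightarrow> 'b::real_normed_vector"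
  shows "bounded_bilinear B \<Longrightarrow> smooth p \<Longrightarrow> smooth q \<Longrightarrow> smooth (\<lambda>\<theta>. B (p \<theta>) (q \<theta>))"
  by (simp add: smooth_def Ck_bounded_bilinear)

lemmas smooth_scaleR_fun = smooth_bounded_bilinear[OF bounded_bilinear_scaleR]
lemmas smooth_inner = smooth_bounded_bilinear[OF bounded_bilinear_inner]
lemmas smooth_mult = smooth_bounded_bilinear[OF bounded_bilinear_mult]

lemma smooth_sum: "finite I \<Longrightarrow> (\<And>i. i \<in> I \<Longrightarrow> smooth (f i)) \<Longrightarrow> smooth (\<lambda>x. \<Sum>i\<in>I. f i x)"
  by (simp add: smooth_def Ck_sum)

lemma smooth_compose:
  fixes W :: "'a::euclidean_space \<Rightarrow> 'b::real_normed_vector" and u :: "real \<Rightarrow> 'a"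
  shows "smooth W \<Longrightarrow> smooth u \<Longrightarrow> smooth (\<lambda>\<theta>. W (u \<theta>))"
  unfolding smooth_def[of u] smooth_def[of "\<lambda>\<theta>. W (u \<theta>)"] by (simp add: Ck_smooth_compose)

lemma smooth_diff: "smooth f \<Longrightarrow> smooth g \<Longrightarrow> smooth (\<lambda>x. f x - g x)"
  using smooth_add[OF _ smooth_scaleR, of f g "-1"] by simp

lemma smooth_id_real: "smooth (\<lambda>x::real. x)"
proof -
  have "Ck k (\<lambda>x::real. x)" for k
  proof (cases k)
    case (Suc n)
    have "vd (\<lambda>x::real. x) = (\<lambda>_. 1)"
      by (auto intro!: vector_derivative_at)
    then show ?thesis unfolding Suc Ck_Suc_real by (auto simp: Ck_const)
  qed simp
  then show ?thesis by (simp add: smooth_def)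
qed

text \<open>All real powers are treated at once since they are permuted by differentiation.\<close>

lemma smooth_powr:
  fixes r :: "real \<Rightarrow> real"
  assumes "smooth r" "\<And>\<theta>. r \<theta> > 0"
  shows "smooth (\<lambda>\<theta>. r \<theta> powr p)"
proof -
  have "Ck k (\<lambda>\<theta>. r \<theta> powr p)" for k
  proof (induction k arbitrary: p)
    case 0
    show ?case using assms smooth_continuous_on[OF assms(1)] by (auto intro!: continuous_intros simp: less_imp_neq[symmetric])
  next
    case (Suc k)
    have d: "((\<lambda>\<theta>. r \<theta> powr p) has_vector_derivative (p * vd r \<theta>) * r \<theta> powr (p - 1)) (at \<theta>)" for \<theta>
    proof -
      have "(r has_real_derivative vd r \<theta>) (at \<theta>)"
        using smooth_has_vector_derivative[OF assms(1)] by (simp add: has_real_derivative_iff_has_vector_derivative)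
      from DERIV_chain2[where f = "\<lambda>z. z powr p" and g = r, OF has_real_derivative_powr[OF assms(2)] this] show ?thesis
        unfolding has_real_derivative_iff_has_vector_derivative[symmetric] by (simp add: algebra_simps)
    qed
    have e: "vd (\<lambda>\<theta>. r \<theta> powr p) = (\<lambda>\<theta>. (p * vd r \<theta>) * r \<theta> powr (p - 1))"
      using d vector_derivative_at by blast
    have "Ck k (\<lambda>\<theta>. (p * vd r \<theta>) * r \<theta> powr (p - 1))"
      using smooth_vd[OF assms(1)]
      by (intro Ck_bounded_bilinear[OF bounded_bilinear_mult] Suc Ck_bounded_linear[OF bounded_linear_mult_right]) (simp add: smooth_def)
    then show ?case
      unfolding Ck_Suc_real e using d by (auto intro!: differentiableI_vector)
  qed
  then show ?thesis by (simp add: smooth_def)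
qed

text \<open>The second difference on the left-hand side is symmetric in \<open>u\<close> and \<open>v\<close>. Comparing its
mean-value forms for both orders of \<open>u\<close> and \<open>v\<close> as \<open>t\<close> tends to \<open>0\<close> gives the symmetry of
second derivatives.\<close>

lemma mixed_difference_mean_value:
  fixes W :: "'a::real_normed_vector \<Rightarrow> real"
  assumes W: "smooth W" and t: "t > 0"
  obtains \<xi> \<eta> where "0 < \<xi>" "\<xi> < t" "0 < \<eta>" "\<eta> < t"
    "W (x + t *\<^sub>R u + t *\<^sub>R v) - W (x + t *\<^sub>R u) - W (x + t *\<^sub>R v) + W x
      = t * t * frechet_derivative (\<lambda>y. frechet_derivative W (at y) u) (at (x + \<xi> *\<^sub>R u + \<eta> *\<^sub>R v)) v"
proof -
  let ?Wu = "\<lambda>y. frechet_derivative W (at y) u"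
  have Wu: "smooth ?Wu" using W by (rule smooth_frechet_derivative)
  have line: "((\<lambda>s. f (y + s *\<^sub>R a)) has_real_derivative frechet_derivative f (at (y + s *\<^sub>R a)) a) (at s)"
    if "smooth f" for f :: "'a \<Rightarrow> real" and y a s
    unfolding has_real_derivative_iff_has_vector_derivative
    by (rule has_vector_derivative_smooth_compose[OF that]) (auto intro!: derivative_eq_intros)
  let ?\<phi> = "\<lambda>s. W (x + t *\<^sub>R v + s *\<^sub>R u) - W (x + s *\<^sub>R u)"
  have "(?\<phi> has_real_derivative ?Wu (x + t *\<^sub>R v + s *\<^sub>R u) - ?Wu (x + s *\<^sub>R u)) (at s)" for s
    by (intro derivative_intros line W)
  from MVT2[OF t, of ?\<phi>, OF this] obtain \<xi> where xi: "0 < \<xi>" "\<xi> < t"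
    "?\<phi> t - ?\<phi> 0 = t * (?Wu (x + t *\<^sub>R v + \<xi> *\<^sub>R u) - ?Wu (x + \<xi> *\<^sub>R u))"
    by auto
  from MVT2[OF t, of "\<lambda>s. ?Wu (x + \<xi> *\<^sub>R u + s *\<^sub>R v)", OF line[OF Wu]] obtain \<eta> where
    eta: "0 < \<eta>" "\<eta> < t" "?Wu (x + \<xi> *\<^sub>R u + t *\<^sub>R v) - ?Wu (x + \<xi> *\<^sub>R u)
      = t * frechet_derivative ?Wu (at (x + \<xi> *\<^sub>R u + \<eta> *\<^sub>R v)) v"
    by auto
  show thesis
  proof (rule that[OF xi(1,2) eta(1,2)])
    show "W (x + t *\<^sub>R u + t *\<^sub>R v) - W (x + t *\<^sub>R u) - W (x + t *\<^sub>R v) + W x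
      = t * t * frechet_derivative ?Wu (at (x + \<xi> *\<^sub>R u + \<eta> *\<^sub>R v)) v"
      using xi(3) eta(3) by (simp add: algebra_simps)
  qed
qed

lemma frechet_derivative_symmetric_real:
  fixes W :: "'a::real_normed_vector \<Rightarrow> real"
  assumes W: "smooth W"
  shows "frechet_derivative (\<lambda>y. frechet_derivative W (at y) u) (at x) v
       = frechet_derivative (\<lambda>y. frechet_derivative W (at y) v) (at x) u"
proof -
  let ?D = "\<lambda>a b y. frechet_derivative (\<lambda>y. frechet_derivative W (at y) a) (at y) b"
  have lim: "((\<lambda>n. ?D a b (x + \<xi> n *\<^sub>R a + \<eta> n *\<^sub>R b)) \<longlonglongrightarrow> ?D a b x)"
    if "\<xi> \<longlonglongrightarrow> 0" "\<eta> \<longlonglongrightarrow> 0" for a b \<xi> \<eta>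
  proof -
    have "isCont (?D a b) x"
      using smooth_continuous_on[OF smooth_frechet_derivative[OF smooth_frechet_derivative[OF W]], of UNIV]
      by (simp add: continuous_on_eq_continuous_at)
    moreover have "(\<lambda>n. x + \<xi> n *\<^sub>R a + \<eta> n *\<^sub>R b) \<longlonglongrightarrow> x"
      using that by (auto intro!: tendsto_eq_intros)
    ultimately show ?thesis by (rule isCont_tendsto_compose)
  qed
  define t where "t n = inverse (real (Suc n))" for n
  have t: "t n > 0" "t \<longlonglongrightarrow> 0" for n
    unfolding t_def using LIMSEQ_inverse_real_of_nat by simp_all
  define Q where "Q a b n p \<longleftrightarrow> 0 < fst p \<and> fst p < t n \<and> 0 < snd p \<and> snd p < t n \<and>
      W (x + t n *\<^sub>R a + t n *\<^sub>R b) - W (x + t n *\<^sub>R a) - W (x + t n *\<^sub>R b) + W x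
      = t n * t n * ?D a b (x + fst p *\<^sub>R a + snd p *\<^sub>R b)" for a b n p
  have "\<exists>p. Q a b n p" for n a b
    by (rule mixed_difference_mean_value[OF W t(1)[of n], of x a b]) (auto simp: Q_def)
  then have Q: "Q a b n (SOME p. Q a b n p)" for a b n
    by (rule someI_ex)
  define \<xi> \<eta> where "\<xi> a b n = fst (SOME p. Q a b n p)" and "\<eta> a b n = snd (SOME p. Q a b n p)" for a b n
  have *: "0 < \<xi> a b n" "\<xi> a b n < t n" "0 < \<eta> a b n" "\<eta> a b n < t n"
      "W (x + t n *\<^sub>R a + t n *\<^sub>R b) - W (x + t n *\<^sub>R a) - W (x + t n *\<^sub>R b) + W x
      = t n * t n * ?D a b (x + \<xi> a b n *\<^sub>R a + \<eta> a b n *\<^sub>R b)" for n a b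
    using Q[of a b n] unfolding \<xi>_def \<eta>_def Q_def by blast+
  have z: "\<xi> a b \<longlonglongrightarrow> 0" "\<eta> a b \<longlonglongrightarrow> 0" for a b
    by (rule tendsto_sandwich[OF _ _ tendsto_const t(2)], simp_all add: * less_imp_le)+
  have "t n * t n * ?D u v (x + \<xi> u v n *\<^sub>R u + \<eta> u v n *\<^sub>R v)
      = t n * t n * ?D v u (x + \<xi> v u n *\<^sub>R v + \<eta> v u n *\<^sub>R u)" for n
    using *(5)[of n u v] *(5)[of n v u] by (simp add: algebra_simps)
  moreover have "t n * t n \<noteq> 0" for n
    using t(1)[of n] by simp
  ultimately have eq: "?D u v (x + \<xi> u v n *\<^sub>R u + \<eta> u v n *\<^sub>R v) = ?D v u (x + \<xi> v u n *\<^sub>R v + \<eta> v u n *\<^sub>R u)" for n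
    by (rule mult_left_cancel[THEN iffD1, rotated])
  show ?thesis
    using lim[OF z(1)[of u v] z(2)[of u v], of u v] lim[OF z(1)[of v u] z(2)[of v u], of v u]
    unfolding eq by (rule LIMSEQ_unique)
qed

lemma frechet_derivative_symmetric:
  fixes W :: "'a::real_normed_vector \<Rightarrow> 'b::euclidean_space"
  assumes W: "smooth W"
  shows "frechet_derivative (\<lambda>y. frechet_derivative W (at y) u) (at x) v
       = frechet_derivative (\<lambda>y. frechet_derivative W (at y) v) (at x) u"
proof (rule euclidean_eqI)
  fix e :: 'b
  have d: "frechet_derivative (\<lambda>y. f y \<bullet> e) (at x) v = frechet_derivative f (at x) v \<bullet> e"
    if "smooth f" for f :: "'a \<Rightarrow> 'b" and x v
    using frechet_derivative_at[OF has_derivative_inner_left[OF smooth_has_derivative[OF that]]] by metis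
  have "smooth (\<lambda>y. W y \<bullet> e)"
    using smooth_bounded_linear[OF bounded_linear_inner_left W] .
  from frechet_derivative_symmetric_real[OF this, of u x v]
  show "frechet_derivative (\<lambda>y. frechet_derivative W (at y) u) (at x) v \<bullet> e
     = frechet_derivative (\<lambda>y. frechet_derivative W (at y) v) (at x) u \<bullet> e"
    by (simp add: d W smooth_frechet_derivative)
qed

section \<open>Uniform convergence of all derivatives\<close>

text \<open>The functions \<open>u x\<close> converge along the filter \<open>F\<close> to \<open>v\<close>, uniformly on one period, together with
their first \<open>k\<close> derivatives. Working on a compact interval loses nothing for periodic functions
and also admits the identity and its perturbations.\<close>

primrec derivs_converge :: "nat \<Rightarrow> ('x \<Rightarrow> real \<Rightarrow> 'b::real_normed_vector) \<Rightarrow> (real \<Rightarrow> 'b) \<Rightarrow> 'x filter \<Rightarrow> bool" where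
  "derivs_converge 0 u v F = uniform_limit {0..2 * pi} u v F"
| "derivs_converge (Suc k) u v F = (uniform_limit {0..2 * pi} u v F \<and> derivs_converge k (\<lambda>x. vd (u x)) (vd v) F)"

lemma derivs_converge_imp_uniform_limit: "derivs_converge k u v F \<Longrightarrow> uniform_limit {0..2 * pi} u v F"
  by (cases k) auto

lemma derivs_converge_Suc_imp: "derivs_converge (Suc k) u v F \<Longrightarrow> derivs_converge k u v F"
  by (induction k arbitrary: u v) auto

lemma derivs_converge_cong:
  assumes "\<forall>\<^sub>F x in F. u x = u' x" "derivs_converge k u v F"
  shows "derivs_converge k u' v F"
  using assms
proof (induction k arbitrary: u u' v)
  case 0
  then show ?case
    by (simp, subst uniform_limit_cong[where g = u and i = v]) (auto elim: eventually_mono)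
next
  case (Suc k)
  have "uniform_limit {0..2 * pi} u' v F"
    using Suc.prems by (subst uniform_limit_cong[where g = u and i = v]) (auto elim: eventually_mono)
  moreover have "derivs_converge k (\<lambda>x. vd (u' x)) (vd v) F"
    by (rule Suc.IH[of "\<lambda>x. vd (u x)"]) (use Suc.prems in \<open>auto elim: eventually_mono\<close>)
  ultimately show ?case by simp
qed

lemma derivs_converge_iff: "derivs_converge k u v F \<longleftrightarrow>
  (\<forall>j\<le>k. uniform_limit {0..2 * pi} (\<lambda>x. (vd ^^ j) (u x)) ((vd ^^ j) v) F)"
proof (induction k arbitrary: u v)
  case (Suc k)
  have "(\<forall>j\<le>Suc k. P j) \<longleftrightarrow> P 0 \<and> (\<forall>j\<le>k. P (Suc j))" for P
    by (metis Suc_le_mono le0 not0_implies_Suc)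
  then show ?case
    by (simp add: Suc funpow_Suc_right del: funpow.simps(2))
qed simp

lemma vd_add: "smooth f \<Longrightarrow> smooth g \<Longrightarrow> vd (\<lambda>\<theta>. f \<theta> + g \<theta>) = (\<lambda>\<theta>. vd f \<theta> + vd g \<theta>)"
  by (intro ext vector_derivative_at has_vector_derivative_add smooth_has_vector_derivative)

lemma vd_bilinear:
  "bounded_bilinear B \<Longrightarrow> smooth p \<Longrightarrow> smooth q \<Longrightarrow>
    vd (\<lambda>\<theta>. B (p \<theta>) (q \<theta>)) = (\<lambda>\<theta>. B (p \<theta>) (vd q \<theta>) + B (vd p \<theta>) (q \<theta>))"
  by (rule ext, rule vector_derivative_at,
      rule bounded_bilinear.has_vector_derivative[OF _ smooth_has_vector_derivative smooth_has_vector_derivative])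

lemma vd_bounded_linear:
  "bounded_linear L \<Longrightarrow> smooth q \<Longrightarrow> vd (\<lambda>\<theta>. L (q \<theta>)) = (\<lambda>\<theta>. L (vd q \<theta>))"
  by (rule ext, rule vector_derivative_at, rule bounded_linear.has_vector_derivative[OF _ smooth_has_vector_derivative])

lemma vd_smooth_compose:
  fixes W :: "'a::euclidean_space \<Rightarrow> 'b::real_normed_vector"
  assumes "smooth W" "smooth u"
  shows "vd (\<lambda>\<theta>. W (u \<theta>)) = (\<lambda>\<theta>. \<Sum>i\<in>Basis. (vd u \<theta> \<bullet> i) *\<^sub>R frechet_derivative W (at (u \<theta>)) i)"
  using has_vector_derivative_smooth_compose[OF assms(1) smooth_has_vector_derivative[OF assms(2)]]
    frechet_derivative_basis_sum[OF assms(1)] vector_derivative_at by metis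

text \<open>Convergence of order \<open>k\<close> among smooth functions. Smoothness of \<open>u x\<close> is only required
eventually along \<open>F\<close>, so that expressions defined near embeddings only are admitted.\<close>

definition Ck_limit :: "nat \<Rightarrow> ('x \<Rightarrow> real \<Rightarrow> 'b::real_normed_vector) \<Rightarrow> (real \<Rightarrow> 'b) \<Rightarrow> 'x filter \<Rightarrow> bool" where
  "Ck_limit k u v F \<longleftrightarrow> (\<forall>\<^sub>F x in F. smooth (u x)) \<and> smooth v \<and> derivs_converge k u v F"

text \<open>Convergence of all derivatives. For functions that come from loops this is convergence in the
Frechet topology (\<open>tendsto_loop_iff\<close> below).\<close>

definition smooth_limit :: "('x \<Rightarrow> real \<Rightarrow> 'b::real_normed_vector) \<Rightarrow> (real \<Rightarrow> 'b) \<Rightarrow> 'x filter \<Rightarrow> bool" where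
  "smooth_limit u v F \<longleftrightarrow> (\<forall>k. Ck_limit k u v F)"

lemma Ck_limit_cong: "\<forall>\<^sub>F x in F. u x = u' x \<Longrightarrow> Ck_limit k u v F \<Longrightarrow> Ck_limit k u' v F"
  unfolding Ck_limit_def by (auto intro: derivs_converge_cong elim: eventually_elim2)

lemma Ck_limitD:
  assumes "Ck_limit k u v F"
  shows "\<forall>\<^sub>F x in F. smooth (u x)" "smooth v" "uniform_limit {0..2 * pi} u v F"
  using assms derivs_converge_imp_uniform_limit by (auto simp: Ck_limit_def)

lemma Ck_limit_SucI:
  assumes "\<forall>\<^sub>F x in F. smooth (u x)" "smooth v" "uniform_limit {0..2 * pi} u v F"
    "Ck_limit k (\<lambda>x. vd (u x)) (vd v) F"
  shows "Ck_limit (Suc k) u v F"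
  using assms by (simp add: Ck_limit_def)

lemma Ck_limit_Suc_vd: "Ck_limit (Suc k) u v F \<Longrightarrow> Ck_limit k (\<lambda>x. vd (u x)) (vd v) F"
  by (auto simp: Ck_limit_def intro: smooth_vd elim: eventually_mono)

lemma Ck_limit_Suc_imp: "Ck_limit (Suc k) u v F \<Longrightarrow> Ck_limit k u v F"
  unfolding Ck_limit_def using derivs_converge_Suc_imp by blast

lemma Ck_limit_const: "smooth v \<Longrightarrow> Ck_limit k (\<lambda>x. v) v F"
proof -
  have "derivs_converge k (\<lambda>x. v) v F"
    by (induction k arbitrary: v) (auto simp: uniform_limit_iff)
  then show "smooth v \<Longrightarrow> Ck_limit k (\<lambda>x. v) v F" by (simp add: Ck_limit_def)
qed

lemma Ck_limit_const_fun:
  assumes "(r \<longlongrightarrow> a) F"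
  shows "Ck_limit k (\<lambda>x \<theta>. r x) (\<lambda>\<theta>. a) F"
proof -
  have u: "uniform_limit {0..2 * pi} (\<lambda>x \<theta>. r x) (\<lambda>\<theta>. a) F"
    using assms by (auto simp: uniform_limit_iff tendsto_iff elim: eventually_mono)
  show ?thesis
  proof (cases k)
    case 0
    then show ?thesis using u by (simp add: Ck_limit_def smooth_const)
  next
    case (Suc n)
    show ?thesis unfolding Suc
      by (rule Ck_limit_SucI) (simp_all add: u smooth_const Ck_limit_const)
  qed
qed

lemma Ck_limit_add:
  "Ck_limit k p a F \<Longrightarrow> Ck_limit k q b F \<Longrightarrow> Ck_limit k (\<lambda>x \<theta>. p x \<theta> + q x \<theta>) (\<lambda>\<theta>. a \<theta> + b \<theta>) F"
proof (induction k arbitrary: p q a b)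
  case 0
  note d = Ck_limitD[OF 0(1)] Ck_limitD[OF 0(2)]
  have "\<forall>\<^sub>F x in F. smooth (\<lambda>\<theta>. p x \<theta> + q x \<theta>)"
    using d(1,4) by eventually_elim (rule smooth_add)
  then show ?case using d by (simp add: Ck_limit_def smooth_add uniform_limit_add)
next
  case (Suc k)
  note d = Ck_limitD[OF Suc.prems(1)] Ck_limitD[OF Suc.prems(2)]
  have s: "\<forall>\<^sub>F x in F. smooth (p x) \<and> smooth (q x)"
    using d(1,4) by (rule eventually_conj)
  have "Ck_limit k (\<lambda>x \<theta>. vd (p x) \<theta> + vd (q x) \<theta>) (\<lambda>\<theta>. vd a \<theta> + vd b \<theta>) F"
    by (intro Suc.IH Ck_limit_Suc_vd Suc.prems)
  then have "Ck_limit k (\<lambda>x. vd (\<lambda>\<theta>. p x \<theta> + q x \<theta>)) (vd (\<lambda>\<theta>. a \<theta> + b \<theta>)) F"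
    unfolding vd_add[OF d(2,5)]
    by (rule Ck_limit_cong[rotated]) (use s in \<open>auto simp: vd_add elim!: eventually_mono\<close>)
  moreover have "\<forall>\<^sub>F x in F. smooth (\<lambda>\<theta>. p x \<theta> + q x \<theta>)"
    using s by (auto intro: smooth_add elim: eventually_mono)
  ultimately show ?case using d by (intro Ck_limit_SucI smooth_add uniform_limit_add)
qed

lemma smooth_bounded_image: "smooth f \<Longrightarrow> bounded (f ` {0..2 * pi :: real})"
  by (intro compact_imp_bounded compact_continuous_image smooth_continuous_on compact_Icc)

lemma Ck_limit_bilinear:
  assumes B: "bounded_bilinear B" and "Ck_limit k p a F" "Ck_limit k q b F"
  shows "Ck_limit k (\<lambda>x \<theta>. B (p x \<theta>) (q x \<theta>)) (\<lambda>\<theta>. B (a \<theta>) (b \<theta>)) F"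
  using assms(2-)
proof (induction k arbitrary: p q a b)
  case 0
  note d = Ck_limitD[OF 0(1)] Ck_limitD[OF 0(2)]
  have "\<forall>\<^sub>F x in F. smooth (\<lambda>\<theta>. B (p x \<theta>) (q x \<theta>))"
    using d(1,4) by eventually_elim (rule smooth_bounded_bilinear[OF B])
  then show ?case using d
    by (simp add: Ck_limit_def bounded_bilinear.bounded_uniform_limit[OF B] smooth_bounded_image
        smooth_bounded_bilinear[OF B])
next
  case (Suc k)
  note d = Ck_limitD[OF Suc.prems(1)] Ck_limitD[OF Suc.prems(2)]
  have s: "\<forall>\<^sub>F x in F. smooth (p x) \<and> smooth (q x)"
    using d(1,4) by (rule eventually_conj)
  have "Ck_limit k (\<lambda>x \<theta>. B (p x \<theta>) (vd (q x) \<theta>) + B (vd (p x) \<theta>) (q x \<theta>))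
      (\<lambda>\<theta>. B (a \<theta>) (vd b \<theta>) + B (vd a \<theta>) (b \<theta>)) F"
    by (intro Ck_limit_add Suc.IH Ck_limit_Suc_vd Suc.prems Ck_limit_Suc_imp[OF Suc.prems(1)]
        Ck_limit_Suc_imp[OF Suc.prems(2)])
  then have "Ck_limit k (\<lambda>x. vd (\<lambda>\<theta>. B (p x \<theta>) (q x \<theta>))) (vd (\<lambda>\<theta>. B (a \<theta>) (b \<theta>))) F"
    unfolding vd_bilinear[OF B d(2,5)]
    by (rule Ck_limit_cong[rotated]) (use s in \<open>auto simp: vd_bilinear[OF B] elim!: eventually_mono\<close>)
  moreover have "\<forall>\<^sub>F x in F. smooth (\<lambda>\<theta>. B (p x \<theta>) (q x \<theta>))"
    using s by (auto intro: smooth_bounded_bilinear[OF B] elim: eventually_mono)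
  ultimately show ?case using d
    by (intro Ck_limit_SucI smooth_bounded_bilinear[OF B]
        bounded_bilinear.bounded_uniform_limit[OF B] smooth_bounded_image)
qed

lemma Ck_limit_bounded_linear:
  assumes L: "bounded_linear L" and u: "Ck_limit k u v F"
  shows "Ck_limit k (\<lambda>x \<theta>. L (u x \<theta>)) (\<lambda>\<theta>. L (v \<theta>)) F"
proof -
  have "bounded_bilinear (\<lambda>(r::real) x. r *\<^sub>R L x)"
    by (rule bounded_bilinear.comp[OF bounded_bilinear_scaleR bounded_linear_ident L])
  from Ck_limit_bilinear[OF this Ck_limit_const_fun[OF tendsto_const[of 1]] u]
  show ?thesis by simp
qed

lemma Ck_limit_sum:
  assumes "finite I" "\<And>i. i \<in> I \<Longrightarrow> Ck_limit k (u i) (v i) F"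
  shows "Ck_limit k (\<lambda>x \<theta>. \<Sum>i\<in>I. u i x \<theta>) (\<lambda>\<theta>. \<Sum>i\<in>I. v i \<theta>) F"
  using assms
  by (induction I rule: finite_induct) (auto intro: Ck_limit_add Ck_limit_const smooth_const)

lemma smooth_limitD:
  assumes "smooth_limit u v F"
  shows "\<forall>\<^sub>F x in F. smooth (u x)" "smooth v" "uniform_limit {0..2 * pi} u v F" "Ck_limit k u v F"
  using assms Ck_limitD unfolding smooth_limit_def by blast+

lemma smooth_limit_cong: "\<forall>\<^sub>F x in F. u x = u' x \<Longrightarrow> smooth_limit u v F \<Longrightarrow> smooth_limit u' v F"
  unfolding smooth_limit_def using Ck_limit_cong by blast

lemma smooth_limit_const: "smooth v \<Longrightarrow> smooth_limit (\<lambda>x. v) v F"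
  by (simp add: smooth_limit_def Ck_limit_const)

lemma smooth_limit_const_fun: "(r \<longlongrightarrow> a) F \<Longrightarrow> smooth_limit (\<lambda>x \<theta>. r x) (\<lambda>\<theta>. a) F"
  by (simp add: smooth_limit_def Ck_limit_const_fun)

lemma smooth_limit_add:
  "smooth_limit p a F \<Longrightarrow> smooth_limit q b F \<Longrightarrow> smooth_limit (\<lambda>x \<theta>. p x \<theta> + q x \<theta>) (\<lambda>\<theta>. a \<theta> + b \<theta>) F"
  by (simp add: smooth_limit_def Ck_limit_add)

lemma smooth_limit_bilinear:
  "bounded_bilinear B \<Longrightarrow> smooth_limit p a F \<Longrightarrow> smooth_limit q b F \<Longrightarrow>
    smooth_limit (\<lambda>x \<theta>. B (p x \<theta>) (q x \<theta>)) (\<lambda>\<theta>. B (a \<theta>) (b \<theta>)) F"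
  by (simp add: smooth_limit_def Ck_limit_bilinear)

lemmas smooth_limit_scaleR = smooth_limit_bilinear[OF bounded_bilinear_scaleR]

lemma smooth_limit_bounded_linear:
  "bounded_linear L \<Longrightarrow> smooth_limit u v F \<Longrightarrow> smooth_limit (\<lambda>x \<theta>. L (u x \<theta>)) (\<lambda>\<theta>. L (v \<theta>)) F"
  by (simp add: smooth_limit_def Ck_limit_bounded_linear)

lemma smooth_limit_sum:
  "finite I \<Longrightarrow> (\<And>i. i \<in> I \<Longrightarrow> smooth_limit (u i) (v i) F) \<Longrightarrow>
    smooth_limit (\<lambda>x \<theta>. \<Sum>i\<in>I. u i x \<theta>) (\<lambda>\<theta>. \<Sum>i\<in>I. v i \<theta>) F"
  by (simp add: smooth_limit_def Ck_limit_sum)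

lemma smooth_limit_vd: "smooth_limit u v F \<Longrightarrow> smooth_limit (\<lambda>x. vd (u x)) (vd v) F"
  unfolding smooth_limit_def using Ck_limit_Suc_vd by blast

lemma smooth_limit_filter:
  assumes u: "smooth_limit u v F" and g: "filterlim g F G"
  shows "smooth_limit (\<lambda>x. u (g x)) v G"
proof -
  have "uniform_limit {0..2 * pi} (\<lambda>x. (vd ^^ j) (u (g x))) ((vd ^^ j) v) G" for j
    by (rule filterlim_compose[OF _ g]) (use u in \<open>auto simp: smooth_limit_def Ck_limit_def derivs_converge_iff\<close>)
  then show ?thesis
    using smooth_limitD(1,2)[OF u] eventually_compose_filterlim[OF smooth_limitD(1)[OF u] g]
    by (simp add: smooth_limit_def Ck_limit_def derivs_converge_iff)
qed

lemma uniform_limit_smooth_compose: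
  fixes W :: "'a::euclidean_space \<Rightarrow> 'b::real_normed_vector"
  assumes W: "smooth W" and v: "smooth v" and u: "uniform_limit {0..2 * pi} u v F"
  shows "uniform_limit {0..2 * pi} (\<lambda>x \<theta>. W (u x \<theta>)) (\<lambda>\<theta>. W (v \<theta>)) F"
proof -
  obtain R where R: "\<And>\<theta>. \<theta> \<in> {0..2 * pi} \<Longrightarrow> norm (v \<theta>) \<le> R"
    using smooth_bounded_image[OF v] unfolding bounded_iff by blast
  show ?thesis
  proof (rule uniform_limit_compose_uniformly_continuous_on[OF u, of "cball 0 (R + 1)"])
    show "uniformly_continuous_on (cball 0 (R + 1)) W"
      by (intro compact_uniformly_continuous smooth_continuous_on W compact_cball)
    show "\<forall>\<^sub>F x in F. \<forall>\<theta>\<in>{0..2 * pi}. u x \<theta> \<in> cball 0 (R + 1)"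
      using uniform_limitD[OF u zero_less_one]
    proof eventually_elim
      case (elim x)
      have "norm (u x \<theta>) \<le> R + 1" if "\<theta> \<in> {0..2 * pi}" for \<theta>
        using bspec[OF elim that] R[OF that] norm_triangle_sub[of "u x \<theta>" "v \<theta>"] by (simp add: dist_norm)
      then show ?case by simp
    qed
  qed simp
qed

lemma Ck_limit_compose:
  fixes W :: "'a::euclidean_space \<Rightarrow> 'b::real_normed_vector"
  assumes "smooth W" and "Ck_limit k u v F"
  shows "Ck_limit k (\<lambda>x \<theta>. W (u x \<theta>)) (\<lambda>\<theta>. W (v \<theta>)) F"
  using assms
proof (induction k arbitrary: W)
  case 0
  note d = Ck_limitD[OF 0(2)]
  have "\<forall>\<^sub>F x in F. smooth (\<lambda>\<theta>. W (u x \<theta>))"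
    using d(1) by eventually_elim (rule smooth_compose[OF 0(1)])
  then show ?case
    using d uniform_limit_smooth_compose[OF 0(1) d(2,3)] smooth_compose[OF 0(1)] by (simp add: Ck_limit_def)
next
  case (Suc k)
  note d = Ck_limitD[OF Suc.prems(2)]
  have "Ck_limit k (\<lambda>x \<theta>. \<Sum>i\<in>Basis. (vd (u x) \<theta> \<bullet> i) *\<^sub>R frechet_derivative W (at (u x \<theta>)) i)
      (\<lambda>\<theta>. \<Sum>i\<in>Basis. (vd v \<theta> \<bullet> i) *\<^sub>R frechet_derivative W (at (v \<theta>)) i) F"
    by (intro Ck_limit_sum finite_Basis Ck_limit_bilinear[OF bounded_bilinear_scaleR]
        Ck_limit_bounded_linear[OF bounded_linear_inner_left] Ck_limit_Suc_vd
        Suc.IH smooth_frechet_derivative Suc.prems Ck_limit_Suc_imp[OF Suc.prems(2)])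
  then have "Ck_limit k (\<lambda>x. vd (\<lambda>\<theta>. W (u x \<theta>))) (vd (\<lambda>\<theta>. W (v \<theta>))) F"
    unfolding vd_smooth_compose[OF Suc.prems(1) d(2)]
    by (rule Ck_limit_cong[rotated])
      (use d(1) in \<open>auto simp: vd_smooth_compose[OF Suc.prems(1)] elim!: eventually_mono\<close>)
  moreover have "\<forall>\<^sub>F x in F. smooth (\<lambda>\<theta>. W (u x \<theta>))"
    using d(1) by eventually_elim (rule smooth_compose[OF Suc.prems(1)])
  ultimately show ?case
    by (intro Ck_limit_SucI uniform_limit_smooth_compose[OF Suc.prems(1)] d smooth_compose[OF Suc.prems(1)])
qed

lemma smooth_limit_compose:
  fixes W :: "'a::euclidean_space \<Rightarrow> 'b::real_normed_vector"
  shows "smooth W \<Longrightarrow> smooth_limit u v F \<Longrightarrow> smooth_limit (\<lambda>x \<theta>. W (u x \<theta>)) (\<lambda>\<theta>. W (v \<theta>)) F"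
  by (simp add: smooth_limit_def Ck_limit_compose)

lemma vd_inverse:
  fixes r :: "real \<Rightarrow> real"
  assumes "smooth r" "\<And>\<theta>. r \<theta> \<noteq> 0"
  shows "vd (\<lambda>\<theta>. inverse (r \<theta>)) = (\<lambda>\<theta>. - (vd r \<theta> * (inverse (r \<theta>) * inverse (r \<theta>))))"
proof (intro ext vector_derivative_at)
  fix \<theta>
  have "(r has_real_derivative vd r \<theta>) (at \<theta>)"
    using smooth_has_vector_derivative[OF assms(1)] by (simp add: has_real_derivative_iff_has_vector_derivative)
  from DERIV_inverse'[OF this assms(2)]
  show "((\<lambda>\<theta>. inverse (r \<theta>)) has_vector_derivative - (vd r \<theta> * (inverse (r \<theta>) * inverse (r \<theta>)))) (at \<theta>)"
    unfolding has_real_derivative_iff_has_vector_derivative[symmetric] by (simp add: algebra_simps)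
qed

lemma smooth_inverse:
  fixes r :: "real \<Rightarrow> real"
  assumes "smooth r" "\<And>\<theta>. r \<theta> > 0"
  shows "smooth (\<lambda>\<theta>. inverse (r \<theta>))"
  using smooth_powr[OF assms, of "-1"] assms(2) by (simp add: powr_minus less_imp_le)

lemma smooth_limit_inverse:
  fixes u :: "'x \<Rightarrow> real \<Rightarrow> real"
  assumes u: "smooth_limit u v F" and pos: "\<forall>\<^sub>F x in F. \<forall>\<theta>. u x \<theta> > 0" "\<And>\<theta>. v \<theta> > 0"
  shows "smooth_limit (\<lambda>x \<theta>. inverse (u x \<theta>)) (\<lambda>\<theta>. inverse (v \<theta>)) F"
proof -
  note d = smooth_limitD[OF u]
  have p: "\<forall>\<^sub>F x in F. smooth (u x) \<and> (\<forall>\<theta>. u x \<theta> > 0)"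
    using d(1) pos(1) by (rule eventually_conj)
  then have si: "\<forall>\<^sub>F x in F. smooth (\<lambda>\<theta>. inverse (u x \<theta>))"
    by eventually_elim (auto intro: smooth_inverse)
  obtain m where m: "m \<in> {0..2 * pi}" "\<And>\<theta>. \<theta> \<in> {0..2 * pi} \<Longrightarrow> v m \<le> v \<theta>"
    using continuous_attains_inf[of "{0..2 * pi}" v] smooth_continuous_on[OF d(2)] pi_ge_zero by auto
  have "v m \<le> norm (v \<theta>)" if "\<theta> \<in> {0..2 * pi}" for \<theta>
    using m(2)[OF that] by simp
  from uniform_lim_inverse[OF d(3) this pos(2)]
  have ul: "uniform_limit {0..2 * pi} (\<lambda>x \<theta>. inverse (u x \<theta>)) (\<lambda>\<theta>. inverse (v \<theta>)) F"
    by (simp add: o_def)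
  have "Ck_limit k (\<lambda>x \<theta>. inverse (u x \<theta>)) (\<lambda>\<theta>. inverse (v \<theta>)) F" for k
  proof (induction k)
    case 0
    then show ?case using ul si smooth_inverse[OF d(2) pos(2)] by (simp add: Ck_limit_def)
  next
    case (Suc k)
    have "Ck_limit k (\<lambda>x \<theta>. - (vd (u x) \<theta> * (inverse (u x \<theta>) * inverse (u x \<theta>))))
        (\<lambda>\<theta>. - (vd v \<theta> * (inverse (v \<theta>) * inverse (v \<theta>)))) F"
      by (intro Ck_limit_bounded_linear[OF bounded_linear_minus[OF bounded_linear_ident]]
          Ck_limit_bilinear[OF bounded_bilinear_mult] Suc smooth_limitD(4)[OF smooth_limit_vd[OF u]])
    then have "Ck_limit k (\<lambda>x. vd (\<lambda>\<theta>. inverse (u x \<theta>))) (vd (\<lambda>\<theta>. inverse (v \<theta>))) F"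
      unfolding vd_inverse[OF d(2) less_imp_neq[OF pos(2), symmetric]]
      by (rule Ck_limit_cong[rotated])
        (use p in \<open>auto simp: vd_inverse less_imp_neq[symmetric] elim!: eventually_mono\<close>)
    then show ?case
      by (intro Ck_limit_SucI si ul smooth_inverse[OF d(2) pos(2)])
  qed
  then show ?thesis by (simp add: smooth_limit_def)
qed

lemma smooth_limit_line: "smooth u \<Longrightarrow> smooth b \<Longrightarrow> smooth_limit (\<lambda>t \<theta>. u \<theta> + t *\<^sub>R b \<theta>) u (at (0::real))"
  using smooth_limit_add[OF smooth_limit_const[of u] smooth_limit_scaleR[OF smooth_limit_const_fun[OF tendsto_ident_at] smooth_limit_const], of b 0 UNIV]
  by simp

lemma smooth_frechet_derivative_along:
  fixes W :: "'a::euclidean_space \<Rightarrow> 'b::real_normed_vector" and u b :: "real \<Rightarrow> 'a"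
  assumes "smooth W" "smooth u" "smooth b"
  shows "smooth (\<lambda>\<theta>. frechet_derivative W (at (u \<theta>)) (b \<theta>))"
  unfolding frechet_derivative_basis_sum[OF assms(1), of _ "b _"]
  by (intro smooth_sum finite_Basis smooth_scaleR_fun smooth_bounded_linear[OF bounded_linear_inner_left]
      smooth_compose[OF smooth_frechet_derivative] assms)

lemma smooth_limit_frechet_derivative_along:
  fixes W :: "'a::euclidean_space \<Rightarrow> 'b::real_normed_vector"
  assumes "smooth W" "smooth_limit u v F" "smooth_limit b c F"
  shows "smooth_limit (\<lambda>x \<theta>. frechet_derivative W (at (u x \<theta>)) (b x \<theta>)) (\<lambda>\<theta>. frechet_derivative W (at (v \<theta>)) (c \<theta>)) F"
  unfolding frechet_derivative_basis_sum[OF assms(1), of _ "b _ _"] frechet_derivative_basis_sum[OF assms(1), of _ "c _"]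
  by (intro smooth_limit_sum finite_Basis smooth_limit_scaleR smooth_limit_bounded_linear[OF bounded_linear_inner_left]
      smooth_limit_compose[OF smooth_frechet_derivative] assms)

text \<open>The mean value inequality is applied to \<open>s \<mapsto> W (u \<theta> + s b \<theta>) - s DW (u \<theta>) (b \<theta>)\<close>, whose
derivative is small for small \<open>s\<close>, uniformly in \<open>\<theta>\<close>.\<close>

lemma uniform_limit_difference_quotient:
  fixes W :: "'a::euclidean_space \<Rightarrow> 'b::real_normed_vector" and u b :: "real \<Rightarrow> 'a"
  assumes W: "smooth W" and u: "smooth u" and b: "smooth b"
  shows "uniform_limit {0..2 * pi} (\<lambda>t \<theta>. (W (u \<theta> + t *\<^sub>R b \<theta>) - W (u \<theta>)) /\<^sub>R t)
     (\<lambda>\<theta>. frechet_derivative W (at (u \<theta>)) (b \<theta>)) (at 0)"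
proof (rule uniform_limitI)
  fix e :: real assume e: "e > 0"
  let ?K = "\<lambda>t \<theta>. frechet_derivative W (at (u \<theta> + t *\<^sub>R b \<theta>)) (b \<theta>)"
  have "uniform_limit {0..2 * pi} ?K (\<lambda>\<theta>. frechet_derivative W (at (u \<theta>)) (b \<theta>)) (at 0)"
    using smooth_limit_frechet_derivative_along[OF W smooth_limit_line[OF u b] smooth_limit_const[OF b]]
    by (rule smooth_limitD(3))
  from uniform_limitD[OF this, of "e / 2"] e obtain d where d: "d > 0"
    "\<And>t \<theta>. t \<noteq> 0 \<Longrightarrow> \<bar>t\<bar> < d \<Longrightarrow> \<theta> \<in> {0..2 * pi} \<Longrightarrow> dist (?K t \<theta>) (?K 0 \<theta>) < e / 2"
    by (auto simp: eventually_at)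
  have "dist ((W (u \<theta> + t *\<^sub>R b \<theta>) - W (u \<theta>)) /\<^sub>R t) (?K 0 \<theta>) < e"
    if t: "t \<noteq> 0" "\<bar>t\<bar> < d" and \<theta>: "\<theta> \<in> {0..2 * pi}" for t \<theta>
  proof -
    let ?\<phi> = "\<lambda>s. W (u \<theta> + s *\<^sub>R b \<theta>) - s *\<^sub>R ?K 0 \<theta>"
    have "norm (?\<phi> t - ?\<phi> 0) \<le> e / 2 * norm (t - 0)"
    proof (rule differentiable_bound[where S = "{-\<bar>t\<bar>..\<bar>t\<bar>}" and f' = "\<lambda>s h. h *\<^sub>R (?K s \<theta> - ?K 0 \<theta>)"])
      fix s assume s: "s \<in> {-\<bar>t\<bar>..\<bar>t\<bar>}"
      have "(?\<phi> has_vector_derivative ?K s \<theta> - 1 *\<^sub>R ?K 0 \<theta>) (at s)"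
        by (intro has_vector_derivative_diff has_vector_derivative_smooth_compose[OF W])
          (auto intro!: derivative_eq_intros)
      then show "(?\<phi> has_derivative (\<lambda>h. h *\<^sub>R (?K s \<theta> - ?K 0 \<theta>))) (at s within {-\<bar>t\<bar>..\<bar>t\<bar>})"
        unfolding has_vector_derivative_def by (simp add: has_derivative_at_withinI)
      have "norm (?K s \<theta> - ?K 0 \<theta>) \<le> e / 2"
        using d(2)[of s \<theta>] s t \<theta> e by (cases "s = 0") (auto simp: dist_norm abs_le_iff intro!: less_imp_le)
      then show "onorm (\<lambda>h. h *\<^sub>R (?K s \<theta> - ?K 0 \<theta>)) \<le> e / 2"
        by (intro onorm_le) (metis mult.commute mult_left_mono norm_ge_zero norm_scaleR real_norm_def)
    qed auto
    then have "norm (W (u \<theta> + t *\<^sub>R b \<theta>) - W (u \<theta>) - t *\<^sub>R ?K 0 \<theta>) \<le> e / 2 * \<bar>t\<bar>"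
      by (simp add: algebra_simps)
    moreover have "(W (u \<theta> + t *\<^sub>R b \<theta>) - W (u \<theta>)) /\<^sub>R t - ?K 0 \<theta>
        = (W (u \<theta> + t *\<^sub>R b \<theta>) - W (u \<theta>) - t *\<^sub>R ?K 0 \<theta>) /\<^sub>R t"
      using t by (simp add: algebra_simps)
    ultimately have "norm ((W (u \<theta> + t *\<^sub>R b \<theta>) - W (u \<theta>)) /\<^sub>R t - ?K 0 \<theta>) \<le> (e / 2 * \<bar>t\<bar>) / \<bar>t\<bar>"
      by (simp only: norm_scaleR abs_inverse divide_inverse mult.commute[of "inverse \<bar>t\<bar>"])
        (rule mult_right_mono, simp_all)
    then have "norm ((W (u \<theta> + t *\<^sub>R b \<theta>) - W (u \<theta>)) /\<^sub>R t - ?K 0 \<theta>) \<le> e / 2"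
      using t by simp
    then show ?thesis using e by (simp add: dist_norm)
  qed
  then show "\<forall>\<^sub>F t in at 0. \<forall>\<theta>\<in>{0..2 * pi}. dist ((W (u \<theta> + t *\<^sub>R b \<theta>) - W (u \<theta>)) /\<^sub>R t)
      (frechet_derivative W (at (u \<theta>)) (b \<theta>)) < e"
    unfolding eventually_at using d(1) by (intro exI[of _ d]) auto
qed

text \<open>By the symmetry of second derivatives, the derivative of \<open>\<theta> \<mapsto> DW (u \<theta>) (b \<theta>)\<close> is the sum of
the terms that arise as limits in the next lemma.\<close>

lemma vd_frechet_derivative_along:
  fixes W :: "'a::euclidean_space \<Rightarrow> 'b::euclidean_space" and u b :: "real \<Rightarrow> 'a"
  assumes W: "smooth W" and u: "smooth u" and b: "smooth b"
  shows "vd (\<lambda>\<theta>. frechet_derivative W (at (u \<theta>)) (b \<theta>)) =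
    (\<lambda>\<theta>. \<Sum>i\<in>Basis. (vd u \<theta> \<bullet> i) *\<^sub>R frechet_derivative (\<lambda>y. frechet_derivative W (at y) i) (at (u \<theta>)) (b \<theta>)
        + (vd b \<theta> \<bullet> i) *\<^sub>R frechet_derivative W (at (u \<theta>)) i)"
proof
  fix \<theta>
  let ?W = "\<lambda>i y. frechet_derivative W (at y) i"
  have W': "smooth (?W i)" for i using W by (rule smooth_frechet_derivative)
  have D: "((\<lambda>\<theta>. \<Sum>i\<in>Basis. (b \<theta> \<bullet> i) *\<^sub>R ?W i (u \<theta>)) has_vector_derivative
     (\<Sum>i\<in>Basis. (b \<theta> \<bullet> i) *\<^sub>R frechet_derivative (?W i) (at (u \<theta>)) (vd u \<theta>) + (vd b \<theta> \<bullet> i) *\<^sub>R ?W i (u \<theta>))) (at \<theta>)"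
    by (intro has_vector_derivative_sum bounded_bilinear.has_vector_derivative[OF bounded_bilinear_scaleR]
        has_vector_derivative_smooth_compose[OF W'] smooth_has_vector_derivative u b
        bounded_linear.has_vector_derivative[OF bounded_linear_inner_left])
  have "(\<Sum>i\<in>Basis. (b \<theta> \<bullet> i) *\<^sub>R frechet_derivative (?W i) (at (u \<theta>)) (vd u \<theta>))
     = (\<Sum>i\<in>Basis. \<Sum>j\<in>Basis. (b \<theta> \<bullet> i) *\<^sub>R (vd u \<theta> \<bullet> j) *\<^sub>R frechet_derivative (?W i) (at (u \<theta>)) j)"
    by (simp only: scaleR_sum_right[symmetric] frechet_derivative_basis_sum[OF W', where v = "vd u \<theta>", symmetric])
  also have "\<dots> = (\<Sum>j\<in>Basis. \<Sum>i\<in>Basis. (vd u \<theta> \<bullet> j) *\<^sub>R (b \<theta> \<bullet> i) *\<^sub>R frechet_derivative (?W j) (at (u \<theta>)) i)"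
    by (subst sum.swap, intro sum.cong refl)
      (simp add: frechet_derivative_symmetric[OF W, of _ "u \<theta>"] mult.commute)
  also have "\<dots> = (\<Sum>j\<in>Basis. (vd u \<theta> \<bullet> j) *\<^sub>R frechet_derivative (?W j) (at (u \<theta>)) (b \<theta>))"
    by (simp only: scaleR_sum_right[symmetric] frechet_derivative_basis_sum[OF W', where v = "b \<theta>", symmetric])
  finally show "vd (\<lambda>\<theta>. frechet_derivative W (at (u \<theta>)) (b \<theta>)) \<theta> =
    (\<Sum>i\<in>Basis. (vd u \<theta> \<bullet> i) *\<^sub>R frechet_derivative (?W i) (at (u \<theta>)) (b \<theta>) + (vd b \<theta> \<bullet> i) *\<^sub>R ?W i (u \<theta>))"
    using vector_derivative_at[OF D] frechet_derivative_basis_sum[OF W, of _ "b _", symmetric]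
    by (simp add: sum.distrib)
qed

text \<open>Difference quotients of the superposition operator \<open>u \<mapsto> W \<circ> u\<close> converge with all derivatives.
The induction passes from \<open>W\<close> to its partial derivatives.\<close>

lemma Ck_limit_difference_quotient:
  fixes W :: "'a::euclidean_space \<Rightarrow> 'b::euclidean_space" and u b :: "real \<Rightarrow> 'a"
  assumes "smooth W" and u: "smooth u" and b: "smooth b"
  shows "Ck_limit k (\<lambda>t \<theta>. (W (u \<theta> + t *\<^sub>R b \<theta>) - W (u \<theta>)) /\<^sub>R t)
     (\<lambda>\<theta>. frechet_derivative W (at (u \<theta>)) (b \<theta>)) (at 0)"
  using assms(1)
proof (induction k arbitrary: W)
  case (0 W)
  have "smooth (\<lambda>\<theta>. (W (u \<theta> + t *\<^sub>R b \<theta>) - W (u \<theta>)) /\<^sub>R t)" for t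
    by (intro smooth_scaleR smooth_diff smooth_compose[OF 0] smooth_add u b)
  then show ?case
    using uniform_limit_difference_quotient[OF 0 u b] smooth_frechet_derivative_along[OF 0 u b]
    by (simp add: Ck_limit_def)
next
  case (Suc k W)
  note W = Suc.prems
  let ?W = "\<lambda>i y. frechet_derivative W (at y) i"
  have W': "smooth (?W i)" for i using W by (rule smooth_frechet_derivative)
  have ub: "smooth (\<lambda>\<theta>. u \<theta> + t *\<^sub>R b \<theta>)" for t
    by (intro smooth_add smooth_scaleR u b)
  have s: "smooth (\<lambda>\<theta>. (W (u \<theta> + t *\<^sub>R b \<theta>) - W (u \<theta>)) /\<^sub>R t)" for t
    by (intro smooth_scaleR smooth_diff smooth_compose[OF W] u ub)
  have vdub: "vd (\<lambda>\<theta>. u \<theta> + t *\<^sub>R b \<theta>) = (\<lambda>\<theta>. vd u \<theta> + t *\<^sub>R vd b \<theta>)" for t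
    by (simp add: vd_add[OF u smooth_scaleR[OF b]] fun_cong[OF vd_bounded_linear[where L = "(*\<^sub>R) t", OF bounded_linear_scaleR_right b]])
  have "vd (\<lambda>\<theta>. (W (u \<theta> + t *\<^sub>R b \<theta>) - W (u \<theta>)) /\<^sub>R t) = (\<lambda>\<theta>. \<Sum>i\<in>Basis.
      (vd u \<theta> \<bullet> i) *\<^sub>R ((?W i (u \<theta> + t *\<^sub>R b \<theta>) - ?W i (u \<theta>)) /\<^sub>R t) + (vd b \<theta> \<bullet> i) *\<^sub>R ?W i (u \<theta> + t *\<^sub>R b \<theta>))"
    if "t \<noteq> 0" for t
  proof
    fix \<theta>
    have ti: "t * (inverse t * r) = r" for r
      using that by simp
    have "((\<lambda>\<theta>. (W (u \<theta> + t *\<^sub>R b \<theta>) - W (u \<theta>)) /\<^sub>R t) has_vector_derivative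
      (vd (\<lambda>\<theta>. W (u \<theta> + t *\<^sub>R b \<theta>)) \<theta> - vd (\<lambda>\<theta>. W (u \<theta>)) \<theta>) /\<^sub>R t) (at \<theta>)"
      by (intro bounded_linear.has_vector_derivative[OF bounded_linear_scaleR_right] has_vector_derivative_diff
          smooth_has_vector_derivative smooth_compose[OF W] u ub)
    from vector_derivative_at[OF this] show "vd (\<lambda>\<theta>. (W (u \<theta> + t *\<^sub>R b \<theta>) - W (u \<theta>)) /\<^sub>R t) \<theta> = (\<Sum>i\<in>Basis.
      (vd u \<theta> \<bullet> i) *\<^sub>R ((?W i (u \<theta> + t *\<^sub>R b \<theta>) - ?W i (u \<theta>)) /\<^sub>R t) + (vd b \<theta> \<bullet> i) *\<^sub>R ?W i (u \<theta> + t *\<^sub>R b \<theta>))"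
      unfolding fun_cong[OF vd_smooth_compose[OF W ub]] fun_cong[OF vd_smooth_compose[OF W u]] fun_cong[OF vdub]
      by (simp add: ti sum_subtractf[symmetric] scaleR_sum_right algebra_simps inner_add_left sum.distrib[symmetric])
  qed
  moreover have lim: "Ck_limit k (\<lambda>t \<theta>. \<Sum>i\<in>Basis. (vd u \<theta> \<bullet> i) *\<^sub>R ((?W i (u \<theta> + t *\<^sub>R b \<theta>) - ?W i (u \<theta>)) /\<^sub>R t)
       + (vd b \<theta> \<bullet> i) *\<^sub>R ?W i (u \<theta> + t *\<^sub>R b \<theta>))
     (vd (\<lambda>\<theta>. frechet_derivative W (at (u \<theta>)) (b \<theta>))) (at 0)"
    unfolding vd_frechet_derivative_along[OF W u b]
    by (intro Ck_limit_sum finite_Basis Ck_limit_add Ck_limit_bilinear[OF bounded_bilinear_scaleR]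
        Ck_limit_const Suc.IH W' smooth_bounded_linear[OF bounded_linear_inner_left] smooth_vd u b
        Ck_limit_compose[OF W'] smooth_limitD(4)[OF smooth_limit_line])
  ultimately have "Ck_limit k (\<lambda>t. vd (\<lambda>\<theta>. (W (u \<theta> + t *\<^sub>R b \<theta>) - W (u \<theta>)) /\<^sub>R t))
     (vd (\<lambda>\<theta>. frechet_derivative W (at (u \<theta>)) (b \<theta>))) (at 0)"
    by (intro Ck_limit_cong[OF _ lim]) (simp add: eventually_at_filter)
  then show ?case
    by (intro Ck_limit_SucI uniform_limit_difference_quotient W u b smooth_frechet_derivative_along)
      (simp_all add: s)
qed

lemma smooth_limit_difference_quotient:
  fixes W :: "'a::euclidean_space \<Rightarrow> 'b::euclidean_space" and u b :: "real \<Rightarrow> 'a"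
  assumes "smooth W" "smooth u" "smooth b"
  shows "smooth_limit (\<lambda>t \<theta>. (W (u \<theta> + t *\<^sub>R b \<theta>) - W (u \<theta>)) /\<^sub>R t)
     (\<lambda>\<theta>. frechet_derivative W (at (u \<theta>)) (b \<theta>)) (at 0)"
  by (simp add: smooth_limit_def Ck_limit_difference_quotient assms)

section \<open>Loops, embeddings and differentiation along paths\<close>

lemma smooth_at_angle: "smooth (at_angle \<gamma>)"
  and periodic_at_angle: "periodic (at_angle \<gamma>)"
  using at_angle[of \<gamma>] by auto

lemma at_angle_plus: "at_angle (\<gamma> + \<delta>) = (\<lambda>\<theta>. at_angle \<gamma> \<theta> + at_angle \<delta> \<theta>)"
  and at_angle_scaleR: "at_angle (r *\<^sub>R \<gamma>) = (\<lambda>\<theta>. r *\<^sub>R at_angle \<gamma> \<theta>)"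
  by (rule plus_loop.rep_eq scaleR_loop.rep_eq)+

lemma at_angle_Abs_loop: "smooth g \<Longrightarrow> periodic g \<Longrightarrow> at_angle (Abs_loop g) = g"
  by (simp add: Abs_loop_inverse)

lemma angle_deriv_eq: "angle_deriv j \<gamma> = (vd ^^ j) (at_angle \<gamma>)"
  by (simp add: angle_deriv_def)

lemma angle_deriv_1: "angle_deriv 1 \<gamma> = vd (at_angle \<gamma>)"
  by (simp add: angle_deriv_def)

lemma periodic_int_shift:
  assumes "periodic f"
  shows "f (\<theta> + 2 * pi * of_int n) = f \<theta>"
proof -
  have nat: "f (\<theta> + 2 * pi * of_nat n) = f \<theta>" for n \<theta>
  proof (induction n)
    case (Suc n)
    have "f (\<theta> + 2 * pi * of_nat (Suc n)) = f ((\<theta> + 2 * pi * of_nat n) + 2 * pi)"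
      by (simp add: algebra_simps)
    then show ?case using assms Suc by (simp add: periodic_def)
  qed simp
  show ?thesis
  proof (cases n)
    case (nonneg k)
    then show ?thesis using nat[of \<theta> k] by simp
  next
    case (neg k)
    have "\<theta> + 2 * pi * of_int n + 2 * pi * of_nat (Suc k) = \<theta>"
      unfolding neg by (simp add: algebra_simps)
    then show ?thesis using nat[of "\<theta> + 2 * pi * of_int n" "Suc k"] by metis
  qed
qed

lemma angle_reduction:
  obtains \<theta>' and n :: int where "\<theta>' \<in> {0..<2 * pi}" "\<theta> = \<theta>' + 2 * pi * of_int n"
proof
  let ?n = "\<lfloor>\<theta> / (2 * pi)\<rfloor>"
  have "of_int ?n * (2 * pi) \<le> \<theta>"
    by (rule pos_le_divide_eq[THEN iffD1]) simp_all
  moreover have "\<theta> < (of_int ?n + 1) * (2 * pi)"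
    by (rule pos_divide_less_eq[THEN iffD1]) (simp, linarith)
  ultimately show "\<theta> - 2 * pi * of_int ?n \<in> {0..<2 * pi}"
    by (simp add: algebra_simps)
  show "\<theta> = \<theta> - 2 * pi * of_int ?n + 2 * pi * of_int ?n" by simp
qed

lemma periodic_vd:
  assumes "smooth g" "periodic g"
  shows "periodic (vd g)"
  unfolding periodic_def
proof
  fix \<theta>
  have "((g \<circ> (\<lambda>\<theta>. \<theta> + 2 * pi)) has_vector_derivative 1 *\<^sub>R vd g (\<theta> + 2 * pi)) (at \<theta>)"
    by (rule vector_diff_chain_at) (auto intro!: derivative_eq_intros smooth_has_vector_derivative assms)
  moreover have "g \<circ> (\<lambda>\<theta>. \<theta> + 2 * pi) = g"
    using assms(2) by (auto simp: periodic_def)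
  ultimately show "vd g (\<theta> + 2 * pi) = vd g \<theta>"
    by (simp add: vector_derivative_at)
qed

lemma periodic_angle_deriv: "periodic (angle_deriv j \<gamma>)"
proof -
  have "smooth ((vd ^^ j) (at_angle \<gamma>)) \<and> periodic ((vd ^^ j) (at_angle \<gamma>))"
    by (induction j) (auto intro: smooth_vd periodic_vd smooth_at_angle periodic_at_angle)
  then show ?thesis by (simp add: angle_deriv_eq)
qed

text \<open>A pointwise relation between derivatives of two loops needs to be checked on one period only.\<close>

lemma angle_deriv_ball_extend:
  assumes "\<And>\<theta>. \<theta> \<in> {0..2 * pi} \<Longrightarrow> P (angle_deriv j \<gamma> \<theta>) (angle_deriv j \<delta> \<theta>)"
  shows "P (angle_deriv j \<gamma> \<theta>) (angle_deriv j \<delta> \<theta>)"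
proof -
  obtain \<theta>' n where t: "\<theta>' \<in> {0..<2 * pi}" "\<theta> = \<theta>' + 2 * pi * of_int n"
    using angle_reduction by blast
  then have "angle_deriv j \<gamma> \<theta> = angle_deriv j \<gamma> \<theta>'" "angle_deriv j \<delta> \<theta> = angle_deriv j \<delta> \<theta>'"
    using periodic_int_shift periodic_angle_deriv by metis+
  then show ?thesis using assms[of \<theta>'] t(1) by simp
qed

lemma smooth_limit_loop_iff:
  "smooth_limit (\<lambda>x. at_angle (g x)) (at_angle l) F \<longleftrightarrow>
    (\<forall>j. uniform_limit {0..2 * pi} (\<lambda>x. angle_deriv j (g x)) (angle_deriv j l) F)"
  unfolding smooth_limit_def Ck_limit_def derivs_converge_iff angle_deriv_eq
  by (auto simp: smooth_at_angle)

lemma tendsto_loop_iff: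
  "(g \<longlongrightarrow> l) F \<longleftrightarrow> smooth_limit (\<lambda>x. at_angle (g x)) (at_angle l) F"
proof
  assume g: "(g \<longlongrightarrow> l) F"
  have "uniform_limit {0..2 * pi} (\<lambda>x. angle_deriv j (g x)) (angle_deriv j l) F" for j
  proof (rule uniform_limitI)
    fix e :: real assume e: "e > 0"
    \<comment> \<open>the strict gap between \<open>e'\<close> and \<open>e\<close> makes this set open\<close>
    define U where "U = {\<delta>. \<exists>e'<e. \<forall>\<theta>. dist (angle_deriv j \<delta> \<theta>) (angle_deriv j l \<theta>) \<le> e'}"
    have "open U"
      unfolding open_loop_def
    proof
      fix \<gamma> assume "\<gamma> \<in> U"
      then obtain e' where e': "e' < e" "\<And>\<theta>. dist (angle_deriv j \<gamma> \<theta>) (angle_deriv j l \<theta>) \<le> e'"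
        by (auto simp: U_def)
      have "\<delta> \<in> U" if d: "\<forall>i\<le>j. \<forall>\<theta>. dist (angle_deriv i \<delta> \<theta>) (angle_deriv i \<gamma> \<theta>) < (e - e') / 2" for \<delta>
      proof -
        have "dist (angle_deriv j \<delta> \<theta>) (angle_deriv j l \<theta>) \<le> (e + e') / 2" for \<theta>
          using dist_triangle[of "angle_deriv j \<delta> \<theta>" "angle_deriv j l \<theta>" "angle_deriv j \<gamma> \<theta>"]
            e'(2)[of \<theta>] d[rule_format, OF order_refl, of \<theta>] by argo
        then show ?thesis unfolding U_def using e'(1) by (auto intro!: exI[of _ "(e + e') / 2"])
      qed
      then show "\<exists>k. \<exists>e>0. \<forall>\<delta>. (\<forall>j\<le>k. \<forall>\<theta>. dist (angle_deriv j \<delta> \<theta>) (angle_deriv j \<gamma> \<theta>) < e) \<longrightarrow> \<delta> \<in> U"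
        using e'(1) by (intro exI[of _ j] exI[of _ "(e - e') / 2"]) auto
    qed
    moreover have "l \<in> U" using e by (auto simp: U_def)
    ultimately have "\<forall>\<^sub>F x in F. g x \<in> U" using g topological_tendstoD by blast
    then show "\<forall>\<^sub>F x in F. \<forall>\<theta>\<in>{0..2 * pi}. dist (angle_deriv j (g x) \<theta>) (angle_deriv j l \<theta>) < e"
      by (rule eventually_mono) (auto simp: U_def intro: le_less_trans)
  qed
  then show "smooth_limit (\<lambda>x. at_angle (g x)) (at_angle l) F"
    by (simp add: smooth_limit_loop_iff)
next
  assume s: "smooth_limit (\<lambda>x. at_angle (g x)) (at_angle l) F"
  show "(g \<longlongrightarrow> l) F"
  proof (rule topological_tendstoI)
    fix S assume S: "open S" "l \<in> S"
    then obtain k e where e: "e > 0"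
      "\<And>\<delta>. (\<forall>j\<le>k. \<forall>\<theta>. dist (angle_deriv j \<delta> \<theta>) (angle_deriv j l \<theta>) < e) \<Longrightarrow> \<delta> \<in> S"
      unfolding open_loop_def by blast
    have "\<forall>\<^sub>F x in F. \<forall>j\<in>{..k}. \<forall>\<theta>\<in>{0..2 * pi}. dist (angle_deriv j (g x) \<theta>) (angle_deriv j l \<theta>) < e"
      by (rule eventually_ball_finite[OF finite_atMost], rule ballI)
        (rule uniform_limitD[OF s[unfolded smooth_limit_loop_iff, rule_format] e(1)])
    then show "\<forall>\<^sub>F x in F. g x \<in> S"
    proof eventually_elim
      case (elim x)
      have "dist (angle_deriv j (g x) \<theta>) (angle_deriv j l \<theta>) < e" if "j \<le> k" for j \<theta>
        by (rule angle_deriv_ball_extend[where P = "\<lambda>a b. dist a b < e"]) (use elim that in auto)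
      then show ?case using e(2) by blast
    qed
  qed
qed

lemma Emb_D:
  assumes "\<gamma> \<in> Emb"
  shows "vd (at_angle \<gamma>) \<theta> \<noteq> 0" "inj_on (at_angle \<gamma>) {0..<2 * pi}"
  using assms unfolding Emb_def angle_deriv_1 by blast+

lemma Emb_eq_imp:
  assumes "\<gamma> \<in> Emb" "at_angle \<gamma> a = at_angle \<gamma> b"
  obtains n :: int where "a = b + 2 * pi * of_int n"
proof -
  obtain a' n where a: "a' \<in> {0..<2 * pi}" "a = a' + 2 * pi * of_int n" using angle_reduction by blast
  obtain b' m where b: "b' \<in> {0..<2 * pi}" "b = b' + 2 * pi * of_int m" using angle_reduction by blast
  have "at_angle \<gamma> a' = at_angle \<gamma> b'"
    using assms(2) unfolding a b periodic_int_shift[OF periodic_at_angle] .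
  then have "a' = b'" using Emb_D(2)[OF assms(1)] a(1) b(1) by (auto dest: inj_onD)
  then have "a = b + 2 * pi * of_int (n - m)" using a b by (simp add: algebra_simps)
  then show thesis using that by blast
qed

lemma curve_eq_image: "curve \<gamma> = at_angle \<gamma> ` {0..<2 * pi}"
proof -
  have "at_angle \<gamma> \<theta> \<in> at_angle \<gamma> ` {0..<2 * pi}" for \<theta>
  proof -
    obtain \<theta>' n where t: "\<theta>' \<in> {0..<2 * pi}" "\<theta> = \<theta>' + 2 * pi * of_int n" using angle_reduction by blast
    then have "at_angle \<gamma> \<theta> = at_angle \<gamma> \<theta>'" using periodic_int_shift[OF periodic_at_angle] by simp
    then show ?thesis using t(1) by blast
  qed
  then show ?thesis by (auto simp: curve_def)
qed

lemma curve_eq_image_closed: "curve \<gamma> = at_angle \<gamma> ` {0..2 * pi}"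
proof
  show "curve \<gamma> \<subseteq> at_angle \<gamma> ` {0..2 * pi}"
    unfolding curve_eq_image by (rule image_mono) auto
qed (auto simp: curve_def)

lemma compact_curve: "compact (curve \<gamma>)"
  unfolding curve_eq_image_closed by (intro compact_continuous_image smooth_continuous_on smooth_at_angle compact_Icc)

text \<open>First-order Taylor approximation with an error that is uniform in the base point.\<close>

lemma uniform_strict_derivative:
  assumes g: "smooth g" "periodic g" and e: "e > 0"
  obtains d where "d > 0" "\<And>\<theta> h. \<bar>h\<bar> < d \<Longrightarrow> norm (g (\<theta> + h) - g \<theta> - h *\<^sub>R vd g \<theta>) \<le> e * \<bar>h\<bar>"
proof -
  have "uniformly_continuous_on {-1..2 * pi + 1} (vd g)"
    by (intro compact_uniformly_continuous smooth_continuous_on smooth_vd g compact_Icc)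
  then obtain d where d: "d > 0" "\<And>x y. x \<in> {-1..2 * pi + 1} \<Longrightarrow> y \<in> {-1..2 * pi + 1} \<Longrightarrow> dist x y < d \<Longrightarrow> dist (vd g x) (vd g y) < e"
    using e unfolding uniformly_continuous_on_def by metis
  have main: "norm (g (\<theta> + h) - g \<theta> - h *\<^sub>R vd g \<theta>) \<le> e * \<bar>h\<bar>"
    if h: "\<bar>h\<bar> < min d 1" and \<theta>: "\<theta> \<in> {0..2 * pi}" for h \<theta>
  proof -
    let ?\<phi> = "\<lambda>s. g (\<theta> + s) - s *\<^sub>R vd g \<theta>"
    have "norm (?\<phi> h - ?\<phi> 0) \<le> e * norm (h - 0)"
    proof (rule differentiable_bound[where S = "{-\<bar>h\<bar>..\<bar>h\<bar>}" and f' = "\<lambda>s k. k *\<^sub>R (vd g (\<theta> + s) - vd g \<theta>)"])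
      fix s assume s: "s \<in> {-\<bar>h\<bar>..\<bar>h\<bar>}"
      have "((g \<circ> (\<lambda>s. \<theta> + s)) has_vector_derivative 1 *\<^sub>R vd g (\<theta> + s)) (at s)"
        by (rule vector_diff_chain_at) (auto intro!: derivative_eq_intros smooth_has_vector_derivative g)
      then have "(?\<phi> has_vector_derivative vd g (\<theta> + s) - vd g \<theta>) (at s)"
        by (auto simp: o_def intro!: derivative_eq_intros)
      then show "(?\<phi> has_derivative (\<lambda>k. k *\<^sub>R (vd g (\<theta> + s) - vd g \<theta>))) (at s within {-\<bar>h\<bar>..\<bar>h\<bar>})"
        unfolding has_vector_derivative_def by (simp add: has_derivative_at_withinI)
      have "norm (vd g (\<theta> + s) - vd g \<theta>) \<le> e"
      proof -
        have "\<bar>s\<bar> \<le> \<bar>h\<bar>" using s by auto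
        then have "dist (vd g (\<theta> + s)) (vd g \<theta>) < e"
          using h \<theta> by (intro d(2)) (auto simp: dist_real_def)
        then show ?thesis by (simp add: dist_norm)
      qed
      then show "onorm (\<lambda>k. k *\<^sub>R (vd g (\<theta> + s) - vd g \<theta>)) \<le> e"
        by (intro onorm_le) (metis mult.commute mult_left_mono norm_ge_zero norm_scaleR real_norm_def)
    qed auto
    then show ?thesis by (simp add: algebra_simps)
  qed
  show thesis
  proof (rule that[of "min d 1"])
    fix \<theta> h :: real assume h: "\<bar>h\<bar> < min d 1"
    obtain \<theta>' n where t: "\<theta>' \<in> {0..<2 * pi}" "\<theta> = \<theta>' + 2 * pi * of_int n" using angle_reduction by blast
    have "g (\<theta> + h) = g (\<theta>' + h)" "g \<theta> = g \<theta>'" "vd g \<theta> = vd g \<theta>'"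
      using periodic_int_shift[OF g(2), of "\<theta>' + h" n] periodic_int_shift[OF g(2), of \<theta>' n]
        periodic_int_shift[OF periodic_vd[OF g], of \<theta>' n] unfolding t(2) by (simp_all add: algebra_simps)
    then show "norm (g (\<theta> + h) - g \<theta> - h *\<^sub>R vd g \<theta>) \<le> e * \<bar>h\<bar>"
      using main[OF h, of \<theta>'] t(1) by simp
  qed (use d in auto)
qed

lemma Emb_speed_bound:
  assumes "\<gamma> \<in> Emb"
  obtains \<mu> where "\<mu> > 0" "\<And>\<theta>. norm (vd (at_angle \<gamma>) \<theta>) \<ge> \<mu>"
proof -
  have c: "continuous_on {0..2 * pi} (\<lambda>\<theta>. norm (vd (at_angle \<gamma>) \<theta>))"
    by (intro continuous_intros smooth_continuous_on smooth_vd smooth_at_angle)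
  then obtain m where m: "m \<in> {0..2 * pi}"
    "\<And>\<theta>. \<theta> \<in> {0..2 * pi} \<Longrightarrow> norm (vd (at_angle \<gamma>) m) \<le> norm (vd (at_angle \<gamma>) \<theta>)"
    using continuous_attains_inf[OF _ _ c] pi_ge_zero by auto
  show thesis
  proof (rule that)
    show "norm (vd (at_angle \<gamma>) m) > 0" using Emb_D(1)[OF assms] by simp
    show "norm (vd (at_angle \<gamma>) \<theta>) \<ge> norm (vd (at_angle \<gamma>) m)" for \<theta>
      using angle_deriv_ball_extend[where P = "\<lambda>a b. norm a \<ge> norm (vd (at_angle \<gamma>) m)" and j = 1 and \<gamma> = \<gamma>] m(2)
      unfolding angle_deriv_1 by blast
  qed
qed

text \<open>An embedding is bi-Lipschitz on arcs of length at most half a period. For short arcs this comes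
from the lower bound on the speed, for the others from injectivity and compactness.\<close>

lemma Emb_chord_arc:
  assumes \<gamma>: "\<gamma> \<in> Emb"
  obtains m where "m > 0" "\<And>a b. \<bar>a - b\<bar> \<le> pi \<Longrightarrow> norm (at_angle \<gamma> a - at_angle \<gamma> b) \<ge> m * \<bar>a - b\<bar>"
proof -
  let ?g = "at_angle \<gamma>"
  obtain \<mu> where \<mu>: "\<mu> > 0" "\<And>\<theta>. norm (vd ?g \<theta>) \<ge> \<mu>" using Emb_speed_bound[OF \<gamma>] by blast
  obtain d where d: "d > 0" "\<And>\<theta> h. \<bar>h\<bar> < d \<Longrightarrow> norm (?g (\<theta> + h) - ?g \<theta> - h *\<^sub>R vd ?g \<theta>) \<le> \<mu> / 2 * \<bar>h\<bar>"
    using uniform_strict_derivative[OF smooth_at_angle periodic_at_angle, of "\<mu> / 2"] \<mu>(1) by auto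
  have near: "norm (?g (\<theta> + h) - ?g \<theta>) \<ge> \<mu> / 2 * \<bar>h\<bar>" if "\<bar>h\<bar> < d" for \<theta> h
  proof -
    have "norm (h *\<^sub>R vd ?g \<theta>) \<le> norm (?g (\<theta> + h) - ?g \<theta>) + norm (?g (\<theta> + h) - ?g \<theta> - h *\<^sub>R vd ?g \<theta>)"
      using norm_triangle_ineq4[of "?g (\<theta> + h) - ?g \<theta>" "?g (\<theta> + h) - ?g \<theta> - h *\<^sub>R vd ?g \<theta>"] by simp
    moreover have "norm (h *\<^sub>R vd ?g \<theta>) \<ge> \<bar>h\<bar> * \<mu>" using \<mu>(2) by (simp add: mult_left_mono)
    ultimately show ?thesis using d(2)[OF that, of \<theta>] by argo
  qed
  define K where "K = {0..2 * pi} \<times> ({-pi..pi} \<inter> {h. \<bar>h\<bar> \<ge> d})"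
  have "closed {h::real. \<bar>h\<bar> \<ge> d}" by (intro closed_Collect_le continuous_intros)
  then have K: "compact K" unfolding K_def by (intro compact_Times compact_Int_closed compact_Icc)
  have "\<exists>m>0. \<forall>(\<theta>, h)\<in>K. norm (?g (\<theta> + h) - ?g \<theta>) \<ge> m"
  proof (cases "K = {}")
    case False
    have "continuous_on K (\<lambda>p. norm (?g (fst p + snd p) - ?g (fst p)))"
      by (intro continuous_intros continuous_on_compose2[OF smooth_continuous_on[OF smooth_at_angle, of UNIV]]) auto
    then obtain p where p: "p \<in> K" "\<And>q. q \<in> K \<Longrightarrow> norm (?g (fst p + snd p) - ?g (fst p)) \<le> norm (?g (fst q + snd q) - ?g (fst q))"
      using continuous_attains_inf[OF K False] by blast
    have "?g (fst p + snd p) \<noteq> ?g (fst p)"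
    proof
      assume "?g (fst p + snd p) = ?g (fst p)"
      then obtain n where "fst p + snd p = fst p + 2 * pi * of_int n" using Emb_eq_imp[OF \<gamma>] by blast
      then have n: "snd p = 2 * pi * of_int n" by simp
      have "\<bar>snd p\<bar> \<le> pi" "snd p \<noteq> 0" using p(1) d(1) by (auto simp: K_def)
      then have "\<bar>real_of_int n\<bar> * (2 * pi) \<le> pi" "n \<noteq> 0" unfolding n by (auto simp: abs_mult)
      then have "\<bar>real_of_int n\<bar> \<ge> 1" by linarith
      then have "\<bar>real_of_int n\<bar> * (2 * pi) \<ge> 1 * (2 * pi)" by (intro mult_right_mono) auto
      with \<open>\<bar>real_of_int n\<bar> * (2 * pi) \<le> pi\<close> show False using pi_gt_zero by linarith
    qed
    then show ?thesis using p(2) by (intro exI[of _ "norm (?g (fst p + snd p) - ?g (fst p))"]) auto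
  qed (auto intro: exI[of _ 1])
  then obtain m where m: "m > 0" "\<And>\<theta> h. (\<theta>, h) \<in> K \<Longrightarrow> norm (?g (\<theta> + h) - ?g \<theta>) \<ge> m" by auto
  show thesis
  proof (rule that[of "min (\<mu> / 2) (m / pi)"])
    show "min (\<mu> / 2) (m / pi) > 0" using \<mu> m by auto
    fix a b :: real assume ab: "\<bar>a - b\<bar> \<le> pi"
    obtain b' n where b: "b' \<in> {0..<2 * pi}" "b = b' + 2 * pi * of_int n" using angle_reduction by blast
    define h where "h = a - b"
    have e: "?g a = ?g (b' + h)" "?g b = ?g b'"
      using periodic_int_shift[OF periodic_at_angle, of \<gamma> "b' + h" n] periodic_int_shift[OF periodic_at_angle, of \<gamma> b' n]
      unfolding h_def b(2) by (simp_all add: algebra_simps)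
    have "min (\<mu> / 2) (m / pi) * \<bar>h\<bar> \<le> norm (?g (b' + h) - ?g b')"
    proof (cases "\<bar>h\<bar> < d")
      case True
      have "min (\<mu> / 2) (m / pi) * \<bar>h\<bar> \<le> \<mu> / 2 * \<bar>h\<bar>" by (intro mult_right_mono min.cobounded1 abs_ge_zero)
      then show ?thesis using near[OF True, of b'] by linarith
    next
      case False
      then have "(b', h) \<in> K" using b(1) ab unfolding K_def h_def by auto
      moreover have "min (\<mu> / 2) (m / pi) * \<bar>h\<bar> \<le> m / pi * pi"
        using ab m(1) unfolding h_def by (intro mult_mono) auto
      ultimately show ?thesis using m(2)[of b' h] by simp
    qed
    then show "norm (?g a - ?g b) \<ge> min (\<mu> / 2) (m / pi) * \<bar>a - b\<bar>"
      unfolding e h_def[symmetric] .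
  qed
qed

text \<open>If the derivative of \<open>\<delta> - \<gamma>\<close> is small compared with the chord-arc constant of \<open>\<gamma>\<close>, then \<open>\<delta>\<close>
inherits a chord-arc estimate from \<open>\<gamma>\<close>, hence its injectivity.\<close>

lemma Emb_perturb:
  assumes \<gamma>: "\<gamma> \<in> Emb"
  obtains e where "e > 0" "\<And>\<delta>. (\<And>\<theta>. dist (angle_deriv 1 \<delta> \<theta>) (angle_deriv 1 \<gamma> \<theta>) < e) \<Longrightarrow> \<delta> \<in> Emb"
proof -
  obtain m where m: "m > 0" "\<And>a b. \<bar>a - b\<bar> \<le> pi \<Longrightarrow> norm (at_angle \<gamma> a - at_angle \<gamma> b) \<ge> m * \<bar>a - b\<bar>"
    using Emb_chord_arc[OF \<gamma>] by blast
  obtain \<mu> where \<mu>: "\<mu> > 0" "\<And>\<theta>. norm (vd (at_angle \<gamma>) \<theta>) \<ge> \<mu>" using Emb_speed_bound[OF \<gamma>] by blast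
  define e where "e = min \<mu> (m / 2)"
  show thesis
  proof (rule that)
    show "e > 0" using m \<mu> by (simp add: e_def)
    fix \<delta> assume "\<And>\<theta>. dist (angle_deriv 1 \<delta> \<theta>) (angle_deriv 1 \<gamma> \<theta>) < e"
    then have d: "norm (vd (at_angle \<delta>) \<theta> - vd (at_angle \<gamma>) \<theta>) < e" for \<theta>
      unfolding angle_deriv_1 dist_norm .
    have imm: "vd (at_angle \<delta>) \<theta> \<noteq> 0" for \<theta>
      using d[of \<theta>] \<mu>(2)[of \<theta>] by (auto simp: e_def)
    have lip: "norm ((at_angle \<delta> a - at_angle \<gamma> a) - (at_angle \<delta> b - at_angle \<gamma> b)) \<le> m / 2 * norm (a - b)" for a b
    proof (rule differentiable_bound[where S = UNIV and f' = "\<lambda>\<theta> k. k *\<^sub>R (vd (at_angle \<delta>) \<theta> - vd (at_angle \<gamma>) \<theta>)"])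
      fix \<theta> :: real
      have "((\<lambda>x. at_angle \<delta> x - at_angle \<gamma> x) has_vector_derivative vd (at_angle \<delta>) \<theta> - vd (at_angle \<gamma>) \<theta>) (at \<theta>)"
        by (intro has_vector_derivative_diff smooth_has_vector_derivative smooth_at_angle)
      then show "((\<lambda>x. at_angle \<delta> x - at_angle \<gamma> x) has_derivative (\<lambda>k. k *\<^sub>R (vd (at_angle \<delta>) \<theta> - vd (at_angle \<gamma>) \<theta>))) (at \<theta>)"
        unfolding has_vector_derivative_def .
      have "norm (vd (at_angle \<delta>) \<theta> - vd (at_angle \<gamma>) \<theta>) \<le> m / 2"
        using d[of \<theta>] by (simp add: e_def)
      then show "onorm (\<lambda>k. k *\<^sub>R (vd (at_angle \<delta>) \<theta> - vd (at_angle \<gamma>) \<theta>)) \<le> m / 2"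
        by (intro onorm_le) (metis mult.commute mult_left_mono norm_ge_zero norm_scaleR real_norm_def)
    qed auto
    have inj: "a = b" if "\<bar>a - b\<bar> \<le> pi" "at_angle \<delta> a = at_angle \<delta> b" for a b
    proof -
      have "m * \<bar>a - b\<bar> \<le> m / 2 * \<bar>a - b\<bar>"
        using m(2)[OF that(1)] lip[of a b] that(2) by (simp add: norm_minus_commute)
      then show ?thesis using m(1) by simp
    qed
    have "inj_on (at_angle \<delta>) {0..<2 * pi}"
    proof (rule linorder_inj_onI)
      fix a b :: real assume ab: "a < b" "a \<in> {0..<2 * pi}" "b \<in> {0..<2 * pi}"
      show "at_angle \<delta> a \<noteq> at_angle \<delta> b"
      proof
        assume eq: "at_angle \<delta> a = at_angle \<delta> b"
        show False
        proof (cases "b - a \<le> pi")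
          case True
          then show False using inj[OF _ eq] ab by auto
        next
          case False
          have "at_angle \<delta> (b - 2 * pi) = at_angle \<delta> a"
            using periodic_at_angle[of \<delta>] eq unfolding periodic_def by (metis diff_add_cancel)
          then have "a = b - 2 * pi"
            using inj[of a "b - 2 * pi"] ab False by (auto simp: abs_le_iff)
          then show False using ab by auto
        qed
      qed
    qed auto
    then show "\<delta> \<in> Emb"
      using imm unfolding Emb_def angle_deriv_1 by blast
  qed
qed

lemma open_Emb: "open Emb"
  unfolding open_loop_def
proof
  fix \<gamma> assume "\<gamma> \<in> Emb"
  then obtain e where "e > 0" "\<And>\<delta>. (\<And>\<theta>. dist (angle_deriv 1 \<delta> \<theta>) (angle_deriv 1 \<gamma> \<theta>) < e) \<Longrightarrow> \<delta> \<in> Emb"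
    using Emb_perturb by blast
  then show "\<exists>k. \<exists>e>0. \<forall>\<delta>. (\<forall>j\<le>k. \<forall>\<theta>. dist (angle_deriv j \<delta> \<theta>) (angle_deriv j \<gamma> \<theta>) < e) \<longrightarrow> \<delta> \<in> Emb"
    by (intro exI[of _ 1] exI[of _ e]) auto
qed

lemma tendsto_loop_add: "(f \<longlongrightarrow> a) F \<Longrightarrow> (g \<longlongrightarrow> b) F \<Longrightarrow> ((\<lambda>x. f x + g x) \<longlongrightarrow> (a + b :: loop)) F"
  unfolding tendsto_loop_iff at_angle_plus by (rule smooth_limit_add)

lemma tendsto_loop_scaleR: "(r \<longlongrightarrow> s) F \<Longrightarrow> (g \<longlongrightarrow> b) F \<Longrightarrow> ((\<lambda>x. r x *\<^sub>R g x) \<longlongrightarrow> (s *\<^sub>R b :: loop)) F"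
  unfolding tendsto_loop_iff at_angle_scaleR by (intro smooth_limit_scaleR smooth_limit_const_fun)

text \<open>The first derivative does not need the whole sequence of directions used in \<open>Ck_on\<close>; constant
sequences suffice.\<close>

lemma Ck_on_Suc_obtain_derivative:
  fixes F :: "loop \<Rightarrow> real"
  assumes F: "Ck_on (Suc k) U F" and U: "open U"
  obtains DF where "\<And>x v. x \<in> U \<Longrightarrow> ((\<lambda>t. (F (x + t *\<^sub>R v) - F x) / t) \<longlongrightarrow> DF x v) (at 0)"
    "continuous_on (U \<times> UNIV) (\<lambda>(x, v). DF x v)"
proof -
  from F obtain D :: "nat \<Rightarrow> loop \<Rightarrow> (nat \<Rightarrow> loop) \<Rightarrow> real" where
    D: "\<forall>x\<in>U. \<forall>v. D 0 x v = F x"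
       "\<forall>j<Suc k. \<forall>x\<in>U. \<forall>v. ((\<lambda>t. (D j (x + t *\<^sub>R v j) v - D j x v) /\<^sub>R t) \<longlongrightarrow> D (Suc j) x v) (at 0)"
       "\<forall>j\<le>Suc k. continuous_on (U \<times> UNIV) (\<lambda>(x, v). D j x v)"
    unfolding Ck_on_def by blast
  have D0: "D 0 x v = F x" if "x \<in> U" for x v
    using D(1) that by blast
  have D1: "((\<lambda>t. (D 0 (x + t *\<^sub>R v 0) v - D 0 x v) /\<^sub>R t) \<longlongrightarrow> D 1 x v) (at 0)" if "x \<in> U" for x v
    using D(2)[rule_format, of 0 x v] that by simp
  have Dc: "continuous_on (U \<times> UNIV) (\<lambda>(x, v). D 1 x v)"
    using D(3)[rule_format, of 1] by simp
  show thesis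
  proof (rule that[of "\<lambda>x v. D 1 x (\<lambda>_. v)"])
    fix x v assume x: "x \<in> U"
    have "((\<lambda>t. x + t *\<^sub>R v) \<longlongrightarrow> x + 0 *\<^sub>R v) (at 0)"
      by (intro tendsto_loop_add tendsto_loop_scaleR tendsto_const tendsto_ident_at)
    then have "\<forall>\<^sub>F t in at 0. x + t *\<^sub>R v \<in> U"
      using topological_tendstoD[OF _ U] x by auto
    then have "\<forall>\<^sub>F t in at 0. (D 0 (x + t *\<^sub>R v) (\<lambda>_. v) - D 0 x (\<lambda>_. v)) /\<^sub>R t = (F (x + t *\<^sub>R v) - F x) / t"
      by eventually_elim (simp add: D0 x divide_inverse mult.commute)
    with D1[OF x, of "\<lambda>_. v"] show "((\<lambda>t. (F (x + t *\<^sub>R v) - F x) / t) \<longlongrightarrow> D 1 x (\<lambda>_. v)) (at 0)"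
      using Lim_transform_eventually by fastforce
  next
    have "continuous_on (U \<times> UNIV) (\<lambda>p. (fst p, \<lambda>_::nat. snd p) :: loop \<times> (nat \<Rightarrow> loop))"
      by (intro continuous_on_Pair continuous_on_fst continuous_on_id continuous_on_coordinatewise_then_product continuous_on_snd)
    from continuous_on_compose2[OF Dc this]
    show "continuous_on (U \<times> UNIV) (\<lambda>(x, v). D 1 x (\<lambda>_. v))"
      by (simp add: case_prod_beta image_subset_iff)
  qed
qed

text \<open>A \<open>C\<^sup>1\<close> function can be differentiated along the paths \<open>t \<mapsto> x + t a t\<close> with \<open>a t\<close> converging to
\<open>a0\<close>, and not only along lines. By the mean value theorem on the segment from \<open>x\<close> to
\<open>x + t a t\<close> the difference quotient is \<open>DF (x + s a t) (a t)\<close> for some \<open>s\<close> between \<open>0\<close> and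
\<open>t\<close>; joint continuity of \<open>DF\<close> gives the limit. Linearity of the derivative is not used.\<close>

lemma derivative_along_path:
  fixes F :: "loop \<Rightarrow> real"
  assumes U: "open U"
    and DF: "\<And>x v. x \<in> U \<Longrightarrow> ((\<lambda>t. (F (x + t *\<^sub>R v) - F x) / t) \<longlongrightarrow> DF x v) (at 0)"
    and cont: "continuous_on (U \<times> UNIV) (\<lambda>(x, v). DF x v)"
    and x: "x \<in> U" and a: "(a \<longlongrightarrow> a0) (at (0::real))"
  shows "((\<lambda>t. (F (x + t *\<^sub>R a t) - F x) / t) \<longlongrightarrow> DF x a0) (at 0)"
proof -
  have "((\<lambda>p. x + fst p *\<^sub>R a (snd p)) \<longlongrightarrow> x + 0 *\<^sub>R a0) (nhds 0 \<times>\<^sub>F at 0)"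
    by (intro tendsto_loop_add tendsto_loop_scaleR tendsto_const filterlim_fst filterlim_compose[OF a filterlim_snd])
  then have "\<forall>\<^sub>F p in nhds 0 \<times>\<^sub>F at 0. x + fst p *\<^sub>R a (snd p) \<in> U"
    using topological_tendstoD[OF _ U] x by auto
  then obtain P Q where P: "eventually P (nhds 0)" and Q: "eventually Q (at 0)"
    and PQ: "\<And>s t. P s \<Longrightarrow> Q t \<Longrightarrow> x + s *\<^sub>R a t \<in> U"
    unfolding eventually_prod_filter by auto
  obtain d where d: "d > 0" "\<And>s. \<bar>s\<bar> < d \<Longrightarrow> P s"
    using P unfolding eventually_nhds_metric by (auto simp: dist_real_def)
  have "\<exists>s. \<bar>s\<bar> \<le> \<bar>t\<bar> \<and> x + s *\<^sub>R a t \<in> U \<and> (F (x + t *\<^sub>R a t) - F x) / t = DF (x + s *\<^sub>R a t) (a t)"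
    if t: "Q t" "\<bar>t\<bar> < d" "t \<noteq> 0" for t
  proof -
    have inU: "x + s *\<^sub>R a t \<in> U" if "\<bar>s\<bar> \<le> \<bar>t\<bar>" for s
      using PQ d(2) t that by auto
    have der: "((\<lambda>s. F (x + s *\<^sub>R a t)) has_real_derivative DF (x + s *\<^sub>R a t) (a t)) (at s)" if "\<bar>s\<bar> \<le> \<bar>t\<bar>" for s
      using DF[OF inU[OF that], of "a t"] unfolding DERIV_def by (simp add: scaleR_add_left add.assoc)
    show ?thesis
    proof (cases "t > 0")
      case True
      from MVT2[OF this, of "\<lambda>s. F (x + s *\<^sub>R a t)" "\<lambda>s. DF (x + s *\<^sub>R a t) (a t)"] der
      obtain s where "0 < s" "s < t" "F (x + t *\<^sub>R a t) - F (x + 0 *\<^sub>R a t) = (t - 0) * DF (x + s *\<^sub>R a t) (a t)"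
        by auto
      then show ?thesis using inU True by (intro exI[of _ s]) auto
    next
      case False
      then have "t < 0" using t by simp
      from MVT2[OF this, of "\<lambda>s. F (x + s *\<^sub>R a t)" "\<lambda>s. DF (x + s *\<^sub>R a t) (a t)"] der
      obtain s where "t < s" "s < 0" "F (x + 0 *\<^sub>R a t) - F (x + t *\<^sub>R a t) = (0 - t) * DF (x + s *\<^sub>R a t) (a t)"
        by auto
      then show ?thesis using inU \<open>t < 0\<close> by (intro exI[of _ s]) (auto simp: field_simps)
    qed
  qed
  then obtain s where s: "\<And>t. Q t \<Longrightarrow> \<bar>t\<bar> < d \<Longrightarrow> t \<noteq> 0 \<Longrightarrow> \<bar>s t\<bar> \<le> \<bar>t\<bar> \<and> x + s t *\<^sub>R a t \<in> U
      \<and> (F (x + t *\<^sub>R a t) - F x) / t = DF (x + s t *\<^sub>R a t) (a t)"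
    by metis
  have "\<forall>\<^sub>F t in at 0. \<bar>t\<bar> < d" "\<forall>\<^sub>F t in at (0::real). t \<noteq> 0"
    using d(1) by (auto simp: eventually_at intro: exI[of _ d])
  with Q have ev: "\<forall>\<^sub>F t in at 0. \<bar>s t\<bar> \<le> \<bar>t\<bar> \<and> x + s t *\<^sub>R a t \<in> U
      \<and> (F (x + t *\<^sub>R a t) - F x) / t = DF (x + s t *\<^sub>R a t) (a t)"
    by eventually_elim (use s in auto)
  have "(s \<longlongrightarrow> 0) (at 0)"
    by (rule Lim_null_comparison[of _ "\<lambda>t. \<bar>t\<bar>"])
      (use ev in \<open>auto intro!: tendsto_eq_intros elim: eventually_mono\<close>)
  then have "((\<lambda>t. x + s t *\<^sub>R a t) \<longlongrightarrow> x + 0 *\<^sub>R a0) (at 0)"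
    by (intro tendsto_loop_add tendsto_loop_scaleR tendsto_const a)
  then have "((\<lambda>t. (x + s t *\<^sub>R a t, a t)) \<longlongrightarrow> (x, a0)) (at 0)"
    using a by (auto intro: tendsto_Pair)
  moreover have "\<forall>\<^sub>F t in at 0. (x + s t *\<^sub>R a t, a t) \<in> U \<times> UNIV"
    using ev by (auto elim: eventually_mono)
  ultimately have "((\<lambda>t. DF (x + s t *\<^sub>R a t) (a t)) \<longlongrightarrow> DF x a0) (at 0)"
    using continuous_on_tendsto_compose[OF cont, of "\<lambda>t. (x + s t *\<^sub>R a t, a t)" "(x, a0)" "at 0"] x
    by auto
  then show ?thesis
    by (rule Lim_transform_eventually) (use ev in \<open>auto elim: eventually_mono\<close>)
qed

section \<open>The two sides of an embedded curve\<close>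

text \<open>Rotation of the plane by a right angle.\<close>

definition rot :: "plane \<Rightarrow> plane" where
  "rot v = vector [- (v $ 2), v $ 1]"

lemma inner_plane: "(v :: plane) \<bullet> w = v $ 1 * w $ 1 + v $ 2 * w $ 2"
  by (simp add: inner_vec_def sum_2)

lemma rot_nth: "rot v $ 1 = - (v $ 2)" "rot v $ 2 = v $ 1"
  by (simp_all add: rot_def vector_2)

lemma bounded_linear_rot: "bounded_linear rot"
  by (rule linear_conv_bounded_linear[THEN iffD1], rule linearI) (simp_all add: vec_eq_iff forall_2 rot_nth)

lemma inner_rot_self: "v \<bullet> rot v = 0" "rot v \<bullet> v = 0"
  by (simp_all add: inner_plane rot_nth)

lemma inner_rot_rot: "rot v \<bullet> rot w = v \<bullet> w"
  by (simp add: inner_plane rot_nth)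

lemma norm_rot: "norm (rot v) = norm v"
  by (simp add: norm_eq_sqrt_inner inner_rot_rot)

lemma rot_eq_0_iff: "rot v = 0 \<longleftrightarrow> v = 0"
  by (metis norm_eq_zero norm_rot)

lemma rot_frame_expansion:
  assumes "v \<noteq> 0"
  shows "w = ((w \<bullet> v) / (v \<bullet> v)) *\<^sub>R v + ((w \<bullet> rot v) / (v \<bullet> v)) *\<^sub>R rot v"
proof -
  have p: "v \<bullet> v \<noteq> 0" using assms by simp
  have "(v \<bullet> v) *\<^sub>R w = (w \<bullet> v) *\<^sub>R v + (w \<bullet> rot v) *\<^sub>R rot v"
    by (simp add: vec_eq_iff forall_2 inner_plane rot_nth algebra_simps)
  then have "w = (1 / (v \<bullet> v)) *\<^sub>R ((w \<bullet> v) *\<^sub>R v + (w \<bullet> rot v) *\<^sub>R rot v)"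
    using p by (metis (no_types, lifting) divide_self_if scaleR_one scaleR_scaleR times_divide_eq_left mult_1)
  then show ?thesis by (simp add: scaleR_add_right)
qed

text \<open>The normal of a parametrized curve obtained by rotating its velocity. It is not normalized, and its
side depends on the orientation of the parametrization.\<close>

definition normal_at :: "loop \<Rightarrow> real \<Rightarrow> plane" where
  "normal_at \<gamma> \<theta> = rot (vd (at_angle \<gamma>) \<theta>)"

lemma normal_at_nonzero: "\<gamma> \<in> Emb \<Longrightarrow> normal_at \<gamma> \<theta> \<noteq> 0"
  using Emb_D(1) by (simp add: normal_at_def rot_eq_0_iff)

lemma inner_normal_at: "normal_at \<gamma> \<theta> \<bullet> vd (at_angle \<gamma>) \<theta> = 0" "vd (at_angle \<gamma>) \<theta> \<bullet> normal_at \<gamma> \<theta> = 0"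
  by (simp_all add: normal_at_def inner_rot_self)

lemma norm_normal_at: "norm (normal_at \<gamma> \<theta>) = norm (vd (at_angle \<gamma>) \<theta>)"
  by (simp add: normal_at_def norm_rot)

lemma smooth_normal_at: "smooth (normal_at \<gamma>)"
  unfolding normal_at_def by (intro smooth_bounded_linear[OF bounded_linear_rot] smooth_vd smooth_at_angle)

lemma periodic_normal_at: "periodic (normal_at \<gamma>)"
  using periodic_vd[OF smooth_at_angle periodic_at_angle, of \<gamma>] by (simp add: periodic_def normal_at_def)

lemma curve_point_close_angle:
  assumes "x \<in> curve \<gamma>"
  obtains h where "\<bar>h\<bar> \<le> pi" "x = at_angle \<gamma> (\<theta> + h)"
proof -
  obtain s where s: "x = at_angle \<gamma> s" using assms by (auto simp: curve_def)
  obtain h' n where h': "h' \<in> {0..<2 * pi}" "s - \<theta> + pi = h' + 2 * pi * of_int n" using angle_reduction by blast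
  show thesis
  proof (rule that[of "h' - pi"])
    show "\<bar>h' - pi\<bar> \<le> pi" using h'(1) by auto
    have "s = (\<theta> + (h' - pi)) + 2 * pi * of_int n" using h'(2) by simp
    then show "x = at_angle \<gamma> (\<theta> + (h' - pi))"
      using s periodic_int_shift[OF periodic_at_angle] by metis
  qed
qed

text \<open>Near the curve, moving along the normal leaves the curve.\<close>

lemma Emb_tube:
  assumes \<gamma>: "\<gamma> \<in> Emb"
  obtains \<tau> where "\<tau> > 0" "\<And>\<theta> t. t \<noteq> 0 \<Longrightarrow> \<bar>t\<bar> < \<tau> \<Longrightarrow> at_angle \<gamma> \<theta> + t *\<^sub>R normal_at \<gamma> \<theta> \<notin> curve \<gamma>"
proof -
  let ?g = "at_angle \<gamma>"
  obtain m where m: "m > 0" "\<And>a b. \<bar>a - b\<bar> \<le> pi \<Longrightarrow> norm (?g a - ?g b) \<ge> m * \<bar>a - b\<bar>"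
    using Emb_chord_arc[OF \<gamma>] by blast
  obtain \<mu> where \<mu>: "\<mu> > 0" "\<And>\<theta>. norm (vd ?g \<theta>) \<ge> \<mu>" using Emb_speed_bound[OF \<gamma>] by blast
  obtain M where M: "\<And>\<theta>. \<theta> \<in> {0..2 * pi} \<Longrightarrow> norm (vd ?g \<theta>) \<le> M"
    using smooth_bounded_image[OF smooth_vd[OF smooth_at_angle]] unfolding bounded_iff by blast
  have M': "norm (vd ?g \<theta>) \<le> M" for \<theta>
    using angle_deriv_ball_extend[where P = "\<lambda>a b. norm a \<le> M" and j = 1 and \<gamma> = \<gamma>] M
    unfolding angle_deriv_1 by blast
  have M0: "M > 0" using M'[of 0] \<mu>(1) \<mu>(2)[of 0] by linarith
  obtain d where d: "d > 0" "\<And>\<theta> h. \<bar>h\<bar> < d \<Longrightarrow> norm (?g (\<theta> + h) - ?g \<theta> - h *\<^sub>R vd ?g \<theta>) \<le> \<mu> / 2 * \<bar>h\<bar>"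
    using uniform_strict_derivative[OF smooth_at_angle periodic_at_angle, of "\<mu> / 2"] \<mu>(1) by auto
  show thesis
  proof (rule that[of "m * d / M"])
    \<comment> \<open>with this bound on \<open>t\<close>, the chord-arc estimate places a second parameter within \<open>d\<close> of \<open>\<theta>\<close>\<close>
    show "m * d / M > 0" using m d M0 by simp
    fix \<theta> t :: real assume t: "t \<noteq> 0" "\<bar>t\<bar> < m * d / M"
    show "?g \<theta> + t *\<^sub>R normal_at \<gamma> \<theta> \<notin> curve \<gamma>"
    proof
      assume "?g \<theta> + t *\<^sub>R normal_at \<gamma> \<theta> \<in> curve \<gamma>"
      then obtain h where h: "\<bar>h\<bar> \<le> pi" "?g \<theta> + t *\<^sub>R normal_at \<gamma> \<theta> = ?g (\<theta> + h)"
        using curve_point_close_angle by blast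
      have D: "?g (\<theta> + h) - ?g \<theta> = t *\<^sub>R normal_at \<gamma> \<theta>"
        unfolding h(2)[symmetric] by simp
      have "m * \<bar>h\<bar> \<le> \<bar>t\<bar> * norm (vd ?g \<theta>)"
        using m(2)[of "\<theta> + h" \<theta>] h(1) by (simp add: D norm_normal_at)
      also have "\<dots> \<le> \<bar>t\<bar> * M" by (intro mult_left_mono M') auto
      also have "\<dots> < m * d" using t(2) M0 by (simp add: pos_less_divide_eq)
      finally have "\<bar>h\<bar> < d" using m(1) by simp
      from d(2)[OF this, of \<theta>] have le: "norm (t *\<^sub>R normal_at \<gamma> \<theta> - h *\<^sub>R vd ?g \<theta>) \<le> \<mu> / 2 * \<bar>h\<bar>"
        unfolding D .
      have "\<bar>h\<bar> * (norm (vd ?g \<theta>))\<^sup>2 = \<bar>(t *\<^sub>R normal_at \<gamma> \<theta> - h *\<^sub>R vd ?g \<theta>) \<bullet> vd ?g \<theta>\<bar>"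
        by (simp add: inner_diff_left inner_normal_at power2_norm_eq_inner abs_mult)
      also have "\<dots> \<le> \<mu> / 2 * \<bar>h\<bar> * norm (vd ?g \<theta>)"
        using Cauchy_Schwarz_ineq2 le by (meson mult_right_mono norm_ge_zero order_trans)
      finally have "(\<bar>h\<bar> * norm (vd ?g \<theta>)) * norm (vd ?g \<theta>) \<le> (\<mu> / 2 * \<bar>h\<bar>) * norm (vd ?g \<theta>)"
        by (simp add: power2_eq_square mult.assoc)
      then have "\<bar>h\<bar> * norm (vd ?g \<theta>) \<le> \<mu> / 2 * \<bar>h\<bar>"
        by (rule mult_right_le_imp_le) (use \<mu>(1) \<mu>(2)[of \<theta>] in linarith)
      moreover have "\<bar>h\<bar> * \<mu> \<le> \<bar>h\<bar> * norm (vd ?g \<theta>)" using \<mu>(2) by (intro mult_left_mono) auto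
      ultimately have "\<bar>h\<bar> * \<mu> \<le> 0" by argo
      then have "h = 0" using \<mu>(1) by (simp add: mult_le_0_iff)
      then show False using D t(1) normal_at_nonzero[OF \<gamma>] by simp
    qed
  qed
qed

text \<open>Every point of the plane lies on the normal line through a nearest point of the curve. Together with
the tube this covers a neighbourhood of the curve without an inverse function theorem.\<close>

lemma nearest_point_normal:
  assumes \<gamma>: "\<gamma> \<in> Emb"
  obtains \<theta> t where "y = at_angle \<gamma> \<theta> + t *\<^sub>R normal_at \<gamma> \<theta>"
    "\<And>x. x \<in> curve \<gamma> \<Longrightarrow> \<bar>t\<bar> * norm (vd (at_angle \<gamma>) \<theta>) \<le> dist y x"
proof -
  let ?g = "at_angle \<gamma>"
  have "curve \<gamma> \<noteq> {}" by (simp add: curve_def)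
  then obtain x where x: "x \<in> curve \<gamma>" "\<And>z. z \<in> curve \<gamma> \<Longrightarrow> dist y x \<le> dist y z"
    using continuous_attains_inf[OF compact_curve, of \<gamma> "dist y"] continuous_on_dist[OF continuous_on_const continuous_on_id] by metis
  then obtain \<theta> where \<theta>: "x = ?g \<theta>" by (auto simp: curve_def)
  let ?\<phi> = "\<lambda>s. (y - ?g s) \<bullet> (y - ?g s)"
  have "((\<lambda>s. y - ?g s) has_vector_derivative 0 - vd ?g \<theta>) (at \<theta>)"
    by (intro has_vector_derivative_diff has_vector_derivative_const smooth_has_vector_derivative smooth_at_angle)
  from bounded_bilinear.has_vector_derivative[OF bounded_bilinear_inner this this]
  have D: "(?\<phi> has_real_derivative - 2 * ((y - ?g \<theta>) \<bullet> vd ?g \<theta>)) (at \<theta>)"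
    unfolding has_real_derivative_iff_has_vector_derivative by (simp add: inner_commute)
  have min: "?\<phi> \<theta> \<le> ?\<phi> s" for s
  proof -
    have "norm (y - ?g \<theta>) \<le> norm (y - ?g s)" using x(2)[of "?g s"] \<theta> by (auto simp: curve_def dist_norm)
    then show ?thesis by (simp add: dot_square_norm power_mono)
  qed
  have "- 2 * ((y - ?g \<theta>) \<bullet> vd ?g \<theta>) = 0"
    by (rule DERIV_local_min[OF D zero_less_one]) (use min in blast)
  then have perp: "(y - ?g \<theta>) \<bullet> vd ?g \<theta> = 0" by simp
  define t where "t = ((y - ?g \<theta>) \<bullet> normal_at \<gamma> \<theta>) / (vd ?g \<theta> \<bullet> vd ?g \<theta>)"
  have eq: "y - ?g \<theta> = t *\<^sub>R normal_at \<gamma> \<theta>"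
    using rot_frame_expansion[OF Emb_D(1)[OF \<gamma>], of "y - ?g \<theta>" \<theta>] perp by (simp add: t_def normal_at_def)
  show thesis
  proof (rule that)
    show "y = ?g \<theta> + t *\<^sub>R normal_at \<gamma> \<theta>" using eq by (simp add: algebra_simps)
    fix z assume "z \<in> curve \<gamma>"
    then have "norm (y - ?g \<theta>) \<le> dist y z" using x(2) \<theta> by (simp add: dist_norm)
    then show "\<bar>t\<bar> * norm (vd ?g \<theta>) \<le> dist y z" by (simp add: eq norm_normal_at)
  qed
qed

lemma curve_homeomorphic_sphere:
  assumes \<gamma>: "\<gamma> \<in> Emb"
  shows "curve \<gamma> homeomorphic sphere (0 :: plane) 1"
proof -
  define p where "p = (\<lambda>s. at_angle \<gamma> (2 * pi * s))"
  have img: "path_image p = curve \<gamma>"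
  proof -
    have "(\<lambda>s. 2 * pi * s) ` {0..1} = {0..2 * pi}"
      by (subst image_mult_atLeastAtMost) auto
    moreover have "path_image p = at_angle \<gamma> ` (\<lambda>s. 2 * pi * s) ` {0..1}"
      by (simp only: path_image_def p_def image_image)
    ultimately show ?thesis by (simp only: curve_eq_image_closed)
  qed
  have "path p"
    unfolding path_def p_def
    by (intro continuous_on_compose2[OF smooth_continuous_on[OF smooth_at_angle, of UNIV]] continuous_intros) auto
  moreover have "loop_free p"
    unfolding loop_free_def
  proof (intro ballI impI)
    fix x y :: real assume xy: "x \<in> {0..1}" "y \<in> {0..1}" "p x = p y"
    obtain n where "2 * pi * x = 2 * pi * y + 2 * pi * of_int n"
      using Emb_eq_imp[OF \<gamma>] xy(3) unfolding p_def by blast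
    then have "2 * pi * x = 2 * pi * (y + of_int n)" by (simp add: algebra_simps)
    then have n: "x = y + of_int n" by simp
    then have "\<bar>real_of_int n\<bar> \<le> 1" using xy by auto
    then have "n = 0 \<or> n = 1 \<or> n = -1" by linarith
    then show "x = y \<or> x = 0 \<and> y = 1 \<or> x = 1 \<and> y = 0" using n xy by auto
  qed
  ultimately have "simple_path p" by (simp add: simple_path_def)
  moreover have "pathfinish p = pathstart p"
    using periodic_at_angle[of \<gamma>] unfolding pathfinish_def pathstart_def p_def periodic_def
    by (metis add_0 mult.right_neutral mult_zero_right)
  ultimately have "curve \<gamma> homeomorphic sphere (0 :: complex) 1"
    using homeomorphic_simple_path_image_circle[of p 1 0] img by simp
  moreover have "sphere (0 :: complex) 1 homeomorphic sphere (0 :: plane) 1"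
    by (rule homeomorphic_spheres_gen) simp_all
  ultimately show ?thesis by (rule homeomorphic_trans)
qed

text \<open>This is where the Jordan-Brouwer theorem enters: each complementary component has the whole curve
as its frontier.\<close>

lemma component_touches_curve:
  assumes \<gamma>: "\<gamma> \<in> Emb" and T: "T \<in> components (- curve \<gamma>)" and r: "r > 0" and x: "x \<in> curve \<gamma>"
  obtains y where "y \<in> T" "dist y x < r"
proof -
  have "frontier T = curve \<gamma>"
    using Jordan_Brouwer_frontier[OF curve_homeomorphic_sphere[OF \<gamma>] T] by simp
  then have "x \<in> closure T" using x by (auto simp: frontier_def)
  then show thesis using r that closure_approachable by blast
qed

lemma outside_curve_component:
  assumes "\<gamma> \<in> Emb"
  shows "outside (curve \<gamma>) \<in> components (- curve \<gamma>)"
    and "\<exists>T \<in> components (- curve \<gamma>). T \<inter> outside (curve \<gamma>) = {}"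
proof -
  have b: "bounded (curve \<gamma>)" by (rule compact_imp_bounded[OF compact_curve])
  show O: "outside (curve \<gamma>) \<in> components (- curve \<gamma>)"
    unfolding outside_in_components using connected_outside[OF b] outside_bounded_nonempty[OF b] by simp
  have "\<not> connected (- curve \<gamma>)"
    using Jordan_Brouwer_separation[OF curve_homeomorphic_sphere[OF assms]] by simp
  then have "components (- curve \<gamma>) \<noteq> {outside (curve \<gamma>)}"
    by (metis O in_components_connected Union_components cSup_singleton)
  then obtain T where "T \<in> components (- curve \<gamma>)" "T \<noteq> outside (curve \<gamma>)" using O by blast
  then show "\<exists>T \<in> components (- curve \<gamma>). T \<inter> outside (curve \<gamma>) = {}"
    using components_nonoverlap[OF _ O] by blast
qed

text \<open>The two halves \<open>S 1\<close> and \<open>S (-1)\<close> of the tube are connected and miss the curve, so each lies in one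
component of the complement. Every component approaches the curve and hence contains one of the
halves. Since there are at least two components, exactly one half lies outside. The sign \<open>\<epsilon>\<close> does not
depend on the point of the curve.\<close>

lemma Emb_sides:
  assumes \<gamma>: "\<gamma> \<in> Emb"
  obtains \<epsilon> \<tau> :: real where "\<epsilon> = 1 \<or> \<epsilon> = -1" "\<tau> > 0"
    "\<And>\<theta> t. 0 < t \<Longrightarrow> t < \<tau> \<Longrightarrow> at_angle \<gamma> \<theta> + (\<epsilon> * t) *\<^sub>R normal_at \<gamma> \<theta> \<in> outside (curve \<gamma>)"
    "\<And>\<theta> t. 0 < t \<Longrightarrow> t < \<tau> \<Longrightarrow> at_angle \<gamma> \<theta> - (\<epsilon> * t) *\<^sub>R normal_at \<gamma> \<theta> \<notin> outside (curve \<gamma>)"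
proof -
  let ?g = "at_angle \<gamma>" and ?n = "normal_at \<gamma>" and ?c = "curve \<gamma>"
  obtain \<mu> where \<mu>: "\<mu> > 0" "\<And>\<theta>. norm (vd ?g \<theta>) \<ge> \<mu>" using Emb_speed_bound[OF \<gamma>] by blast
  obtain \<tau> where \<tau>: "\<tau> > 0" "\<And>\<theta> t. t \<noteq> 0 \<Longrightarrow> \<bar>t\<bar> < \<tau> \<Longrightarrow> ?g \<theta> + t *\<^sub>R ?n \<theta> \<notin> ?c"
    using Emb_tube[OF \<gamma>] by blast
  define S where "S \<sigma> = (\<lambda>(\<theta>, t). ?g \<theta> + (\<sigma> * t) *\<^sub>R ?n \<theta>) ` (UNIV \<times> {0<..<\<tau>})" for \<sigma> :: real
  have conn: "connected (S \<sigma>)" for \<sigma>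
    unfolding S_def case_prod_beta
    by (intro connected_continuous_image connected_Times connected_UNIV connected_Ioo continuous_intros
        continuous_on_compose2[OF smooth_continuous_on[OF smooth_at_angle, of UNIV]]
        continuous_on_compose2[OF smooth_continuous_on[OF smooth_normal_at, of UNIV]]) auto
  have disj: "S \<sigma> \<subseteq> - ?c" if "\<sigma> = 1 \<or> \<sigma> = -1" for \<sigma>
  proof -
    have "?g \<theta> + (\<sigma> * t) *\<^sub>R ?n \<theta> \<notin> ?c" if "0 < t" "t < \<tau>" for \<theta> t
      using \<tau>(2)[of "\<sigma> * t" \<theta>] that \<open>\<sigma> = 1 \<or> \<sigma> = -1\<close> by auto
    then show ?thesis by (auto simp: S_def)
  qed
  have meets: "\<exists>\<sigma>. (\<sigma> = 1 \<or> \<sigma> = -1) \<and> S \<sigma> \<subseteq> T" if T: "T \<in> components (- ?c)" for T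
  proof -
    obtain y where y: "y \<in> T" "dist y (?g 0) < \<tau> * \<mu>"
      using component_touches_curve[OF \<gamma> T, of "\<tau> * \<mu>" "?g 0"] \<tau>(1) \<mu>(1) by (auto simp: curve_def)
    obtain \<theta> t where t: "y = ?g \<theta> + t *\<^sub>R ?n \<theta>" "\<And>x. x \<in> ?c \<Longrightarrow> \<bar>t\<bar> * norm (vd ?g \<theta>) \<le> dist y x"
      using nearest_point_normal[OF \<gamma>] by blast
    have "\<bar>t\<bar> * \<mu> \<le> \<bar>t\<bar> * norm (vd ?g \<theta>)" using \<mu>(2) by (intro mult_left_mono) auto
    also have "\<dots> < \<tau> * \<mu>" using t(2)[of "?g 0"] y(2) by (auto simp: curve_def)
    finally have small: "\<bar>t\<bar> < \<tau>" using \<mu>(1) by simp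
    have "y \<notin> ?c" using T y(1) in_components_subset by blast
    then have "t \<noteq> 0" using t(1) by (auto simp: curve_def)
    define \<sigma> where "\<sigma> = sgn t"
    have \<sigma>: "\<sigma> = 1 \<or> \<sigma> = -1" "\<sigma> * \<bar>t\<bar> = t" using \<open>t \<noteq> 0\<close> by (auto simp: \<sigma>_def sgn_if)
    then have "y \<in> S \<sigma>"
      unfolding S_def using t(1) small \<open>t \<noteq> 0\<close> by (intro image_eqI[of _ _ "(\<theta>, \<bar>t\<bar>)"]) auto
    then have "S \<sigma> \<subseteq> T"
      using components_maximal[OF T conn disj[OF \<sigma>(1)]] y(1) by blast
    then show ?thesis using \<sigma>(1) by blast
  qed
  obtain \<epsilon> where \<epsilon>: "\<epsilon> = 1 \<or> \<epsilon> = -1" "S \<epsilon> \<subseteq> outside ?c"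
    using meets[OF outside_curve_component(1)[OF \<gamma>]] by blast
  obtain T where T: "T \<in> components (- ?c)" "T \<inter> outside ?c = {}"
    using outside_curve_component(2)[OF \<gamma>] by blast
  obtain \<sigma> where \<sigma>: "\<sigma> = 1 \<or> \<sigma> = -1" "S \<sigma> \<subseteq> T" using meets[OF T(1)] by blast
  have "?g 0 + (\<epsilon> * (\<tau> / 2)) *\<^sub>R ?n 0 \<in> S \<epsilon>"
    unfolding S_def using \<tau>(1) by (intro image_eqI[of _ _ "(0, \<tau> / 2)"]) auto
  then have "\<sigma> \<noteq> \<epsilon>" using \<epsilon>(2) \<sigma>(2) T(2) by blast
  then have "\<sigma> = - \<epsilon>" using \<epsilon>(1) \<sigma>(1) by auto
  then have opp: "S (- \<epsilon>) \<inter> outside ?c = {}" using \<sigma>(2) T(2) by blast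
  show thesis
  proof (rule that[OF \<epsilon>(1) \<tau>(1)])
    fix \<theta> t :: real assume t: "0 < t" "t < \<tau>"
    have "?g \<theta> + (\<epsilon> * t) *\<^sub>R ?n \<theta> \<in> S \<epsilon>" "?g \<theta> + (- \<epsilon> * t) *\<^sub>R ?n \<theta> \<in> S (- \<epsilon>)"
      unfolding S_def using t by (auto intro!: image_eqI[of _ _ "(\<theta>, t)"])
    then show "?g \<theta> + (\<epsilon> * t) *\<^sub>R ?n \<theta> \<in> outside ?c" "?g \<theta> - (\<epsilon> * t) *\<^sub>R ?n \<theta> \<notin> outside ?c"
      using \<epsilon>(2) opp by auto
  qed
qed

text \<open>The tangent line depends on the curve only: the points of the curve near \<open>at_angle \<gamma> \<theta>\<close> deviate from
the tangent of \<open>\<gamma>\<close> by a small multiple of their distance, so no other parametrization can be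
transversal to it.\<close>

lemma curve_tangent_unique:
  assumes \<gamma>: "\<gamma> \<in> Emb" and eq: "curve \<delta> = curve \<gamma>" "at_angle \<delta> s = at_angle \<gamma> \<theta>"
  shows "normal_at \<gamma> \<theta> \<bullet> vd (at_angle \<delta>) s = 0"
proof -
  let ?g = "at_angle \<gamma>" and ?d = "at_angle \<delta>" and ?n = "normal_at \<gamma> \<theta>"
  obtain m where m: "m > 0" "\<And>a b. \<bar>a - b\<bar> \<le> pi \<Longrightarrow> norm (?g a - ?g b) \<ge> m * \<bar>a - b\<bar>"
    using Emb_chord_arc[OF \<gamma>] by blast
  define Q where "Q h = (1 / h) *\<^sub>R (?d (s + h) - ?d s)" for h
  have "(?d has_vector_derivative vd ?d s) (at s)" by (intro smooth_has_vector_derivative smooth_at_angle)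
  then have lim: "((\<lambda>h. norm (?d (s + h) - ?d s - h *\<^sub>R vd ?d s) / norm h) \<longlongrightarrow> 0) (at 0)"
    by (simp add: has_vector_derivative_def has_derivative_at)
  have "norm (?d (s + h) - ?d s - h *\<^sub>R vd ?d s) / norm h = norm (Q h - vd ?d s)" if "h \<noteq> 0" for h
  proof -
    have "Q h - vd ?d s = (1 / h) *\<^sub>R (?d (s + h) - ?d s - h *\<^sub>R vd ?d s)"
      using that by (simp add: Q_def scaleR_diff_right)
    then show ?thesis by simp
  qed
  then have "\<forall>\<^sub>F h in at 0. norm (?d (s + h) - ?d s - h *\<^sub>R vd ?d s) / norm h = norm (Q h - vd ?d s)"
    by (simp add: eventually_at_filter)
  from Lim_transform_eventually[OF lim this] have Q: "(Q \<longlongrightarrow> vd ?d s) (at 0)"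
    by (rule LIM_zero_cancel[OF tendsto_norm_zero_cancel])
  have key: "\<bar>?n \<bullet> vd ?d s\<bar> \<le> e * (norm ?n / m * norm (vd ?d s))" if e: "e > 0" for e
  proof -
    obtain d where d: "d > 0" "\<And>\<theta> h. \<bar>h\<bar> < d \<Longrightarrow> norm (?g (\<theta> + h) - ?g \<theta> - h *\<^sub>R vd ?g \<theta>) \<le> e * \<bar>h\<bar>"
      using uniform_strict_derivative[OF smooth_at_angle periodic_at_angle e] by blast
    have "isCont ?d s"
      using smooth_continuous_on[OF smooth_at_angle, of UNIV] by (simp add: continuous_on_eq_continuous_at)
    then have "\<forall>\<^sub>F h in at 0. dist (?d (s + h)) (?d s) < m * d"
      using m(1) d(1) tendstoD[of "\<lambda>h. ?d (s + h)" "?d s" "at 0" "m * d"] by (simp add: isCont_iff)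
    moreover have "\<forall>\<^sub>F h in at (0::real). h \<noteq> 0" by (simp add: eventually_at_filter)
    ultimately have "\<forall>\<^sub>F h in at 0. \<bar>?n \<bullet> Q h\<bar> \<le> e * (norm ?n / m * norm (Q h))"
    proof eventually_elim
      case (elim h)
      have "?d (s + h) \<in> curve \<gamma>" unfolding eq(1)[symmetric] by (simp add: curve_def)
      then obtain u where u: "\<bar>u\<bar> \<le> pi" "?d (s + h) = ?g (\<theta> + u)" using curve_point_close_angle by blast
      define \<Delta> where "\<Delta> = ?d (s + h) - ?d s"
      have \<Delta>: "\<Delta> = ?g (\<theta> + u) - ?g \<theta>" by (simp add: \<Delta>_def u(2) eq(2))
      have mu: "m * \<bar>u\<bar> \<le> norm \<Delta>" using m(2)[of "\<theta> + u" \<theta>] u(1) by (simp add: \<Delta>)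
      also have "\<dots> < m * d" using elim(1) by (simp add: \<Delta>_def dist_norm)
      finally have "\<bar>u\<bar> < d" using m(1) by simp
      from d(2)[OF this, of \<theta>] have "norm (\<Delta> - u *\<^sub>R vd ?g \<theta>) \<le> e * \<bar>u\<bar>" by (simp add: \<Delta>)
      moreover have "e * \<bar>u\<bar> \<le> e * (norm \<Delta> / m)"
        using mu m(1) e by (intro mult_left_mono) (simp_all add: field_simps)
      ultimately have le: "norm (\<Delta> - u *\<^sub>R vd ?g \<theta>) \<le> e * (norm \<Delta> / m)" by linarith
      have "?n \<bullet> \<Delta> = ?n \<bullet> (\<Delta> - u *\<^sub>R vd ?g \<theta>)" by (simp add: inner_diff_right inner_normal_at)
      then have "\<bar>?n \<bullet> \<Delta>\<bar> \<le> norm ?n * norm (\<Delta> - u *\<^sub>R vd ?g \<theta>)"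
        using Cauchy_Schwarz_ineq2[of ?n "\<Delta> - u *\<^sub>R vd ?g \<theta>"] by simp
      also have "\<dots> \<le> norm ?n * (e * (norm \<Delta> / m))" by (intro mult_left_mono le) simp
      finally have "\<bar>?n \<bullet> \<Delta>\<bar> / \<bar>h\<bar> \<le> norm ?n * (e * (norm \<Delta> / m)) / \<bar>h\<bar>" by (rule divide_right_mono) simp
      then show ?case unfolding Q_def \<Delta>_def[symmetric] by (simp add: field_simps)
    qed
    then show ?thesis
      by (rule tendsto_le[OF at_neq_bot tendsto_mult[OF tendsto_const tendsto_mult[OF tendsto_const tendsto_norm[OF Q]]]
            tendsto_rabs[OF tendsto_inner[OF tendsto_const Q]]])
  qed
  show ?thesis
  proof (rule ccontr)
    assume "?n \<bullet> vd ?d s \<noteq> 0"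
    define K where "K = norm ?n / m * norm (vd ?d s)"
    have K: "K \<ge> 0" using m(1) by (simp add: K_def)
    define e where "e = \<bar>?n \<bullet> vd ?d s\<bar> / (2 * (K + 1))"
    have "e > 0" using \<open>?n \<bullet> vd ?d s \<noteq> 0\<close> K by (simp add: e_def)
    from key[OF this] have "\<bar>?n \<bullet> vd ?d s\<bar> \<le> e * K" by (simp add: K_def)
    also have "\<dots> < e * (2 * (K + 1))" using \<open>e > 0\<close> K by (intro mult_strict_left_mono) auto
    also have "\<dots> = \<bar>?n \<bullet> vd ?d s\<bar>" using K by (simp add: e_def)
    finally show False by simp
  qed
qed

text \<open>The description of the exterior normal by a definite description is thereby justified, and up to one
global sign it is given by the rotated velocity.\<close>

lemma ext_normal_curve:
  assumes \<gamma>: "\<gamma> \<in> Emb"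
  obtains \<epsilon> :: real where "\<epsilon> = 1 \<or> \<epsilon> = -1"
    "\<And>\<theta>. ext_normal (curve \<gamma>) (at_angle \<gamma> \<theta>) = (\<epsilon> / norm (normal_at \<gamma> \<theta>)) *\<^sub>R normal_at \<gamma> \<theta>"
proof -
  let ?g = "at_angle \<gamma>" and ?n = "normal_at \<gamma>" and ?c = "curve \<gamma>"
  obtain \<epsilon> \<tau> :: real where \<epsilon>: "\<epsilon> = 1 \<or> \<epsilon> = -1" and \<tau>: "\<tau> > 0"
    and out: "\<And>\<theta> t. 0 < t \<Longrightarrow> t < \<tau> \<Longrightarrow> ?g \<theta> + (\<epsilon> * t) *\<^sub>R ?n \<theta> \<in> outside ?c"
    and ins: "\<And>\<theta> t. 0 < t \<Longrightarrow> t < \<tau> \<Longrightarrow> ?g \<theta> - (\<epsilon> * t) *\<^sub>R ?n \<theta> \<notin> outside ?c"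
    using Emb_sides[OF \<gamma>] by metis
  show thesis
  proof (rule that[OF \<epsilon>])
    fix \<theta>
    define r where "r = norm (?n \<theta>)"
    have r: "r > 0" using normal_at_nonzero[OF \<gamma>] by (simp add: r_def)
    define N where "N = (\<epsilon> / r) *\<^sub>R ?n \<theta>"
    have N1: "norm N = 1" using \<epsilon> r by (auto simp: N_def r_def[symmetric])
    have small: "\<forall>\<^sub>F t in at_right 0. 0 < t / r \<and> t / r < \<tau>"
      using \<tau> r eventually_at_right_real[of 0 "\<tau> * r"]
      by (auto elim!: eventually_mono simp: field_simps)
    have Nout: "\<forall>\<^sub>F t in at_right 0. ?g \<theta> + t *\<^sub>R N \<in> outside ?c"
      using small
    proof eventually_elim
      case (elim t)
      then show ?case using out[of "t / r" \<theta>] by (simp add: N_def mult.commute)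
    qed
    have Nin: "\<forall>\<^sub>F t in at_right 0. ?g \<theta> + t *\<^sub>R (- N) \<notin> outside ?c"
      using small
    proof eventually_elim
      case (elim t)
      then show ?case using ins[of "t / r" \<theta>] by (simp add: N_def mult.commute)
    qed
    show "ext_normal ?c (?g \<theta>) = (\<epsilon> / norm (?n \<theta>)) *\<^sub>R ?n \<theta>"
      unfolding ext_normal_def r_def[symmetric] N_def[symmetric]
    proof (rule the_equality)
      show "norm N = 1 \<and> (\<forall>\<delta>\<in>Emb. \<forall>s. curve \<delta> = ?c \<and> at_angle \<delta> s = ?g \<theta> \<longrightarrow> N \<bullet> angle_deriv 1 \<delta> s = 0) \<and>
          (\<forall>\<^sub>F t in at_right 0. ?g \<theta> + t *\<^sub>R N \<in> outside ?c)"
        using N1 Nout curve_tangent_unique[OF \<gamma>] by (auto simp: N_def angle_deriv_1[unfolded One_nat_def])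
    next
      fix N' assume N': "norm N' = 1 \<and> (\<forall>\<delta>\<in>Emb. \<forall>s. curve \<delta> = ?c \<and> at_angle \<delta> s = ?g \<theta> \<longrightarrow> N' \<bullet> angle_deriv 1 \<delta> s = 0) \<and>
          (\<forall>\<^sub>F t in at_right 0. ?g \<theta> + t *\<^sub>R N' \<in> outside ?c)"
      then have perp: "N' \<bullet> vd ?g \<theta> = 0" using \<gamma> by (auto simp: angle_deriv_1[unfolded One_nat_def])
      define a where "a = (N' \<bullet> ?n \<theta>) / (vd ?g \<theta> \<bullet> vd ?g \<theta>)"
      have a: "N' = a *\<^sub>R ?n \<theta>"
        using rot_frame_expansion[OF Emb_D(1)[OF \<gamma>], of N' \<theta>] perp by (simp add: a_def normal_at_def)
      then have "\<bar>a\<bar> * r = 1" using N' by (simp add: r_def)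
      then have "a = 1 / r \<or> a = - (1 / r)" using r by (auto simp: field_simps abs_if split: if_splits)
      then have "N' = N \<or> N' = - N" using \<epsilon> a by (auto simp: N_def)
      moreover have "N' \<noteq> - N"
      proof
        assume "N' = - N"
        then have "\<forall>\<^sub>F t in at_right 0. ?g \<theta> + t *\<^sub>R (- N) \<in> outside ?c"
          using N' by blast
        with Nin have "\<forall>\<^sub>F t in at_right (0::real). False"
          by eventually_elim blast
        then show False by simp
      qed
      ultimately show "N' = N" by blast
    qed
  qed
qed

section \<open>The fields induced by plane vector fields\<close>

text \<open>The normal component of the plane field \<open>W\<close> along a parametrized curve. It is quadratic in the
normal, so the sign of the normal and hence the exterior play no role.\<close>

definition normal_part :: "(plane \<Rightarrow> plane) \<Rightarrow> loop \<Rightarrow> real \<Rightarrow> plane" where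
  "normal_part W \<gamma> \<theta> = ((W (at_angle \<gamma> \<theta>) \<bullet> normal_at \<gamma> \<theta>) * inverse (normal_at \<gamma> \<theta> \<bullet> normal_at \<gamma> \<theta>)) *\<^sub>R normal_at \<gamma> \<theta>"

lemma normal_at_pos: "\<gamma> \<in> Emb \<Longrightarrow> normal_at \<gamma> \<theta> \<bullet> normal_at \<gamma> \<theta> > 0"
  using normal_at_nonzero by simp

lemma induced_field_curve:
  assumes "\<gamma> \<in> Emb"
  shows "induced_field W (curve \<gamma>) (at_angle \<gamma> \<theta>) = normal_part W \<gamma> \<theta>"
proof -
  obtain \<epsilon> :: real where \<epsilon>: "\<epsilon> = 1 \<or> \<epsilon> = -1"
    "\<And>\<theta>. ext_normal (curve \<gamma>) (at_angle \<gamma> \<theta>) = (\<epsilon> / norm (normal_at \<gamma> \<theta>)) *\<^sub>R normal_at \<gamma> \<theta>"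
    using ext_normal_curve[OF assms] by blast
  have "(\<epsilon> / norm n * x) * (\<epsilon> / norm n) = x * inverse (n \<bullet> n)" for n :: plane and x
    using \<epsilon>(1) by (auto simp: dot_square_norm power2_eq_square divide_inverse mult.assoc mult.left_commute)
  moreover have "at_angle \<gamma> \<theta> \<in> curve \<gamma>" by (simp add: curve_def)
  ultimately show ?thesis
    by (simp add: induced_field_def restrict_to_def \<epsilon>(2) normal_part_def)
qed

lemma smooth_normal_part:
  assumes W: "smooth W" and \<gamma>: "\<gamma> \<in> Emb"
  shows "smooth (normal_part W \<gamma>)"
proof -
  have "smooth (\<lambda>\<theta>. inverse (normal_at \<gamma> \<theta> \<bullet> normal_at \<gamma> \<theta>))"
    by (intro smooth_inverse smooth_inner smooth_normal_at normal_at_pos \<gamma>)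
  then have "smooth (\<lambda>\<theta>. ((W (at_angle \<gamma> \<theta>) \<bullet> normal_at \<gamma> \<theta>) * inverse (normal_at \<gamma> \<theta> \<bullet> normal_at \<gamma> \<theta>)) *\<^sub>R normal_at \<gamma> \<theta>)"
    by (intro smooth_scaleR_fun smooth_mult smooth_inner smooth_compose[OF W smooth_at_angle] smooth_normal_at)
  then show ?thesis by (simp add: normal_part_def[abs_def])
qed

lemma periodic_normal_part: "periodic (normal_part W \<gamma>)"
  using periodic_at_angle[of \<gamma>] periodic_normal_at[of \<gamma>] by (simp add: periodic_def normal_part_def)

lemma induced_field_tangent:
  assumes W: "smooth W" and c: "c \<in> Be"
  shows "induced_field W c \<in> tangent_space c"
  unfolding tangent_space_def
proof (intro CollectI conjI ballI impI allI)
  show "induced_field W c x = 0" if "x \<notin> c" for x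
    using that by (simp add: induced_field_def restrict_to_def)
  fix \<gamma> assume \<gamma>: "\<gamma> \<in> Emb" "curve \<gamma> = c"
  obtain \<epsilon> :: real where \<epsilon>: "\<epsilon> = 1 \<or> \<epsilon> = -1"
    "\<And>\<theta>. ext_normal (curve \<gamma>) (at_angle \<gamma> \<theta>) = (\<epsilon> / norm (normal_at \<gamma> \<theta>)) *\<^sub>R normal_at \<gamma> \<theta>"
    using ext_normal_curve[OF \<gamma>(1)] by blast
  define \<alpha> where "\<alpha> \<theta> = W (at_angle \<gamma> \<theta>) \<bullet> ext_normal c (at_angle \<gamma> \<theta>)" for \<theta>
  \<comment> \<open>real powers of the positive function \<open>n \<bullet> n\<close> are known to be smooth\<close>
  have eq: "\<epsilon> / norm (normal_at \<gamma> \<theta>) = \<epsilon> * (normal_at \<gamma> \<theta> \<bullet> normal_at \<gamma> \<theta>) powr (- (1 / 2))" for \<theta>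
    by (simp add: powr_minus_divide powr_half_sqrt norm_eq_sqrt_inner)
  have "\<alpha> = (\<lambda>\<theta>. \<epsilon> *\<^sub>R ((normal_at \<gamma> \<theta> \<bullet> normal_at \<gamma> \<theta>) powr (- (1 / 2)) * (W (at_angle \<gamma> \<theta>) \<bullet> normal_at \<gamma> \<theta>)))"
    unfolding \<alpha>_def \<gamma>(2)[symmetric] \<epsilon>(2) eq by (simp add: mult.assoc)
  moreover have "smooth (\<lambda>\<theta>. (normal_at \<gamma> \<theta> \<bullet> normal_at \<gamma> \<theta>) powr (- (1 / 2)))"
    by (intro smooth_powr smooth_inner smooth_normal_at normal_at_pos \<gamma>(1))
  then have "smooth (\<lambda>\<theta>. \<epsilon> *\<^sub>R ((normal_at \<gamma> \<theta> \<bullet> normal_at \<gamma> \<theta>) powr (- (1 / 2)) * (W (at_angle \<gamma> \<theta>) \<bullet> normal_at \<gamma> \<theta>)))"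
    by (intro smooth_scaleR smooth_mult smooth_inner smooth_compose[OF W smooth_at_angle] smooth_normal_at)
  ultimately have "smooth \<alpha>" by simp
  moreover have "periodic \<alpha>"
    using periodic_at_angle[of \<gamma>] by (simp add: periodic_def \<alpha>_def)
  moreover have "induced_field W c (at_angle \<gamma> \<theta>) = \<alpha> \<theta> *\<^sub>R ext_normal c (at_angle \<gamma> \<theta>)" for \<theta>
    using \<gamma>(2) by (auto simp: induced_field_def restrict_to_def \<alpha>_def curve_def)
  ultimately show "\<exists>\<alpha>. smooth \<alpha> \<and> periodic \<alpha> \<and>
      (\<forall>\<theta>. induced_field W c (at_angle \<gamma> \<theta>) = \<alpha> \<theta> *\<^sub>R ext_normal c (at_angle \<gamma> \<theta>))"
    by blast
qed

text \<open>A \<open>C\<^sup>1\<close> operator \<open>P\<close> on a set \<open>U\<close> of loops, with smooth periodic values and derivative \<open>P'\<close>,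
in terms of uniform convergence of all derivatives. The filter of neighbourhoods that includes the
point itself is used, so that continuity can be composed with maps that are not injective.\<close>

definition C1_operator ::
  "loop set \<Rightarrow> (loop \<Rightarrow> real \<Rightarrow> 'b::real_normed_vector) \<Rightarrow> (loop \<Rightarrow> loop \<Rightarrow> real \<Rightarrow> 'b) \<Rightarrow> bool" where
  "C1_operator U P P' \<longleftrightarrow> (\<forall>\<gamma>\<in>U. \<forall>a. periodic (P \<gamma>) \<and> periodic (P' \<gamma> a) \<and>
     smooth_limit (\<lambda>p. P (fst p)) (P \<gamma>) (inf (nhds (\<gamma>, a)) (principal (U \<times> UNIV))) \<and>
     smooth_limit (\<lambda>p. P' (fst p) (snd p)) (P' \<gamma> a) (inf (nhds (\<gamma>, a)) (principal (U \<times> UNIV))) \<and>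
     smooth_limit (\<lambda>t \<theta>. (P (\<gamma> + t *\<^sub>R a) \<theta> - P \<gamma> \<theta>) /\<^sub>R t) (P' \<gamma> a) (at 0))"

lemma C1_operatorD:
  assumes "C1_operator U P P'" "\<gamma> \<in> U"
  shows "periodic (P \<gamma>)" "periodic (P' \<gamma> a)"
    "smooth_limit (\<lambda>p. P (fst p)) (P \<gamma>) (inf (nhds (\<gamma>, a)) (principal (U \<times> UNIV)))"
    "smooth_limit (\<lambda>p. P' (fst p) (snd p)) (P' \<gamma> a) (inf (nhds (\<gamma>, a)) (principal (U \<times> UNIV)))"
    "smooth_limit (\<lambda>t \<theta>. (P (\<gamma> + t *\<^sub>R a) \<theta> - P \<gamma> \<theta>) /\<^sub>R t) (P' \<gamma> a) (at 0)"
    "smooth (P \<gamma>)" "smooth (P' \<gamma> a)"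
  using assms unfolding C1_operator_def by (blast intro: smooth_limitD(2))+

lemma C1_operator_line:
  assumes "C1_operator U P P'" "\<gamma> \<in> U"
  shows "smooth_limit (\<lambda>t. P (\<gamma> + t *\<^sub>R a)) (P \<gamma>) (at 0)"
proof -
  note d = C1_operatorD[OF assms]
  have "smooth_limit (\<lambda>t \<theta>. P \<gamma> \<theta> + t *\<^sub>R ((P (\<gamma> + t *\<^sub>R a) \<theta> - P \<gamma> \<theta>) /\<^sub>R t)) (\<lambda>\<theta>. P \<gamma> \<theta> + 0 *\<^sub>R P' \<gamma> a \<theta>) (at 0)"
    by (intro smooth_limit_add smooth_limit_const smooth_limit_scaleR smooth_limit_const_fun tendsto_ident_at d)
  then have "smooth_limit (\<lambda>t \<theta>. P \<gamma> \<theta> + t *\<^sub>R ((P (\<gamma> + t *\<^sub>R a) \<theta> - P \<gamma> \<theta>) /\<^sub>R t)) (P \<gamma>) (at 0)"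
    by simp
  then show ?thesis
    by (rule smooth_limit_cong[rotated]) (simp add: eventually_at_filter)
qed

lemma eventually_line_in_open:
  assumes "open U" "\<gamma> \<in> U"
  shows "\<forall>\<^sub>F t in nhds 0. \<gamma> + t *\<^sub>R (a :: loop) \<in> U"
proof -
  have "((\<lambda>t. \<gamma> + t *\<^sub>R a) \<longlongrightarrow> \<gamma> + 0 *\<^sub>R a) (nhds 0)"
    by (intro tendsto_loop_add tendsto_loop_scaleR tendsto_const filterlim_ident)
  then show ?thesis using topological_tendstoD[OF _ assms(1)] assms(2) by auto
qed

lemma filterlim_fst_within: "((\<lambda>p. fst p) \<longlongrightarrow> x) (inf (nhds (x, y)) (principal S))"
  and filterlim_snd_within: "((\<lambda>p. snd p) \<longlongrightarrow> y) (inf (nhds (x, y)) (principal S))"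
  by (auto intro!: tendsto_mono[OF inf_le1] simp: nhds_prod filterlim_fst filterlim_snd)

text \<open>A continuous linear operator is its own derivative at every point.\<close>

lemma C1_operator_linear:
  fixes T :: "loop \<Rightarrow> real \<Rightarrow> 'b::real_normed_vector"
  assumes cont: "\<And>(g :: loop \<times> loop \<Rightarrow> loop) l F. (g \<longlongrightarrow> l) F \<Longrightarrow> smooth_limit (\<lambda>x. T (g x)) (T l) F"
    and lin: "\<And>\<gamma> a t \<theta>. T (\<gamma> + t *\<^sub>R a) \<theta> = T \<gamma> \<theta> + t *\<^sub>R T a \<theta>"
    and per: "\<And>\<gamma>. periodic (T \<gamma>)"
  shows "C1_operator U T (\<lambda>\<gamma>. T)"
proof -
  have s: "smooth (T a)" for a
    using smooth_limitD(2)[OF cont[OF tendsto_const]] .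
  have "smooth_limit (\<lambda>t \<theta>. (T (\<gamma> + t *\<^sub>R a) \<theta> - T \<gamma> \<theta>) /\<^sub>R t) (T a) (at 0)" for \<gamma> a
    by (rule smooth_limit_cong[OF _ smooth_limit_const[OF s]]) (simp add: lin eventually_at_filter)
  then show ?thesis
    unfolding C1_operator_def by (intro ballI allI conjI per cont filterlim_fst_within filterlim_snd_within)
qed

lemma smooth_limit_normal_at: "(g \<longlongrightarrow> l) F \<Longrightarrow> smooth_limit (\<lambda>x. normal_at (g x)) (normal_at l) F"
  unfolding normal_at_def tendsto_loop_iff
  by (intro smooth_limit_bounded_linear[OF bounded_linear_rot] smooth_limit_vd)

lemma normal_at_line: "normal_at (\<gamma> + t *\<^sub>R a) \<theta> = normal_at \<gamma> \<theta> + t *\<^sub>R normal_at a \<theta>"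
proof -
  interpret bounded_linear rot by (rule bounded_linear_rot)
  have "vd (at_angle (\<gamma> + t *\<^sub>R a)) \<theta> = vd (at_angle \<gamma>) \<theta> + t *\<^sub>R vd (at_angle a) \<theta>"
    unfolding at_angle_plus at_angle_scaleR
    by (intro vector_derivative_at has_vector_derivative_add smooth_has_vector_derivative smooth_at_angle
        bounded_linear.has_vector_derivative[OF bounded_linear_scaleR_right])
  then show ?thesis by (simp add: normal_at_def add scale)
qed

lemma C1_operator_normal_at: "C1_operator U normal_at (\<lambda>\<gamma>. normal_at)"
  by (rule C1_operator_linear) (rule smooth_limit_normal_at normal_at_line periodic_normal_at; assumption?)+

lemma C1_operator_smooth_compose:
  fixes W :: "plane \<Rightarrow> 'b::euclidean_space"
  assumes W: "smooth W"
  shows "C1_operator U (\<lambda>\<gamma> \<theta>. W (at_angle \<gamma> \<theta>)) (\<lambda>\<gamma> a \<theta>. frechet_derivative W (at (at_angle \<gamma> \<theta>)) (at_angle a \<theta>))"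
  unfolding C1_operator_def
proof (intro ballI allI conjI)
  fix \<gamma> a :: loop
  let ?F = "inf (nhds (\<gamma>, a)) (principal (U \<times> UNIV))"
  show "periodic (\<lambda>\<theta>. W (at_angle \<gamma> \<theta>))" "periodic (\<lambda>\<theta>. frechet_derivative W (at (at_angle \<gamma> \<theta>)) (at_angle a \<theta>))"
    using periodic_at_angle[of \<gamma>] periodic_at_angle[of a] by (simp_all add: periodic_def)
  have 1: "smooth_limit (\<lambda>p. at_angle (fst p)) (at_angle \<gamma>) ?F" "smooth_limit (\<lambda>p. at_angle (snd p)) (at_angle a) ?F"
    by (rule tendsto_loop_iff[THEN iffD1, OF filterlim_fst_within] tendsto_loop_iff[THEN iffD1, OF filterlim_snd_within])+
  show "smooth_limit (\<lambda>p \<theta>. W (at_angle (fst p) \<theta>)) (\<lambda>\<theta>. W (at_angle \<gamma> \<theta>)) ?F"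
    by (rule smooth_limit_compose[OF W 1(1)])
  show "smooth_limit (\<lambda>p \<theta>. frechet_derivative W (at (at_angle (fst p) \<theta>)) (at_angle (snd p) \<theta>))
      (\<lambda>\<theta>. frechet_derivative W (at (at_angle \<gamma> \<theta>)) (at_angle a \<theta>)) ?F"
    by (intro smooth_limit_frechet_derivative_along W 1)
  show "smooth_limit (\<lambda>t \<theta>. (W (at_angle (\<gamma> + t *\<^sub>R a) \<theta>) - W (at_angle \<gamma> \<theta>)) /\<^sub>R t)
      (\<lambda>\<theta>. frechet_derivative W (at (at_angle \<gamma> \<theta>)) (at_angle a \<theta>)) (at 0)"
    using smooth_limit_difference_quotient[OF W smooth_at_angle smooth_at_angle]
    by (simp add: at_angle_plus at_angle_scaleR)
qed

lemma C1_operator_bilinear: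
  assumes B: "bounded_bilinear B" and P: "C1_operator U P P'" and Q: "C1_operator U Q Q'"
  shows "C1_operator U (\<lambda>\<gamma> \<theta>. B (P \<gamma> \<theta>) (Q \<gamma> \<theta>)) (\<lambda>\<gamma> a \<theta>. B (P' \<gamma> a \<theta>) (Q \<gamma> \<theta>) + B (P \<gamma> \<theta>) (Q' \<gamma> a \<theta>))"
  unfolding C1_operator_def
proof (intro ballI allI conjI)
  fix \<gamma> a :: loop assume \<gamma>: "\<gamma> \<in> U"
  interpret bounded_bilinear B by (rule B)
  note p = C1_operatorD[OF P \<gamma>] and q = C1_operatorD[OF Q \<gamma>]
  show "periodic (\<lambda>\<theta>. B (P \<gamma> \<theta>) (Q \<gamma> \<theta>))"
    "periodic (\<lambda>\<theta>. B (P' \<gamma> a \<theta>) (Q \<gamma> \<theta>) + B (P \<gamma> \<theta>) (Q' \<gamma> a \<theta>))"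
    using p(1,2) q(1,2) by (simp_all add: periodic_def)
  show "smooth_limit (\<lambda>p \<theta>. B (P (fst p) \<theta>) (Q (fst p) \<theta>)) (\<lambda>\<theta>. B (P \<gamma> \<theta>) (Q \<gamma> \<theta>))
      (inf (nhds (\<gamma>, a)) (principal (U \<times> UNIV)))"
    by (intro smooth_limit_bilinear[OF B] p(3) q(3))
  show "smooth_limit (\<lambda>p \<theta>. B (P' (fst p) (snd p) \<theta>) (Q (fst p) \<theta>) + B (P (fst p) \<theta>) (Q' (fst p) (snd p) \<theta>))
      (\<lambda>\<theta>. B (P' \<gamma> a \<theta>) (Q \<gamma> \<theta>) + B (P \<gamma> \<theta>) (Q' \<gamma> a \<theta>)) (inf (nhds (\<gamma>, a)) (principal (U \<times> UNIV)))"
    by (intro smooth_limit_add smooth_limit_bilinear[OF B] p(3,4) q(3,4))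
  have "smooth_limit (\<lambda>t \<theta>. B ((P (\<gamma> + t *\<^sub>R a) \<theta> - P \<gamma> \<theta>) /\<^sub>R t) (Q (\<gamma> + t *\<^sub>R a) \<theta>)
        + B (P \<gamma> \<theta>) ((Q (\<gamma> + t *\<^sub>R a) \<theta> - Q \<gamma> \<theta>) /\<^sub>R t))
      (\<lambda>\<theta>. B (P' \<gamma> a \<theta>) (Q \<gamma> \<theta>) + B (P \<gamma> \<theta>) (Q' \<gamma> a \<theta>)) (at 0)"
    by (intro smooth_limit_add smooth_limit_bilinear[OF B] smooth_limit_const p(5,6) q(5)
        C1_operator_line[OF Q \<gamma>])
  then show "smooth_limit (\<lambda>t \<theta>. (B (P (\<gamma> + t *\<^sub>R a) \<theta>) (Q (\<gamma> + t *\<^sub>R a) \<theta>) - B (P \<gamma> \<theta>) (Q \<gamma> \<theta>)) /\<^sub>R t)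
      (\<lambda>\<theta>. B (P' \<gamma> a \<theta>) (Q \<gamma> \<theta>) + B (P \<gamma> \<theta>) (Q' \<gamma> a \<theta>)) (at 0)"
    by (rule smooth_limit_cong[rotated])
      (simp add: scaleR_left scaleR_right diff_left diff_right scaleR_diff_right)
qed

lemma C1_operator_inverse:
  assumes U: "open U" and P: "C1_operator U P P'" and pos: "\<And>\<gamma> \<theta>. \<gamma> \<in> U \<Longrightarrow> (P \<gamma> \<theta> :: real) > 0"
  shows "C1_operator U (\<lambda>\<gamma> \<theta>. inverse (P \<gamma> \<theta>))
    (\<lambda>\<gamma> a \<theta>. - P' \<gamma> a \<theta> * (inverse (P \<gamma> \<theta>) * inverse (P \<gamma> \<theta>)))"
  unfolding C1_operator_def
proof (intro ballI allI conjI)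
  fix \<gamma> a :: loop assume \<gamma>: "\<gamma> \<in> U"
  note p = C1_operatorD[OF P \<gamma>]
  let ?F = "inf (nhds (\<gamma>, a)) (principal (U \<times> UNIV))"
  show "periodic (\<lambda>\<theta>. inverse (P \<gamma> \<theta>))"
    "periodic (\<lambda>\<theta>. - P' \<gamma> a \<theta> * (inverse (P \<gamma> \<theta>) * inverse (P \<gamma> \<theta>)))"
    using p(1,2) by (simp_all add: periodic_def)
  have "\<forall>\<^sub>F p in ?F. p \<in> U \<times> UNIV" by (simp add: eventually_inf_principal)
  then have "\<forall>\<^sub>F p in ?F. \<forall>\<theta>. P (fst p) \<theta> > 0"
    by (rule eventually_mono) (auto intro: pos)
  then show inv: "smooth_limit (\<lambda>p \<theta>. inverse (P (fst p) \<theta>)) (\<lambda>\<theta>. inverse (P \<gamma> \<theta>)) ?F"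
    by (intro smooth_limit_inverse p(3) pos \<gamma>)
  show "smooth_limit (\<lambda>p \<theta>. - P' (fst p) (snd p) \<theta> * (inverse (P (fst p) \<theta>) * inverse (P (fst p) \<theta>)))
      (\<lambda>\<theta>. - P' \<gamma> a \<theta> * (inverse (P \<gamma> \<theta>) * inverse (P \<gamma> \<theta>))) ?F"
    by (intro smooth_limit_bilinear[OF bounded_bilinear_mult]
        smooth_limit_bounded_linear[OF bounded_linear_minus[OF bounded_linear_ident]] p(4) inv)
  have "\<forall>\<^sub>F t in at 0. \<gamma> + t *\<^sub>R a \<in> U"
    using eventually_line_in_open[OF U \<gamma>] eventually_nhds_conv_at by blast
  then have ev: "\<forall>\<^sub>F t in at 0. \<forall>\<theta>. P (\<gamma> + t *\<^sub>R a) \<theta> > 0"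
    by (rule eventually_mono) (auto intro: pos)
  have "smooth_limit (\<lambda>t \<theta>. - ((P (\<gamma> + t *\<^sub>R a) \<theta> - P \<gamma> \<theta>) /\<^sub>R t) * (inverse (P (\<gamma> + t *\<^sub>R a) \<theta>) * inverse (P \<gamma> \<theta>)))
      (\<lambda>\<theta>. - P' \<gamma> a \<theta> * (inverse (P \<gamma> \<theta>) * inverse (P \<gamma> \<theta>))) (at 0)"
    by (intro smooth_limit_bilinear[OF bounded_bilinear_mult]
        smooth_limit_bounded_linear[OF bounded_linear_minus[OF bounded_linear_ident]] p(5)
        smooth_limit_inverse ev C1_operator_line[OF P \<gamma>] pos \<gamma> smooth_limit_const smooth_inverse p(6))
  then show "smooth_limit (\<lambda>t \<theta>. (inverse (P (\<gamma> + t *\<^sub>R a) \<theta>) - inverse (P \<gamma> \<theta>)) /\<^sub>R t)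
      (\<lambda>\<theta>. - P' \<gamma> a \<theta> * (inverse (P \<gamma> \<theta>) * inverse (P \<gamma> \<theta>))) (at 0)"
  proof (rule smooth_limit_cong[rotated])
    show "\<forall>\<^sub>F t in at 0. (\<lambda>\<theta>. - ((P (\<gamma> + t *\<^sub>R a) \<theta> - P \<gamma> \<theta>) /\<^sub>R t) * (inverse (P (\<gamma> + t *\<^sub>R a) \<theta>) * inverse (P \<gamma> \<theta>)))
        = (\<lambda>\<theta>. (inverse (P (\<gamma> + t *\<^sub>R a) \<theta>) - inverse (P \<gamma> \<theta>)) /\<^sub>R t)"
      using ev
    proof eventually_elim
      case (elim t)
      have "- ((x - y) /\<^sub>R t) * (inverse x * inverse y) = (inverse x - inverse y) /\<^sub>R t" if "x > 0" "y > 0" for x y :: real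
        using that by (cases "t = 0") (simp_all add: field_simps)
      then show ?case using elim pos[OF \<gamma>] by blast
    qed
  qed
qed

lemma Ck_on_cong:
  assumes "\<And>x. x \<in> U \<Longrightarrow> F x = G x" "Ck_on k U F"
  shows "Ck_on k U G"
proof -
  from assms(2) obtain D :: "nat \<Rightarrow> 'a \<Rightarrow> (nat \<Rightarrow> 'a) \<Rightarrow> 'b" where D: "\<forall>x\<in>U. \<forall>v. D 0 x v = F x"
    "\<forall>j<k. \<forall>x\<in>U. \<forall>v. ((\<lambda>t. (D j (x + t *\<^sub>R v j) v - D j x v) /\<^sub>R t) \<longlongrightarrow> D (Suc j) x v) (at 0)"
    "\<forall>j\<le>k. continuous_on (U \<times> UNIV) (\<lambda>(x, v). D j x v)"
    unfolding Ck_on_def by blast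
  from D(1) have "\<forall>x\<in>U. \<forall>v. D 0 x v = G x" using assms(1) by auto
  with D(2,3) show ?thesis unfolding Ck_on_def by blast
qed

lemma at_angle_minus: "at_angle (\<gamma> - \<delta>) = (\<lambda>\<theta>. at_angle \<gamma> \<theta> - at_angle \<delta> \<theta>)"
  unfolding minus_loop_def at_angle_plus uminus_loop.rep_eq by simp

lemma C1_operator_imp_Ck_on:
  assumes P: "C1_operator U P P'" and U: "open U"
  shows "Ck_on 1 U (\<lambda>\<gamma>. Abs_loop (P \<gamma>))"
proof -
  note d = C1_operatorD[OF P]
  \<comment> \<open>values at \<open>j > 1\<close> are irrelevant\<close>
  define D :: "nat \<Rightarrow> loop \<Rightarrow> (nat \<Rightarrow> loop) \<Rightarrow> loop" where
    "D j x v = (if j = 0 then Abs_loop (P x) else Abs_loop (P' x (v 0)))" for j x v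
  have rep: "at_angle (Abs_loop (P x)) = P x" "at_angle (Abs_loop (P' x a)) = P' x a" if "x \<in> U" for x a
    using d[OF that] by (simp_all add: at_angle_Abs_loop)
  have der: "((\<lambda>t. (D 0 (x + t *\<^sub>R v 0) v - D 0 x v) /\<^sub>R t) \<longlongrightarrow> D 1 x v) (at 0)" if x: "x \<in> U" for x v
  proof -
    have "\<forall>\<^sub>F t in at 0. x + t *\<^sub>R v 0 \<in> U"
      using eventually_line_in_open[OF U x] eventually_nhds_conv_at by blast
    then have "\<forall>\<^sub>F t in at 0. (\<lambda>\<theta>. (P (x + t *\<^sub>R v 0) \<theta> - P x \<theta>) /\<^sub>R t) =
        at_angle ((D 0 (x + t *\<^sub>R v 0) v - D 0 x v) /\<^sub>R t)"
      by eventually_elim (simp add: D_def at_angle_scaleR at_angle_minus rep x)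
    from smooth_limit_cong[OF this d(5)[OF x]] show ?thesis
      unfolding tendsto_loop_iff by (simp add: D_def rep x)
  qed
  have cont: "continuous_on (U \<times> UNIV) (\<lambda>(x, v). D j x v)" for j
    unfolding continuous_on_def
  proof
    fix p :: "loop \<times> (nat \<Rightarrow> loop)" assume "p \<in> U \<times> UNIV"
    then obtain \<gamma> v where p: "p = (\<gamma>, v)" and \<gamma>: "\<gamma> \<in> U" by auto
    let ?A = "at p within U \<times> UNIV"
    have ev: "\<forall>\<^sub>F q in ?A. q \<in> U \<times> UNIV" by (simp add: eventually_at_filter)
    have id: "((\<lambda>q. q) \<longlongrightarrow> p) ?A" by (rule tendsto_ident_at)
    have "((\<lambda>q. snd q 0) \<longlongrightarrow> v 0) ?A"
      using continuous_on_tendsto_compose[OF continuous_on_product_coordinates[of "0::nat"] tendsto_snd[OF id]] p by simp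
    moreover have "((\<lambda>q. fst q) \<longlongrightarrow> \<gamma>) ?A"
      using tendsto_fst[OF id] p by simp
    ultimately have "((\<lambda>q. (fst q, snd q 0)) \<longlongrightarrow> (\<gamma>, v 0)) ?A" by (intro tendsto_Pair)
    moreover have "\<forall>\<^sub>F q in ?A. (fst q, snd q 0) \<in> U \<times> UNIV"
      using ev by (auto elim: eventually_mono)
    ultimately have lim: "filterlim (\<lambda>q. (fst q, snd q 0)) (inf (nhds (\<gamma>, v 0)) (principal (U \<times> UNIV))) ?A"
      by (simp add: filterlim_inf filterlim_principal)
    show "((\<lambda>(x, v). D j x v) \<longlongrightarrow> (case p of (x, v) \<Rightarrow> D j x v)) ?A"
    proof (cases "j = 0")
      case True
      from smooth_limit_filter[OF d(3)[OF \<gamma>] lim] have lim1: "smooth_limit (\<lambda>q. P (fst q)) (P \<gamma>) ?A" by simp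
      have ev1: "\<forall>\<^sub>F q in ?A. P (fst q) = at_angle (case q of (x, v) \<Rightarrow> D j x v)"
        using ev by (rule eventually_mono) (auto simp: D_def True rep)
      have eq1: "at_angle (case p of (x, v) \<Rightarrow> D j x v) = P \<gamma>" by (simp add: p D_def True rep \<gamma>)
      show ?thesis
        unfolding tendsto_loop_iff eq1 by (rule smooth_limit_cong[OF ev1 lim1])
    next
      case False
      from smooth_limit_filter[OF d(4)[OF \<gamma>] lim] have lim1: "smooth_limit (\<lambda>q. P' (fst q) (snd q 0)) (P' \<gamma> (v 0)) ?A" by simp
      have ev1: "\<forall>\<^sub>F q in ?A. P' (fst q) (snd q 0) = at_angle (case q of (x, v) \<Rightarrow> D j x v)"
        using ev by (rule eventually_mono) (auto simp: D_def False rep)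
      have eq1: "at_angle (case p of (x, v) \<Rightarrow> D j x v) = P' \<gamma> (v 0)" by (simp add: p D_def False rep \<gamma>)
      show ?thesis
        unfolding tendsto_loop_iff eq1 by (rule smooth_limit_cong[OF ev1 lim1])
    qed
  qed
  have "D 0 x v = Abs_loop (P x)" for x v
    by (simp add: D_def)
  then show ?thesis
    unfolding Ck_on_def by (intro exI[of _ D]) (use der cont in auto)
qed

text \<open>The normal component is assembled from \<open>W \<circ> \<gamma>\<close> and the rotated velocity by bilinear operations and
one inversion.\<close>

lemma C1_field_induced_field:
  assumes W: "smooth W"
  shows "C1_field (induced_field W)"
  unfolding C1_field_def
proof
  show "\<forall>c\<in>Be. induced_field W c \<in> tangent_space c"
    using induced_field_tangent[OF W] by blast
  note inv = C1_operator_inverse[OF open_Emb C1_operator_bilinear[OF bounded_bilinear_inner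
        C1_operator_normal_at C1_operator_normal_at] normal_at_pos]
  note op = C1_operator_bilinear[OF bounded_bilinear_scaleR C1_operator_bilinear[OF bounded_bilinear_mult
        C1_operator_bilinear[OF bounded_bilinear_inner C1_operator_smooth_compose[OF W] C1_operator_normal_at] inv]
        C1_operator_normal_at]
  from C1_operator_imp_Ck_on[OF op open_Emb]
  show "Ck_on 1 Emb (\<lambda>\<gamma>. Abs_loop (\<lambda>\<theta>. induced_field W (curve \<gamma>) (at_angle \<gamma> \<theta>)))"
    by (rule Ck_on_cong[rotated]) (auto intro!: arg_cong[where f = Abs_loop] simp: induced_field_curve normal_part_def)
qed

section \<open>Tangential invariance and the Riemannian shape Hessian\<close>

text \<open>Displacing the angle by a bounded continuous amount is surjective onto the line, so the
reparametrized curve has the same image. No smallness of \<open>t\<close> is needed.\<close>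

lemma range_circle_map:
  fixes \<beta> :: "real \<Rightarrow> real"
  assumes "smooth \<beta>" "periodic \<beta>"
  shows "range (\<lambda>\<theta>. h (\<theta> + t * \<beta> \<theta>)) = range h"
proof -
  have "\<exists>\<theta>. \<theta> + t * \<beta> \<theta> = y" for y
  proof -
    obtain B where B: "\<And>\<theta>. \<theta> \<in> {0..2 * pi} \<Longrightarrow> \<bar>\<beta> \<theta>\<bar> \<le> B"
      using smooth_bounded_image[OF assms(1)] unfolding bounded_iff by force
    have bound: "\<bar>t * \<beta> \<theta>\<bar> \<le> \<bar>t\<bar> * B" for \<theta>
    proof -
      obtain \<theta>' n where t: "\<theta>' \<in> {0..<2 * pi}" "\<theta> = \<theta>' + 2 * pi * of_int n" using angle_reduction by blast
      then have "\<bar>\<beta> \<theta>\<bar> \<le> B" using periodic_int_shift[OF assms(2)] B[of \<theta>'] by simp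
      then show ?thesis by (simp add: abs_mult mult_left_mono)
    qed
    have "\<exists>\<theta>\<ge>y - \<bar>t\<bar> * B. \<theta> \<le> y + \<bar>t\<bar> * B \<and> \<theta> + t * \<beta> \<theta> = y"
    proof (rule IVT')
      show "y - \<bar>t\<bar> * B + t * \<beta> (y - \<bar>t\<bar> * B) \<le> y" using bound[of "y - \<bar>t\<bar> * B"] by linarith
      show "y \<le> y + \<bar>t\<bar> * B + t * \<beta> (y + \<bar>t\<bar> * B)" using bound[of "y + \<bar>t\<bar> * B"] by linarith
      show "y - \<bar>t\<bar> * B \<le> y + \<bar>t\<bar> * B" using bound[of 0] by linarith
      show "continuous_on {y - \<bar>t\<bar> * B..y + \<bar>t\<bar> * B} (\<lambda>\<theta>. \<theta> + t * \<beta> \<theta>)"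
        by (intro continuous_intros smooth_continuous_on assms)
    qed
    then show ?thesis by blast
  qed
  then have "range (\<lambda>\<theta>. \<theta> + t * \<beta> \<theta>) = UNIV" by (auto simp: surj_def) metis
  then show ?thesis by (metis image_image)
qed

lemma smooth_field_loop:
  assumes "smooth W"
  shows "at_angle (Abs_loop (\<lambda>\<theta>. W (at_angle \<gamma> \<theta>))) = (\<lambda>\<theta>. W (at_angle \<gamma> \<theta>))"
  using periodic_at_angle[of \<gamma>]
  by (intro at_angle_Abs_loop smooth_compose[OF assms smooth_at_angle]) (simp add: periodic_def)

lemma image_curve_perturbation:
  assumes "\<And>\<theta>. V (at_angle \<gamma> \<theta>) = at_angle a \<theta>"
  shows "(\<lambda>x. x + t *\<^sub>R V x) ` curve \<gamma> = curve (\<gamma> + t *\<^sub>R a)"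
  using assms by (auto simp: curve_def image_image at_angle_plus at_angle_scaleR)

text \<open>The path \<open>t \<mapsto> \<gamma> + t a t\<close> need only parametrize the perturbed curves, and may be chosen differently from
\<open>\<gamma> + t V \<circ> \<gamma>\<close>.\<close>

lemma shape_deriv_eqI:
  assumes "\<And>t. (\<lambda>x. x + t *\<^sub>R V x) ` curve \<gamma> = curve (\<gamma> + t *\<^sub>R a t)"
    and "((\<lambda>t. (f (curve (\<gamma> + t *\<^sub>R a t)) - f (curve \<gamma>)) / t) \<longlongrightarrow> D) (at 0)"
  shows "shape_deriv f (curve \<gamma>) V = D"
  unfolding shape_deriv_def assms(1) using assms(2)
  by (intro DERIV_imp_deriv) (simp add: DERIV_def)

text \<open>Tangential parts of a perturbation do not contribute to the first shape derivative. The curves moved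
by the normal part \<open>N\<close> of \<open>W\<close> are reparametrized by \<open>\<theta> \<mapsto> \<theta> + t \<beta> \<theta>\<close>, where \<open>\<beta>\<close> is the tangential
component of \<open>W\<close> relative to the velocity. The resulting path of loops has initial velocity
\<open>\<beta> \<gamma>' + N = W \<circ> \<gamma>\<close>, so both shape derivatives are the derivative of the lifted functional at
\<open>\<gamma>\<close> in direction \<open>W \<circ> \<gamma>\<close>.\<close>

lemma shape_deriv_induced_field:
  assumes f: "Ck_functional (Suc k) f" and W: "smooth W" and c: "c \<in> Be"
  shows "shape_deriv f c (induced_field W c) = shape_deriv f c W"
proof -
  obtain \<gamma> where \<gamma>: "\<gamma> \<in> Emb" and c: "c = curve \<gamma>" using c by (auto simp: Be_def)
  let ?g = "at_angle \<gamma>" and ?N = "normal_part W \<gamma>"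
  obtain DF where DF: "\<And>x v. x \<in> Emb \<Longrightarrow> ((\<lambda>t. (f (curve (x + t *\<^sub>R v)) - f (curve x)) / t) \<longlongrightarrow> DF x v) (at 0)"
    and cont: "continuous_on (Emb \<times> UNIV) (\<lambda>(x, v). DF x v)"
    using Ck_on_Suc_obtain_derivative[OF f[unfolded Ck_functional_def] open_Emb] by blast
  define A where "A = Abs_loop (\<lambda>\<theta>. W (?g \<theta>))"
  have A: "at_angle A = (\<lambda>\<theta>. W (?g \<theta>))" unfolding A_def by (rule smooth_field_loop[OF W])
  define \<beta> where "\<beta> \<theta> = (W (?g \<theta>) \<bullet> vd ?g \<theta>) * inverse (normal_at \<gamma> \<theta> \<bullet> normal_at \<gamma> \<theta>)" for \<theta>
  have s\<beta>: "smooth \<beta>" unfolding \<beta>_def[abs_def]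
    by (rule smooth_mult[OF smooth_inner[OF smooth_compose[OF W smooth_at_angle] smooth_vd[OF smooth_at_angle]]
          smooth_inverse[OF smooth_inner[OF smooth_normal_at smooth_normal_at] normal_at_pos[OF \<gamma>]]])
  have p\<beta>: "periodic \<beta>"
    using periodic_at_angle[of \<gamma>] periodic_normal_at[of \<gamma>] periodic_vd[OF smooth_at_angle periodic_at_angle, of \<gamma>]
    by (simp add: periodic_def \<beta>_def)
  have split: "W (?g \<theta>) = \<beta> \<theta> *\<^sub>R vd ?g \<theta> + ?N \<theta>" for \<theta>
    using rot_frame_expansion[OF Emb_D(1)[OF \<gamma>], of "W (?g \<theta>)" \<theta>]
    by (simp add: \<beta>_def normal_part_def normal_at_def inner_rot_rot divide_inverse)
  \<comment> \<open>at \<open>t = 0\<close> the quotient is \<open>0\<close>, and the value of \<open>a 0\<close> does not matter\<close>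
  define a where "a t = Abs_loop (\<lambda>\<theta>. (?g (\<theta> + t *\<^sub>R \<beta> \<theta>) - ?g \<theta>) /\<^sub>R t + ?N (\<theta> + t *\<^sub>R \<beta> \<theta>))" for t
  have a: "at_angle (a t) = (\<lambda>\<theta>. (?g (\<theta> + t *\<^sub>R \<beta> \<theta>) - ?g \<theta>) /\<^sub>R t + ?N (\<theta> + t *\<^sub>R \<beta> \<theta>))" for t
    unfolding a_def
  proof (rule at_angle_Abs_loop)
    have \<phi>: "smooth (\<lambda>\<theta>. \<theta> + t *\<^sub>R \<beta> \<theta>)" by (intro smooth_add smooth_id_real smooth_scaleR s\<beta>)
    show "smooth (\<lambda>\<theta>. (?g (\<theta> + t *\<^sub>R \<beta> \<theta>) - ?g \<theta>) /\<^sub>R t + ?N (\<theta> + t *\<^sub>R \<beta> \<theta>))"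
      by (intro smooth_add smooth_scaleR smooth_diff smooth_at_angle smooth_compose[OF smooth_at_angle \<phi>]
          smooth_compose[OF smooth_normal_part[OF W \<gamma>] \<phi>])
    have shift: "\<theta> + 2 * pi + t *\<^sub>R \<beta> (\<theta> + 2 * pi) = \<theta> + t *\<^sub>R \<beta> \<theta> + 2 * pi" for \<theta>
      using p\<beta> by (simp add: periodic_def)
    show "periodic (\<lambda>\<theta>. (?g (\<theta> + t *\<^sub>R \<beta> \<theta>) - ?g \<theta>) /\<^sub>R t + ?N (\<theta> + t *\<^sub>R \<beta> \<theta>))"
      using periodic_at_angle[of \<gamma>] periodic_normal_part[of W \<gamma>] by (simp only: periodic_def shift simp_thms)
  qed
  have lim: "(a \<longlongrightarrow> A) (at 0)"
  proof -
    have q: "smooth_limit (\<lambda>t \<theta>. (?g (\<theta> + t *\<^sub>R \<beta> \<theta>) - ?g \<theta>) /\<^sub>R t) (\<lambda>\<theta>. frechet_derivative ?g (at \<theta>) (\<beta> \<theta>)) (at 0)"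
      by (rule smooth_limit_difference_quotient[OF smooth_at_angle smooth_id_real s\<beta>])
    have n: "smooth_limit (\<lambda>t \<theta>. ?N (\<theta> + t *\<^sub>R \<beta> \<theta>)) ?N (at 0)"
      by (rule smooth_limit_compose[OF smooth_normal_part[OF W \<gamma>] smooth_limit_line[OF smooth_id_real s\<beta>]])
    have "frechet_derivative ?g (at \<theta>) = (\<lambda>v. v *\<^sub>R vd ?g \<theta>)" for \<theta>
      using smooth_has_vector_derivative[OF smooth_at_angle] frechet_derivative_at unfolding has_vector_derivative_def by metis
    then have "(\<lambda>\<theta>. frechet_derivative ?g (at \<theta>) (\<beta> \<theta>) + ?N \<theta>) = at_angle A"
      by (simp add: A split fun_eq_iff)
    with smooth_limit_add[OF q n] show ?thesis unfolding tendsto_loop_iff a by simp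
  qed
  have "shape_deriv f (curve \<gamma>) W = DF \<gamma> A"
    by (rule shape_deriv_eqI[OF image_curve_perturbation DF[OF \<gamma>]]) (simp add: A)
  moreover have "shape_deriv f (curve \<gamma>) (induced_field W (curve \<gamma>)) = DF \<gamma> A"
  proof (rule shape_deriv_eqI)
    show "((\<lambda>t. (f (curve (\<gamma> + t *\<^sub>R a t)) - f (curve \<gamma>)) / t) \<longlongrightarrow> DF \<gamma> A) (at 0)"
      by (rule derivative_along_path[OF open_Emb DF cont \<gamma> lim])
    fix t
    have "(\<lambda>x. x + t *\<^sub>R induced_field W (curve \<gamma>) x) ` curve \<gamma> = range (\<lambda>\<theta>. ?g \<theta> + t *\<^sub>R ?N \<theta>)"
      by (simp add: curve_def image_image) (simp add: curve_def[symmetric] induced_field_curve[OF \<gamma>])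
    also have "\<dots> = range (\<lambda>\<theta>. ?g (\<theta> + t * \<beta> \<theta>) + t *\<^sub>R ?N (\<theta> + t * \<beta> \<theta>))"
      using range_circle_map[OF s\<beta> p\<beta>, of "\<lambda>\<theta>. ?g \<theta> + t *\<^sub>R ?N \<theta>" t] by simp
    also have "\<dots> = curve (\<gamma> + t *\<^sub>R a t)"
      by (cases "t = 0") (simp_all add: curve_def at_angle_plus at_angle_scaleR a scaleR_add_right)
    finally show "(\<lambda>x. x + t *\<^sub>R induced_field W (curve \<gamma>) x) ` curve \<gamma> = curve (\<gamma> + t *\<^sub>R a t)" .
  qed
  ultimately show ?thesis by (simp add: c)
qed

text \<open>Since embeddings form an open set, small perturbations of a curve in \<open>Be\<close> stay in \<open>Be\<close>.\<close>

lemma shape_deriv_cong: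
  assumes "\<And>c'. c' \<in> Be \<Longrightarrow> \<phi> c' = \<psi> c'" "smooth V" "c \<in> Be"
  shows "shape_deriv \<phi> c V = shape_deriv \<psi> c V"
proof -
  obtain \<gamma> where \<gamma>: "\<gamma> \<in> Emb" "c = curve \<gamma>" using assms(3) by (auto simp: Be_def)
  define A where "A = Abs_loop (\<lambda>\<theta>. V (at_angle \<gamma> \<theta>))"
  have img: "(\<lambda>x. x + t *\<^sub>R V x) ` c = curve (\<gamma> + t *\<^sub>R A)" for t
    unfolding \<gamma>(2) by (rule image_curve_perturbation) (simp add: A_def smooth_field_loop[OF assms(2)])
  have "\<forall>\<^sub>F t in nhds 0. \<gamma> + t *\<^sub>R A \<in> Emb"
    by (rule eventually_line_in_open[OF open_Emb \<gamma>(1)])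
  then have "\<forall>\<^sub>F t in nhds 0. \<phi> (curve (\<gamma> + t *\<^sub>R A)) = \<psi> (curve (\<gamma> + t *\<^sub>R A))"
    by (rule eventually_mono) (auto intro: assms(1) simp: Be_def)
  then show ?thesis
    unfolding shape_deriv_def img by (rule deriv_cong_ev) simp
qed

lemma induced_field_orthogonal:
  "orthogonal_to_curve c V \<Longrightarrow> induced_field V c = restrict_to c V"
  by (auto simp: orthogonal_to_curve_def induced_field_def restrict_to_def)

theorem theorem2p3:
  fixes G :: shape_metric
    and nabla :: shape_connection
    and f :: shape_functional
    and gradf :: shape_field
    and \<Omega> :: "plane set"
    and V W :: "plane \<Rightarrow> plane"
  assumes "riemannian_metric G"
    and "riemannian_connection G nabla"
    and "twice_shape_differentiable f"
    and "is_gradient G f gradf"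
    and "shape \<Omega>"
    and "smooth V" and "smooth W"
    and "orthogonal_to_curve (frontier \<Omega>) V"
    and "orthogonal_to_curve (frontier \<Omega>) W"
  shows "G (frontier \<Omega>) (riemannian_shape_hessian nabla gradf (frontier \<Omega>) V) (restrict_to (frontier \<Omega>) W)
           = shape_hessian f (frontier \<Omega>) W V
             - shape_deriv f (frontier \<Omega>) (nabla_plane nabla (frontier \<Omega>) V W)
       \<and> G (frontier \<Omega>) (riemannian_shape_hessian nabla gradf (frontier \<Omega>) V) (restrict_to (frontier \<Omega>) W)
           = G (frontier \<Omega>) (restrict_to (frontier \<Omega>) V) (riemannian_shape_hessian nabla gradf (frontier \<Omega>) W)"
proof -
  define c where "c = frontier \<Omega>"
  have c: "c \<in> Be" using \<open>shape \<Omega>\<close> by (simp add: shape_def c_def)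
  have f: "Ck_functional (Suc 1) f" using assms(3) by (simp add: numeral_2_eq_2)
  have grad: "C1_field gradf" "\<And>c' h. c' \<in> Be \<Longrightarrow> h \<in> tangent_space c' \<Longrightarrow> G c' (gradf c') h = shape_deriv f c' h"
    using assms(4) unfolding is_gradient_def by blast+
  have cov: "nabla c h X \<in> tangent_space c" if "h \<in> tangent_space c" "C1_field X" for h X
    using assms(2) that c unfolding riemannian_connection_def covariant_derivative_def by blast
  have compat: "shape_deriv (\<lambda>c'. G c' (X c') (Y c')) c h = G c (nabla c h X) (Y c) + G c (X c) (nabla c h Y)"
    if "C1_field X" "C1_field Y" "h \<in> tangent_space c" for X Y h
    using assms(2) that c unfolding riemannian_connection_def metric_compatible_def by blast
  have gradc: "gradf c \<in> tangent_space c" using grad(1) c by (simp add: C1_field_def)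

  \<comment> \<open>metric compatibility for the pair \<open>gradf\<close>, \<open>induced_field Z\<close>\<close>
  have formula: "G c (nabla c (restrict_to c U) gradf) (restrict_to c Z)
      = shape_hessian f c Z U - shape_deriv f c (nabla c (restrict_to c U) (induced_field Z))"
    if U: "smooth U" "orthogonal_to_curve c U" and Z: "smooth Z" "orthogonal_to_curve c Z" for U Z
  proof -
    let ?h = "restrict_to c U" and ?Z = "induced_field Z"
    have h: "?h \<in> tangent_space c"
      using induced_field_tangent[OF U(1) c] by (simp add: induced_field_orthogonal[OF U(2)])
    have CZ: "C1_field ?Z" by (rule C1_field_induced_field[OF Z(1)])
    have "G c' (gradf c') (?Z c') = shape_deriv f c' Z" if "c' \<in> Be" for c'
      using grad(2)[OF that induced_field_tangent[OF Z(1) that]] shape_deriv_induced_field[OF f Z(1) that] by simp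
    then have "shape_deriv (\<lambda>c'. G c' (gradf c') (?Z c')) c U = shape_hessian f c Z U"
      unfolding shape_hessian_def by (rule shape_deriv_cong[OF _ U(1) c])
    moreover have "shape_deriv (\<lambda>c'. G c' (gradf c') (?Z c')) c ?h = shape_deriv (\<lambda>c'. G c' (gradf c') (?Z c')) c U"
      by (rule shape_deriv_extension[symmetric]) simp
    ultimately show ?thesis
      using compat[OF grad(1) CZ h] grad(2)[OF c cov[OF h CZ]] induced_field_orthogonal[OF Z(2)] by simp
  qed

  have o: "orthogonal_to_curve c V" "orthogonal_to_curve c W" using assms(8,9) by (simp_all add: c_def)
  let ?X = "induced_field V" and ?Y = "induced_field W"
  have X: "C1_field ?X" and Y: "C1_field ?Y"
    using C1_field_induced_field assms(6,7) by blast+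
  have Xc: "?X c = restrict_to c V" and Yc: "?Y c = restrict_to c W"
    using induced_field_orthogonal o by blast+
  have tX: "?X c \<in> tangent_space c" and tY: "?Y c \<in> tangent_space c"
    using induced_field_tangent assms(6,7) c by blast+
  have second: "field_action (induced_field U) (field_action (induced_field Z) f) c = shape_hessian f c Z U"
    if "smooth U" "orthogonal_to_curve c U" "smooth Z" for U Z
  proof -
    have "field_action (induced_field U) (field_action (induced_field Z) f) c
        = shape_deriv (field_action (induced_field Z) f) c U"
      unfolding field_action_def[of "induced_field U"] induced_field_orthogonal[OF that(2)]
      by (rule shape_deriv_extension[symmetric]) simp
    also have "\<dots> = shape_hessian f c Z U"
      unfolding shape_hessian_def
      by (rule shape_deriv_cong[OF _ that(1) c]) (simp add: field_action_def shape_deriv_induced_field[OF f that(3)])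
    finally show ?thesis .
  qed

  let ?XY = "nabla c (?X c) ?Y" and ?YX = "nabla c (?Y c) ?X"
  have tXY: "?XY \<in> tangent_space c" and tYX: "?YX \<in> tangent_space c"
    using cov tX tY X Y by blast+
  have "is_lie_bracket ?X ?Y (\<lambda>c x. nabla c (?X c) ?Y x - nabla c (?Y c) ?X x)"
    using assms(2) X Y unfolding riemannian_connection_def torsion_free_def by blast
  then have tD: "(\<lambda>x. ?XY x - ?YX x) \<in> tangent_space c"
    and "field_action (\<lambda>c x. nabla c (?X c) ?Y x - nabla c (?Y c) ?X x) f c
      = field_action ?X (field_action ?Y f) c - field_action ?Y (field_action ?X f) c"
    using assms(3) c unfolding is_lie_bracket_def by blast+
  \<comment> \<open>evaluated at \<open>f\<close>, absence of torsion turns the commutator into a difference of Hessians\<close>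
  then have bracket: "shape_deriv f c (\<lambda>x. ?XY x - ?YX x) = shape_hessian f c W V - shape_hessian f c V W"
    using second assms(6,7) o by (simp add: field_action_def)
  have lin: "G c (\<lambda>x. a *\<^sub>R h x + b *\<^sub>R k x) l = a * G c h l + b * G c k l"
    if "h \<in> tangent_space c" "k \<in> tangent_space c" "l \<in> tangent_space c" for h k l a b
    using assms(1) c that unfolding riemannian_metric_def by blast
  have sym: "G c h k = G c k h" if "h \<in> tangent_space c" "k \<in> tangent_space c" for h k
    using assms(1) c that unfolding riemannian_metric_def by blast
  have "shape_deriv f c (\<lambda>x. ?XY x - ?YX x) = G c (\<lambda>x. ?XY x - ?YX x) (gradf c)"
    using grad(2)[OF c tD] sym[OF gradc tD] by simp
  also have "\<dots> = G c ?XY (gradf c) - G c ?YX (gradf c)"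
    using lin[OF tXY tYX gradc, of 1 "-1"] by simp
  also have "\<dots> = shape_deriv f c ?XY - shape_deriv f c ?YX"
    using grad(2)[OF c tXY] grad(2)[OF c tYX] sym[OF gradc tXY] sym[OF gradc tYX] by simp
  finally have diff: "shape_hessian f c W V - shape_deriv f c ?XY = shape_hessian f c V W - shape_deriv f c ?YX"
    using bracket by simp

  have 1: "G c (nabla c (restrict_to c V) gradf) (restrict_to c W) = shape_hessian f c W V - shape_deriv f c ?XY"
    using formula[OF assms(6) o(1) assms(7) o(2)] by (simp add: Xc)
  also have "\<dots> = G c (nabla c (restrict_to c W) gradf) (restrict_to c V)"
    using formula[OF assms(7) o(2) assms(6) o(1)] diff by (simp add: Yc)
  also have "\<dots> = G c (restrict_to c V) (nabla c (restrict_to c W) gradf)"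
    using sym cov[OF _ grad(1)] tX tY by (simp add: Xc Yc)
  finally show ?thesis
    using 1 unfolding c_def riemannian_shape_hessian_def nabla_plane_def by (simp add: Xc[unfolded c_def])
qed

end
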